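(* Let $d\ge1$ be an integer, let $(\xi_{\mathbf n})_{\mathbf n\in\mathbb Z^d}$ be a stationary random field of real random variables, let $f$ be a measurable function, and let $X_{\mathbf k}=f(\xi_{\mathbf j},\ \mathbf j\le\mathbf k)$ for $\mathbf k\in\mathbb Z^d$, with $X_{\mathbf 0}$ integrable. Let $\mathcal F_{\mathbf k}=\sigma(\xi_{\mathbf u},\ \mathbf u\le\mathbf k)$ and $S_{\mathbf u}=\sum_{\mathbf 1\le\mathbf k\le\mathbf u}X_{\mathbf k}$. Assume that the filtration is commuting in the sense that for all integers $a\ge u$, all $\mathbf b,\mathbf v\in\mathbb Z^{d-1}$ and every integrable random variable $X$, $$E(E(X|\mathcal F_{a,\mathbf b})|\mathcal F_{u,\mathbf v})=E(X|\mathcal F_{u,\mathbf b\wedge\mathbf v})\quad\text{a.s.}$$ Assume that $$\sum_{\mathbf u\ge\mathbf 1}\frac{1}{|\mathbf u|^{3/2}}\|E(S_{\mathbf u}|\mathcal F_{\mathbf 1})\|<\infty ,$$ and that the shift $T_1$ is ergodic. Then there is a constant $c$ such that $$\frac{1}{|\mathbf n|}E(S_{\mathbf n}^2)\to c^2\quad\text{as }\min(n_1,\dots,n_d)\to\infty$$ and $$\frac{1}{\sqrt{|\mathbf n|}}S_{\mathbf n}\Rightarrow N(0,c^2)\quad\text{as }\min(n_1,\dots,n_d)\to\infty .$$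
   Context: $\|\cdot\|$ is the norm in $L^2$; $\Rightarrow$ denotes convergence in distribution. For $\mathbf j,\mathbf k\in\mathbb Z^d$, $\mathbf j\le\mathbf k$ means $j_i\le k_i$ for all $i$; $\mathbf b\wedge\mathbf v$ is the coordinatewise minimum; $\mathbf 0=(0,\dots,0)$, $\mathbf 1=(1,\dots,1)$; $|\mathbf n|=n_1\cdots n_d$. An index $(a,\mathbf b)$ with $a\in\mathbb Z$, $\mathbf b\in\mathbb Z^{d-1}$ is the element of $\mathbb Z^d$ with first coordinate $a$ and remaining coordinates $\mathbf b$. The notation $X_{\mathbf k}=f(\xi_{\mathbf j},\ \mathbf j\le\mathbf k)$ means that the same measurable function $f$ is applied to the translated field, $X_{\mathbf k}=f\big((\xi_{\mathbf k-\mathbf j})_{\mathbf j\ge\mathbf 0}\big)$. $T_1$ is the shift by one unit in the first coordinate, acting on realizations of the field $\xi$ by $(T_1x)_{(i,\mathbf j)}=x_{(i+1,\mathbf j)}$; it is ergodic if every $T_1$-invariant event has probability $0$ or $1$ under the law of $\xi$. $N(0,0)$ is the point mass at $0$. *)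

theory Defs
  imports "HOL-Probability.Probability"
begin

text \<open>
  The lattice of dimension \<open>d \<ge> 1\<close> is \<^typ>\<open>int ^ 'd\<close> with \<open>d = CARD('d)\<close>, ordered coordinatewise
  by the library order on vectors; \<open>0\<close> and \<open>1\<close> are the constant vectors.  The index type carries
  no enumeration, so the coordinate regarded as the first one is passed as a parameter
  \<open>i\<^sub>0 :: 'd\<close>; the remaining \<open>d - 1\<close> coordinates may well be absent.
\<close>

text \<open>
  The index \<open>(a, b)\<close>.  The element \<open>b\<close> of the lattice of dimension \<open>d - 1\<close> is given as a vector
  with \<open>d\<close> coordinates whose coordinate \<open>i\<^sub>0\<close> is ignored.
\<close>

definition idx :: "'d \<Rightarrow> int \<Rightarrow> int ^ 'd \<Rightarrow> int ^ 'd" where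
  "idx i\<^sub>0 a b = (\<chi> i. if i = i\<^sub>0 then a else b $ i)"

definition vmin :: "int ^ 'd \<Rightarrow> int ^ 'd \<Rightarrow> int ^ 'd" where
  "vmin b v = (\<chi> i. min (b $ i) (v $ i))"

definition vol :: "int ^ 'd \<Rightarrow> real" where
  "vol n = real_of_int (\<Prod>i\<in>UNIV. n $ i)"

definition min_at_top :: "(int ^ 'd) filter" where
  "min_at_top = filtercomap (\<lambda>n. MIN i. n $ i) at_top"

definition field_law :: "'a measure \<Rightarrow> (int ^ 'd \<Rightarrow> 'a \<Rightarrow> real) \<Rightarrow> (int ^ 'd \<Rightarrow> real) measure" where
  "field_law M \<xi> = distr M (\<Pi>\<^sub>M n\<in>UNIV. borel) (\<lambda>\<omega> n. \<xi> n \<omega>)"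

definition stationary_field :: "'a measure \<Rightarrow> (int ^ 'd \<Rightarrow> 'a \<Rightarrow> real) \<Rightarrow> bool" where
  "stationary_field M \<xi> \<longleftrightarrow>
     (\<forall>n. \<xi> n \<in> borel_measurable M) \<and>
     (\<forall>h. field_law M (\<lambda>n. \<xi> (n + h)) = field_law M \<xi>)"

definition coord_shift :: "'d \<Rightarrow> (int ^ 'd \<Rightarrow> real) \<Rightarrow> (int ^ 'd \<Rightarrow> real)" where
  "coord_shift i\<^sub>0 x = (\<lambda>n. x (n + axis i\<^sub>0 1))"

definition ergodic_shift :: "'a measure \<Rightarrow> (int ^ 'd \<Rightarrow> 'a \<Rightarrow> real) \<Rightarrow> 'd \<Rightarrow> bool" where
  "ergodic_shift M \<xi> i\<^sub>0 \<longleftrightarrow>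
     (\<forall>A\<in>sets (field_law M \<xi>). coord_shift i\<^sub>0 -` A = A \<longrightarrow>
        measure (field_law M \<xi>) A = 0 \<or> measure (field_law M \<xi>) A = 1)"

definition causal_field ::
    "((int ^ 'd \<Rightarrow> real) \<Rightarrow> real) \<Rightarrow> (int ^ 'd \<Rightarrow> 'a \<Rightarrow> real) \<Rightarrow> int ^ 'd \<Rightarrow> 'a \<Rightarrow> real" where
  "causal_field f \<xi> k \<omega> = f (\<lambda>j\<in>{0..}. \<xi> (k - j) \<omega>)"

definition past :: "'a measure \<Rightarrow> (int ^ 'd \<Rightarrow> 'a \<Rightarrow> real) \<Rightarrow> int ^ 'd \<Rightarrow> 'a measure" where
  "past M \<xi> k = sigma (space M) {\<xi> u -` B \<inter> space M | u B. u \<le> k \<and> B \<in> sets borel}"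

definition commuting :: "'a measure \<Rightarrow> (int ^ 'd \<Rightarrow> 'a measure) \<Rightarrow> 'd \<Rightarrow> bool" where
  "commuting M F i\<^sub>0 \<longleftrightarrow>
     (\<forall>a u b v. \<forall>X :: 'a \<Rightarrow> real. u \<le> a \<longrightarrow> integrable M X \<longrightarrow>
        (AE \<omega> in M. real_cond_exp M (F (idx i\<^sub>0 u v)) (real_cond_exp M (F (idx i\<^sub>0 a b)) X) \<omega>
                  = real_cond_exp M (F (idx i\<^sub>0 u (vmin b v))) X \<omega>))"

definition part_sum :: "(int ^ 'd \<Rightarrow> 'a \<Rightarrow> real) \<Rightarrow> int ^ 'd \<Rightarrow> 'a \<Rightarrow> real" where
  "part_sum X u \<omega> = (\<Sum>k\<in>{1..u}. X k \<omega>)"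

text \<open>The norm is \<open>\<infinity>\<close> for variables that are not square integrable.\<close>

definition L2_norm :: "'a measure \<Rightarrow> ('a \<Rightarrow> real) \<Rightarrow> ennreal" where
  "L2_norm M Y =
     (if integrable M (\<lambda>\<omega>. (Y \<omega>)\<^sup>2) then ennreal (sqrt (\<integral>\<omega>. (Y \<omega>)\<^sup>2 \<partial>M)) else \<infinity>)"

text \<open>
  The library's \<^const>\<open>weak_conv_m\<close> with an arbitrary filter instead of \<^const>\<open>sequentially\<close>.
\<close>

definition weak_conv_filter ::
    "('i \<Rightarrow> real measure) \<Rightarrow> real measure \<Rightarrow> 'i filter \<Rightarrow> bool" where
  "weak_conv_filter \<mu> \<nu> G \<longleftrightarrow>
     (\<forall>x. isCont (cdf \<nu>) x \<longrightarrow> ((\<lambda>n. cdf (\<mu> n) x) \<longlongrightarrow> cdf \<nu> x) G)"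

definition centered_normal :: "real \<Rightarrow> real measure" where
  "centered_normal v =
     (if v = 0 then return borel 0 else density lborel (\<lambda>x. ennreal (normal_density 0 (sqrt v) x)))"

end

theory Submission
  imports Defs
begin

text \<open>
  The proof approximates the field by orthomartingale differences and proves the central limit
  theorem for these.  Everything takes place on the canonical space, where the translations act and
  \<open>X\<^sub>k\<close> is the translate by \<open>k\<close> of one function of the past of \<open>0\<close>.  Commutation makes the conditional
  expectations \<open>E\<^sub>k\<close> a commuting family of projections with \<open>E\<^sub>k E\<^sub>l = E\<^bsub>k \<and> l\<^esub>\<close>, and every argument
  proceeds one direction at a time.

  \<^bold>\<open>Approximation.\<close>  When a box is doubled in one direction, its new half is correlated with the old one
  only through its projection on the past of the old half, and by commutation that projection is
  again a box sum over the other directions (\<open>box_doubling\<close>).  Iterating over dyadic scales and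
  over directions bounds the norm of the sum over a box, divided by the square root of the volume, by
  a constant times a dyadic form of the projective series (\<open>box_sum_bound\<close>); the series of the theorem
  dominates its dyadic form because \<open>u \<mapsto> E(S\<^sub>u | F\<^sub>1)\<close> is subadditive in norm (\<open>dyadic_sum_le\<close>).  In a
  single direction, averaging the potential over \<open>m\<close> steps writes a function as a martingale
  difference plus a coboundary plus a remainder (\<open>martingale_step\<close>).  The coboundary telescopes, and the
  dyadic seminorm of the remainder tends to \<open>0\<close> by dominated convergence.  Treating all directions and
  truncating yields bounded orthomartingale differences \<open>D\<close> whose box sums are arbitrarily close to
  those of \<open>X\<close> in mean square, relative to the volume (\<open>bounded_orthomartingale_approximation\<close>).

  \<^bold>\<open>Central limit theorem for bounded \<open>D\<close>.\<close>  Cut the box into slices orthogonal to the first direction.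
  The normalised slice sums are martingale differences, so by McLeish's method
  (\<open>martingale_clt_bound\<close>) it suffices that the average of their squares tends to the variance.
  For slices of a fixed size this is the ergodic theorem for the first shift; the difficulty is that
  the slices grow simultaneously and in an arbitrary manner.  Expanding the squares in a further
  direction leaves a diagonal part, which is an average of the same quantities for smaller slices, and
  an off-diagonal part, which is a martingale in that direction.  The second moment of the latter is
  small as soon as the empirical covariances of finitely many translated slices are small: inside a
  block of fixed length the slices, seen as vectors indexed by the first coordinate, are then almost
  orthogonal, and a Bessel inequality gains the square root of the block length
  (\<open>martingale_bilinear_bound\<close>).  The ergodicity of the first shift enters through
  \<open>slice_covariance\<close>, which carries these covariances through the induction over the directions.

  \<^bold>\<open>Conclusion.\<close>  Box sums of \<open>D\<close> have second moment exactly the volume times the variance of \<open>D\<close>.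
  Hence the standard deviations of the approximations form a Cauchy sequence; its limit is \<open>c\<close>, and the
  characteristic functions converge to that of the normal law of variance \<open>c\<^sup>2\<close>
  (\<open>projective_clt\<close>).
\<close>

section \<open>Square integrable functions\<close>

context prob_space begin

definition L2 :: "('a \<Rightarrow> real) set" where
  "L2 = {g \<in> borel_measurable M. integrable M (\<lambda>x. (g x)\<^sup>2)}"

definition nrm :: "('a \<Rightarrow> real) \<Rightarrow> real" where
  "nrm g = sqrt (\<integral>x. (g x)\<^sup>2 \<partial>M)"

lemma L2_meas [measurable_dest]: "g \<in> L2 \<Longrightarrow> g \<in> borel_measurable M"
  by (simp add: L2_def)

lemma L2_sq: "g \<in> L2 \<Longrightarrow> integrable M (\<lambda>x. (g x)\<^sup>2)"
  by (simp add: L2_def)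

lemma L2_mult: assumes "f \<in> L2" "g \<in> L2" shows "integrable M (\<lambda>x. f x * g x)"
proof (rule Bochner_Integration.integrable_bound[of M "\<lambda>x. (f x)\<^sup>2 + (g x)\<^sup>2"])
  show "integrable M (\<lambda>x. (f x)\<^sup>2 + (g x)\<^sup>2)" using assms L2_sq by auto
  show "(\<lambda>x. f x * g x) \<in> borel_measurable M" using assms[THEN L2_meas] by measurable
  have "\<bar>a * b\<bar> \<le> a\<^sup>2 + b\<^sup>2" for a b :: real
  proof -
    have "2 * \<bar>a * b\<bar> \<le> a\<^sup>2 + b\<^sup>2"
      using zero_le_power2[of "\<bar>a\<bar> - \<bar>b\<bar>"] by (simp add: power2_diff abs_mult)
    then show ?thesis by simp
  qed
  then show "AE x in M. norm (f x * g x) \<le> norm ((f x)\<^sup>2 + (g x)\<^sup>2)" by auto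
qed

lemma L2_bounded: assumes "g \<in> borel_measurable M" "\<And>x. \<bar>g x\<bar> \<le> K" shows "g \<in> L2"
proof -
  have "integrable M (\<lambda>x. (g x)\<^sup>2)"
  proof (rule integrable_const_bound[of _ "K\<^sup>2"])
    show "AE x in M. norm ((g x)\<^sup>2) \<le> K\<^sup>2"
      using assms(2) by (auto simp: abs_le_square_iff[symmetric] power2_abs intro: order_trans[OF _ abs_ge_self])
    show "(\<lambda>x. (g x)\<^sup>2) \<in> borel_measurable M" using assms(1) by measurable
  qed
  then show ?thesis using assms by (simp add: L2_def)
qed

lemma L2_const: "(\<lambda>x. c) \<in> L2" by (rule L2_bounded[where K="\<bar>c\<bar>"]) auto

lemma L2_integrable: assumes "g \<in> L2" shows "integrable M g"
  using L2_mult[OF assms L2_const[of 1]] by simp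

lemma L2_cmult: assumes "g \<in> L2" shows "(\<lambda>x. c * g x) \<in> L2"
  using assms by (auto simp: L2_def power_mult_distrib)

lemma L2_add: assumes "f \<in> L2" "g \<in> L2" shows "(\<lambda>x. f x + g x) \<in> L2"
proof -
  have "integrable M (\<lambda>x. (f x)\<^sup>2 + 2 * (f x * g x) + (g x)\<^sup>2)"
    using assms L2_sq L2_mult by (intro Bochner_Integration.integrable_add integrable_mult_right) auto
  then show ?thesis using assms[THEN L2_meas] by (simp add: L2_def power2_sum mult.assoc algebra_simps)
qed

lemma L2_diff: assumes "f \<in> L2" "g \<in> L2" shows "(\<lambda>x. f x - g x) \<in> L2"
  using L2_add[OF assms(1) L2_cmult[OF assms(2), of "-1"]] by simp

lemma L2_sum: assumes "\<And>i. i \<in> I \<Longrightarrow> f i \<in> L2" shows "(\<lambda>x. \<Sum>i\<in>I. f i x) \<in> L2"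
  using assms by (induction I rule: infinite_finite_induct) (auto intro: L2_add L2_const)

lemma nrm_nonneg [simp]: "0 \<le> nrm g" by (simp add: nrm_def)

lemma nrm_sq: "(nrm g)\<^sup>2 = (\<integral>x. (g x)\<^sup>2 \<partial>M)" by (simp add: nrm_def)

lemma nrm_cmult: "nrm (\<lambda>x. c * g x) = \<bar>c\<bar> * nrm g"
  by (simp add: nrm_def power_mult_distrib real_sqrt_mult)

lemma nrm_cong_AE: assumes "AE x in M. f x = g x" "f \<in> L2" "g \<in> L2" shows "nrm f = nrm g"
  unfolding nrm_def using assms
  by (auto intro!: arg_cong[where f=sqrt] integral_cong_AE dest: L2_meas)

lemma L2_CS: assumes "f \<in> L2" "g \<in> L2" shows "(\<integral>x. f x * g x \<partial>M) \<le> nrm f * nrm g"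
proof -
  \<comment> \<open>the added \<open>d\<close> lets vanishing norms be divided by\<close>
  have *: "(\<integral>x. f x * g x \<partial>M) \<le> (nrm f + d) * (nrm g + d)" if d: "d > 0" for d
  proof -
    define A B where "A = nrm f + d" and "B = nrm g + d"
    have pos: "A > 0" "B > 0" using d by (auto simp: A_def B_def add_nonneg_pos)
    have "(\<integral>x. f x * g x \<partial>M) \<le> (\<integral>x. (B / A) * (f x)\<^sup>2 / 2 + (A / B) * (g x)\<^sup>2 / 2 \<partial>M)"
    proof (rule integral_mono)
      fix x
      have "0 \<le> (B * f x - A * g x)\<^sup>2" by simp
      then show "f x * g x \<le> (B / A) * (f x)\<^sup>2 / 2 + (A / B) * (g x)\<^sup>2 / 2"
        using pos by (simp add: field_simps power2_eq_square)
    qed (use assms L2_sq L2_mult in auto)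
    also have "\<dots> = (B / A) * (nrm f)\<^sup>2 / 2 + (A / B) * (nrm g)\<^sup>2 / 2"
      using assms L2_sq by (simp add: nrm_sq)
    also have "\<dots> \<le> (B / A) * A\<^sup>2 / 2 + (A / B) * B\<^sup>2 / 2"
      using pos d by (intro add_mono divide_right_mono mult_left_mono power_mono) (auto simp: A_def B_def)
    also have "\<dots> = A * B" using pos by (simp add: field_simps power2_eq_square)
    finally show ?thesis by (simp add: A_def B_def)
  qed
  have "((\<lambda>d. (nrm f + d) * (nrm g + d)) \<longlongrightarrow> (nrm f + 0) * (nrm g + 0)) (at_right 0)"
    by (intro tendsto_intros)
  then show ?thesis
    by (intro tendsto_lowerbound[where F="at_right 0"])
      (use * in \<open>auto simp: eventually_at_filter\<close>)
qed

lemma nrm_add: assumes "f \<in> L2" "g \<in> L2" shows "nrm (\<lambda>x. f x + g x) \<le> nrm f + nrm g"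
proof (rule power2_le_imp_le)
  have "(nrm (\<lambda>x. f x + g x))\<^sup>2 = (\<integral>x. (f x)\<^sup>2 + 2 * (f x * g x) + (g x)\<^sup>2 \<partial>M)"
    by (simp add: nrm_sq power2_sum algebra_simps)
  also have "\<dots> = (nrm f)\<^sup>2 + 2 * (\<integral>x. f x * g x \<partial>M) + (nrm g)\<^sup>2"
    using assms L2_sq L2_mult by (simp add: nrm_sq)
  also have "\<dots> \<le> (nrm f + nrm g)\<^sup>2" using L2_CS[OF assms] by (simp add: power2_sum)
  finally show "(nrm (\<lambda>x. f x + g x))\<^sup>2 \<le> (nrm f + nrm g)\<^sup>2" .
qed simp

lemma nrm_diff: assumes "f \<in> L2" "g \<in> L2" shows "nrm (\<lambda>x. f x - g x) \<le> nrm f + nrm g"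
  using nrm_add[OF assms(1) L2_cmult[OF assms(2), of "-1"]] nrm_cmult[of "-1" g] by simp

lemma nrm_triangle_diff: assumes "f \<in> L2" "g \<in> L2" shows "\<bar>nrm f - nrm g\<bar> \<le> nrm (\<lambda>x. f x - g x)"
  using nrm_add[OF L2_diff[OF assms] assms(2)] nrm_add[OF L2_diff[OF assms(2,1)] assms(1)]
    nrm_cmult[of "-1" "\<lambda>x. f x - g x"] by (simp add: abs_le_iff)

lemma nrm_sum: assumes "\<And>i. i \<in> I \<Longrightarrow> f i \<in> L2"
  shows "nrm (\<lambda>x. \<Sum>i\<in>I. f i x) \<le> (\<Sum>i\<in>I. nrm (f i))"
  using assms
proof (induction I rule: infinite_finite_induct)
  case (insert i I)
  then show ?case using nrm_add[of "f i" "\<lambda>x. \<Sum>i\<in>I. f i x"] L2_sum[of I f] by fastforce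
qed (auto simp: nrm_def)

lemma integral_abs_le_nrm: assumes "g \<in> L2" shows "(\<integral>x. \<bar>g x\<bar> \<partial>M) \<le> nrm g"
proof -
  have "(\<lambda>x. \<bar>g x\<bar>) \<in> L2" using assms by (auto simp: L2_def)
  then have "(\<integral>x. \<bar>g x\<bar> * 1 \<partial>M) \<le> nrm (\<lambda>x. \<bar>g x\<bar>) * nrm (\<lambda>x. 1)"
    by (rule L2_CS[OF _ L2_const])
  also have "\<dots> = nrm g" by (simp add: nrm_def prob_space)
  finally show ?thesis by simp
qed

lemma L2_cond_exp:
  assumes F: "subalgebra M G" and g: "g \<in> L2"
  shows "real_cond_exp M G g \<in> L2" "nrm (real_cond_exp M G g) \<le> nrm g"
proof -
  interpret G: finite_measure_subalgebra M G by unfold_locales (rule F)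
  let ?E = "real_cond_exp M G g"
  have c: "convex_on UNIV (\<lambda>x::real. x\<^sup>2)" by (rule convex_power2)
  have J: "integrable M (\<lambda>x. (?E x)\<^sup>2)" "AE x in M. (?E x)\<^sup>2 \<le> real_cond_exp M G (\<lambda>x. (g x)\<^sup>2) x"
    using G.real_cond_exp_jensens_inequality[where X=g and I=UNIV and q="\<lambda>x. x\<^sup>2"]
      G.integrable_convex_cond_exp[where X=g and I=UNIV and q="\<lambda>x. x\<^sup>2"]
      L2_integrable[OF g] L2_sq[OF g] c by (auto)
  show 1: "?E \<in> L2" using J by (simp add: L2_def)
  have "(\<integral>x. (?E x)\<^sup>2 \<partial>M) \<le> (\<integral>x. real_cond_exp M G (\<lambda>x. (g x)\<^sup>2) x \<partial>M)"
    using J G.real_cond_exp_int[OF L2_sq[OF g]] by (intro integral_mono_AE) auto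
  also have "\<dots> = (\<integral>x. (g x)\<^sup>2 \<partial>M)" using G.real_cond_exp_int[OF L2_sq[OF g]] by simp
  finally show "nrm ?E \<le> nrm g" by (simp add: nrm_def)
qed

end

section \<open>Boxes\<close>

text \<open>
  Coordinates outside \<open>J\<close> are pinned to \<open>0\<close>, so that the box of \<open>insert i J\<close> is made of translates along
  \<open>i\<close> of the box of \<open>J\<close>; this is what inductions over the directions need.
\<close>

definition Box :: "'d set \<Rightarrow> int ^ 'd \<Rightarrow> (int ^ 'd::finite) set" where
  "Box J n = {k. \<forall>j. if j \<in> J then 1 \<le> k $ j \<and> k $ j \<le> n $ j else k $ j = 0}"

definition vol_on :: "'d::finite set \<Rightarrow> int ^ 'd \<Rightarrow> real" where
  "vol_on J n = (\<Prod>j\<in>J. real_of_int (n $ j))"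

lemma Box_UNIV: "Box UNIV n = {1..n}"
  by (auto simp: Box_def less_eq_vec_def)

lemma Box_empty [simp]: "Box {} n = {0}"
  by (auto simp: Box_def vec_eq_iff)

lemma Box_bij: "bij_betw vec_lambda (PiE UNIV (\<lambda>j. if j \<in> J then {1..n $ j} else {0})) (Box J n)"
  by (rule bij_betw_byWitness[where f'="vec_nth"]) (auto simp: Box_def PiE_iff split: if_splits)

lemma finite_Box [simp]: "finite (Box J n)"
  using bij_betw_finite[OF Box_bij[of J n]] by (simp add: finite_PiE)

lemma card_Box: assumes "\<And>j. j \<in> J \<Longrightarrow> 0 \<le> n $ j" shows "real (card (Box J n)) = vol_on J n"
proof -
  have "card (Box J n) = (\<Prod>j\<in>UNIV. card (if j \<in> J then {1..n $ j} else {0}))"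
    using bij_betw_same_card[OF Box_bij[of J n]] by (simp add: card_PiE)
  also have "\<dots> = (\<Prod>j\<in>J. card (if j \<in> J then {1..n $ j} else {0}))"
    by (rule prod.mono_neutral_right) auto
  also have "\<dots> = (\<Prod>j\<in>J. nat (n $ j))" by (rule prod.cong) auto
  finally show ?thesis using assms by (simp add: vol_on_def)
qed

lemma Box_insert_bij: assumes "i \<notin> J"
  shows "bij_betw (\<lambda>(c, k). axis i c + k) ({1..n $ i} \<times> Box J n) (Box (insert i J) n)"
proof (rule bij_betw_byWitness[where f'="\<lambda>k. (k $ i, idx i 0 k)"])
  show "\<forall>a\<in>{1..n $ i} \<times> Box J n. (\<lambda>k. (k $ i, idx i 0 k)) ((\<lambda>(c, k). axis i c + k) a) = a"
    using assms by (auto simp: Box_def idx_def vec_eq_iff axis_def)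
  show "\<forall>a'\<in>Box (insert i J) n. (\<lambda>(c, k). axis i c + k) ((\<lambda>k. (k $ i, idx i 0 k)) a') = a'"
    by (auto simp: Box_def idx_def vec_eq_iff axis_def)
  show "(\<lambda>(c, k). axis i c + k) ` ({1..n $ i} \<times> Box J n) \<subseteq> Box (insert i J) n"
  proof clarsimp
    fix c k assume *: "1 \<le> c" "c \<le> n $ i" "k \<in> Box J n"
    show "axis i c + k \<in> Box (insert i J) n"
      using * assms unfolding Box_def
      by (auto simp: axis_def)
  qed
  show "(\<lambda>k. (k $ i, idx i 0 k)) ` Box (insert i J) n \<subseteq> {1..n $ i} \<times> Box J n"
    using assms by (auto simp: Box_def idx_def)
qed

lemma Box_cong: assumes "\<And>j. j \<in> J \<Longrightarrow> n $ j = m $ j" shows "Box J n = Box J m"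
  using assms by (auto simp: Box_def)

lemma vol_on_cong: assumes "\<And>j. j \<in> J \<Longrightarrow> n $ j = m $ j" shows "vol_on J n = vol_on J m"
  using assms by (auto simp: vol_on_def)

lemma vol_on_insert: "i \<notin> J \<Longrightarrow> vol_on (insert i J) n = real_of_int (n $ i) * vol_on J n"
  by (simp add: vol_on_def)

lemma vol_on_pos: assumes "\<And>j. j \<in> J \<Longrightarrow> 1 \<le> n $ j" shows "0 < vol_on J n"
  using assms unfolding vol_on_def by (intro prod_pos) force

lemma vol_UNIV: "vol n = vol_on UNIV n" by (simp add: vol_def vol_on_def)

lemma idx_nth [simp]: "idx i c n $ j = (if j = i then c else n $ j)" by (simp add: idx_def)

lemma axis_nth': "axis i c $ j = (if j = i then c else 0)" by (auto simp: axis_def)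

lemma axis_add: "axis i a + axis i b = axis i (a + b :: int)" by (auto simp: vec_eq_iff axis_nth')

lemma axis_0 [simp]: "axis i 0 = (0 :: int ^ 'd)" by (auto simp: vec_eq_iff axis_nth')

lemma axis_uminus: "- axis i a = axis i (- a :: int)" by (auto simp: vec_eq_iff axis_nth')

lemma vmin_nth [simp]: "vmin k l $ j = min (k $ j) (l $ j)" by (simp add: vmin_def)

lemma vmin_commute: "vmin k l = vmin l k" by (simp add: vec_eq_iff min.commute)

section \<open>Stationary systems with a commuting filtration\<close>

text \<open>
  The situation on the canonical space: \<open>T\<close> is the action of the translations, \<open>F k\<close> the past of \<open>k\<close>.
\<close>

locale commuting_system = prob_space M for M :: "'a measure" +
  fixes T :: "int ^ 'd::finite \<Rightarrow> 'a \<Rightarrow> 'a" and F :: "int ^ 'd \<Rightarrow> 'a measure"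
  assumes space_UNIV: "space M = UNIV"
    and T_meas [measurable]: "T h \<in> measurable M M"
    and T_distr: "distr M M (T h) = M"
    and T_0 [simp]: "T 0 x = x"
    and T_T: "T h (T k x) = T (h + k) x"
    and F_sub: "subalgebra M (F k)"
    and F_mono: "k \<le> l \<Longrightarrow> sets (F k) \<subseteq> sets (F l)"
    and T_F: "T h \<in> measurable (F (k + h)) (F k)"
    and F_commute: "g \<in> L2 \<Longrightarrow>
      AE x in M. real_cond_exp M (F l) (real_cond_exp M (F k) g) x = real_cond_exp M (F (vmin k l)) g x"
begin

definition sh :: "int ^ 'd \<Rightarrow> ('a \<Rightarrow> real) \<Rightarrow> 'a \<Rightarrow> real" where
  "sh h g = (\<lambda>x. g (T h x))"

abbreviation E :: "int ^ 'd \<Rightarrow> ('a \<Rightarrow> real) \<Rightarrow> 'a \<Rightarrow> real" where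
  "E k \<equiv> real_cond_exp M (F k)"

definition aeq :: "('a \<Rightarrow> real) \<Rightarrow> ('a \<Rightarrow> real) \<Rightarrow> bool" (infix "\<doteq>" 50) where
  "f \<doteq> g \<longleftrightarrow> (AE x in M. f x = g x)"

sublocale F: finite_measure_subalgebra M "F k" for k
  by unfold_locales (rule F_sub)

lemma aeq_trans [trans]: "f \<doteq> g \<Longrightarrow> g \<doteq> h \<Longrightarrow> f \<doteq> h" by (auto simp: aeq_def)
lemma aeq_sym: "f \<doteq> g \<Longrightarrow> g \<doteq> f" by (auto simp: aeq_def)
lemma aeq_refl [simp]: "f \<doteq> f" by (simp add: aeq_def)
lemma aeq_add: "f \<doteq> f' \<Longrightarrow> g \<doteq> g' \<Longrightarrow> (\<lambda>x. f x + g x) \<doteq> (\<lambda>x. f' x + g' x)" by (auto simp: aeq_def)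
lemma aeq_diff: "f \<doteq> f' \<Longrightarrow> g \<doteq> g' \<Longrightarrow> (\<lambda>x. f x - g x) \<doteq> (\<lambda>x. f' x - g' x)" by (auto simp: aeq_def)
lemma aeq_cmult: "f \<doteq> g \<Longrightarrow> (\<lambda>x. c * f x) \<doteq> (\<lambda>x. c * g x)" by (auto simp: aeq_def)

lemma space_F [simp]: "space (F k) = UNIV"
  using F_sub[of k] by (simp add: subalgebra_def space_UNIV)

lemma F_subalg: "k \<le> l \<Longrightarrow> subalgebra (F l) (F k)"
  using F_mono by (simp add: subalgebra_def)

lemma F_meas_mono: "k \<le> l \<Longrightarrow> g \<in> borel_measurable (F k) \<Longrightarrow> g \<in> borel_measurable (F l)"
  using measurable_from_subalg[OF F_subalg] by blast

lemma F_meas: "g \<in> borel_measurable (F k) \<Longrightarrow> g \<in> borel_measurable M"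
  using measurable_from_subalg[OF F_sub] by blast

lemma sh_0 [simp]: "sh 0 g = g" by (simp add: sh_def)

lemma sh_sh: "sh h (sh k g) = sh (h + k) g" by (simp add: sh_def T_T add.commute)

lemma sh_meas [measurable]: "g \<in> borel_measurable M \<Longrightarrow> sh h g \<in> borel_measurable M"
  unfolding sh_def by (rule measurable_compose[OF T_meas])

lemma sh_F: "g \<in> borel_measurable (F k) \<Longrightarrow> sh h g \<in> borel_measurable (F (k + h))"
  unfolding sh_def using measurable_compose[OF T_F] by blast

lemma sh_F': "g \<in> borel_measurable (F k) \<Longrightarrow> k + h \<le> l \<Longrightarrow> sh h g \<in> borel_measurable (F l)"
  using sh_F F_meas_mono by blast

lemma integral_T: fixes g :: "'a \<Rightarrow> real" assumes "g \<in> borel_measurable M" shows "(\<integral>x. g (T h x) \<partial>M) = (\<integral>x. g x \<partial>M)"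
  using integral_distr[of "T h" M M g] assms T_distr by simp

lemma integrable_T: fixes g :: "'a \<Rightarrow> real" assumes "integrable M g" shows "integrable M (\<lambda>x. g (T h x))"
  using integrable_distr[of "T h" M M g] assms T_distr by simp

lemma AE_T: assumes "AE x in M. P x" shows "AE x in M. P (T h x)"
  using AE_distrD[OF T_meas, where P=P] assms unfolding T_distr by blast

lemma sh_aeq: "f \<doteq> g \<Longrightarrow> sh h f \<doteq> sh h g"
  unfolding sh_def aeq_def by (rule AE_T)

lemma sh_L2: "g \<in> L2 \<Longrightarrow> sh h g \<in> L2"
  unfolding L2_def sh_def using integrable_T[of "\<lambda>x. (g x)\<^sup>2"] by auto

lemma nrm_sh: "g \<in> L2 \<Longrightarrow> nrm (sh h g) = nrm g"
  unfolding nrm_def sh_def using integral_T[of "\<lambda>x. (g x)\<^sup>2"] by (auto simp: L2_def)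

lemma E_meas: "E k g \<in> borel_measurable (F k)" by simp

lemma E_measM [measurable]: "E k g \<in> borel_measurable M" by (rule borel_measurable_cond_exp2)

lemma E_L2: "g \<in> L2 \<Longrightarrow> E k g \<in> L2"
  using L2_cond_exp(1)[OF F_sub] by blast

lemma E_nrm: "g \<in> L2 \<Longrightarrow> nrm (E k g) \<le> nrm g"
  using L2_cond_exp(2)[OF F_sub] by blast

lemma E_cong: "f \<doteq> g \<Longrightarrow> f \<in> L2 \<Longrightarrow> g \<in> L2 \<Longrightarrow> E k f \<doteq> E k g"
  unfolding aeq_def by (rule F.real_cond_exp_cong) (auto dest: L2_meas)

lemma E_id: "g \<in> borel_measurable (F k) \<Longrightarrow> g \<in> L2 \<Longrightarrow> E k g \<doteq> g"
  unfolding aeq_def using F.real_cond_exp_F_meas L2_integrable by blast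

lemma nrm_aeq: "f \<doteq> g \<Longrightarrow> f \<in> L2 \<Longrightarrow> g \<in> L2 \<Longrightarrow> nrm f = nrm g"
  unfolding aeq_def by (rule nrm_cong_AE)

lemma E_E: "g \<in> L2 \<Longrightarrow> E l (E k g) \<doteq> E (vmin k l) g"
  unfolding aeq_def by (rule F_commute)

lemma E_tower: assumes "g \<in> L2" "k \<le> l" shows "E k (E l g) \<doteq> E k g"
proof -
  have "vmin l k = k" using assms(2) by (auto simp: vec_eq_iff less_eq_vec_def)
  then show ?thesis unfolding aeq_def using F_commute[OF assms(1), of k l] by simp
qed

lemma E_commute: "g \<in> L2 \<Longrightarrow> E k (E l g) \<doteq> E l (E k g)"
  unfolding aeq_def using F_commute[of g k l] F_commute[of g l k] vmin_commute[of k l] by auto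

lemma E_add: "f \<in> L2 \<Longrightarrow> g \<in> L2 \<Longrightarrow> E k (\<lambda>x. f x + g x) \<doteq> (\<lambda>x. E k f x + E k g x)"
  unfolding aeq_def using F.real_cond_exp_add L2_integrable by blast

lemma E_diff: "f \<in> L2 \<Longrightarrow> g \<in> L2 \<Longrightarrow> E k (\<lambda>x. f x - g x) \<doteq> (\<lambda>x. E k f x - E k g x)"
  unfolding aeq_def using F.real_cond_exp_diff L2_integrable by blast

lemma E_cmult: "g \<in> L2 \<Longrightarrow> E k (\<lambda>x. c * g x) \<doteq> (\<lambda>x. c * E k g x)"
  unfolding aeq_def using F.real_cond_exp_cmult L2_integrable by blast

lemma aeq_sum: assumes "\<And>i. i \<in> I \<Longrightarrow> f i \<doteq> g i" shows "(\<lambda>x. \<Sum>i\<in>I. f i x) \<doteq> (\<lambda>x. \<Sum>i\<in>I. g i x)"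
proof (cases "finite I")
  case True
  then have "AE x in M. \<forall>i\<in>I. f i x = g i x" using assms by (simp add: AE_finite_all aeq_def)
  then show ?thesis unfolding aeq_def by eventually_elim simp
qed simp

lemma E_sum: assumes "\<And>i. i \<in> I \<Longrightarrow> f i \<in> L2"
  shows "E k (\<lambda>x. \<Sum>i\<in>I. f i x) \<doteq> (\<lambda>x. \<Sum>i\<in>I. E k (f i) x)"
proof (cases "finite I")
  case True
  then show ?thesis using assms
  proof induction
    case empty
    have "(\<lambda>x. 0) \<in> L2" by (rule L2_const)
    then show ?case using E_id[of "\<lambda>x. 0" k] by simp
  next
    case (insert i I)
    have "E k (\<lambda>x. f i x + (\<Sum>i\<in>I. f i x)) \<doteq> (\<lambda>x. E k (f i) x + E k (\<lambda>x. \<Sum>i\<in>I. f i x) x)"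
      using insert by (intro E_add L2_sum) auto
    also have "\<dots> \<doteq> (\<lambda>x. E k (f i) x + (\<Sum>i\<in>I. E k (f i) x))" using insert by (intro aeq_add) auto
    finally show ?case using insert by simp
  qed
next
  case False
  then show ?thesis using E_id[of "\<lambda>x. 0" k] L2_const[of 0] by simp
qed

lemma E_int: assumes "z \<in> borel_measurable (F k)" "z \<in> L2" "g \<in> L2"
  shows "(\<integral>x. z x * g x \<partial>M) = (\<integral>x. z x * E k g x \<partial>M)"
  using F.real_cond_exp_intg(2)[OF L2_mult[OF assms(2,3)] assms(1)] assms(3) L2_meas by auto

text \<open>The translation by \<open>h\<close> preserves the measure and carries the past of \<open>k\<close> onto that of \<open>k + h\<close>.\<close>

lemma E_sh: assumes "g \<in> L2" shows "E (k + h) (sh h g) \<doteq> sh h (E k g)"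
  unfolding aeq_def
proof (rule F.real_cond_exp_charact)
  show "integrable M (sh h g)" "integrable M (sh h (E k g))"
    using assms by (auto intro!: L2_integrable sh_L2 E_L2)
  show "sh h (E k g) \<in> borel_measurable (F (k + h))" by (rule sh_F[OF E_meas])
  fix A assume A: "A \<in> sets (F (k + h))"
  define B where "B = T (- h) -` A"
  have "T (- h) \<in> measurable (F k) (F (k + h))" using T_F[of "- h" "k + h"] by simp
  from measurable_sets[OF this A] have B: "B \<in> sets (F k)" by (simp add: B_def)
  have ind: "indicator A x = (indicator B (T h x) :: real)" for x
    by (simp only: B_def indicator_def vimage_eq T_T) simp
  have Bm: "indicator B \<in> borel_measurable (F k)" using B by simp
  have "(indicator B :: 'a \<Rightarrow> real) \<in> L2" 
    by (rule L2_bounded[where K=1]) (use F_meas[OF Bm] in \<open>auto simp: indicator_def\<close>)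
  note B2 = this
  have "(LINT x:A|M. sh h g x) = (\<integral>x. indicator B (T h x) * g (T h x) \<partial>M)"
    by (simp add: set_lebesgue_integral_def ind sh_def)
  also have "\<dots> = (\<integral>x. indicator B x * g x \<partial>M)"
    using integral_T[of "\<lambda>x. indicator B x * g x"] L2_meas[OF B2] L2_meas[OF assms] by auto
  also have "\<dots> = (\<integral>x. indicator B x * E k g x \<partial>M)" by (rule E_int[OF Bm B2 assms])
  also have "\<dots> = (\<integral>x. indicator B (T h x) * E k g (T h x) \<partial>M)"
    using integral_T[of "\<lambda>x. indicator B x * E k g x"] L2_meas[OF B2] by auto
  also have "\<dots> = (LINT x:A|M. sh h (E k g) x)"
    by (simp add: set_lebesgue_integral_def ind sh_def)
  finally show "(LINT x:A|M. sh h g x) = (LINT x:A|M. sh h (E k g) x)" .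
qed

lemma E_sh': "g \<in> L2 \<Longrightarrow> E k (sh h g) \<doteq> sh h (E (k - h) g)"
  using E_sh[of g "k - h" h] by simp

definition S :: "'d set \<Rightarrow> int ^ 'd \<Rightarrow> ('a \<Rightarrow> real) \<Rightarrow> 'a \<Rightarrow> real" where
  "S J n g = (\<lambda>x. \<Sum>k\<in>Box J n. sh k g x)"

lemma S_empty [simp]: "S {} n g = g" by (simp add: S_def)

lemma S_meas [measurable]: "g \<in> borel_measurable M \<Longrightarrow> S J n g \<in> borel_measurable M"
  unfolding S_def by measurable

lemma S_L2: "g \<in> L2 \<Longrightarrow> S J n g \<in> L2"
  unfolding S_def by (intro L2_sum sh_L2)

lemma S_cong: assumes "\<And>j. j \<in> J \<Longrightarrow> n $ j = m $ j" shows "S J n g = S J m g"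
  unfolding S_def using Box_cong[of J n m] assms by simp

lemma S_insert: assumes "i \<notin> J"
  shows "S (insert i J) n g = (\<lambda>x. \<Sum>c\<in>{1..n $ i}. sh (axis i c) (S J n g) x)"
proof
  fix x
  have "S (insert i J) n g x = (\<Sum>(c, k)\<in>{1..n $ i} \<times> Box J n. sh (axis i c + k) g x)"
    unfolding S_def
    by (subst sum.reindex_bij_betw[OF Box_insert_bij[OF assms], symmetric]) (simp add: case_prod_beta)
  also have "\<dots> = (\<Sum>c\<in>{1..n $ i}. \<Sum>k\<in>Box J n. sh (axis i c + k) g x)"
    by (simp add: sum.cartesian_product)
  also have "\<dots> = (\<Sum>c\<in>{1..n $ i}. sh (axis i c) (S J n g) x)"
    by (intro sum.cong refl) (simp add: S_def sh_def T_T add.commute)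
  finally show "S (insert i J) n g x = (\<Sum>c\<in>{1..n $ i}. sh (axis i c) (S J n g) x)" .
qed

lemma S_sh: "S J n (sh h g) = sh h (S J n g)"
  unfolding S_def by (simp add: sh_def T_T add.commute)

lemma S_add: "S J n (\<lambda>x. f x + g x) = (\<lambda>x. S J n f x + S J n g x)"
  by (simp add: S_def sh_def sum.distrib)

lemma S_diff: "S J n (\<lambda>x. f x - g x) = (\<lambda>x. S J n f x - S J n g x)"
  by (simp add: S_def sh_def sum_subtractf)

lemma S_cmult: "S J n (\<lambda>x. c * g x) = (\<lambda>x. c * S J n g x)"
  by (simp add: S_def sh_def sum_distrib_left)

lemma S_sum: "S J n (\<lambda>x. \<Sum>i\<in>I. f i x) = (\<lambda>x. \<Sum>i\<in>I. S J n (f i) x)"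
  by (simp add: S_def sh_def) (subst sum.swap, simp)

lemma S_aeq: "f \<doteq> g \<Longrightarrow> S J n f \<doteq> S J n g"
  unfolding S_def by (intro aeq_sum sh_aeq)

lemma S_F: assumes "g \<in> borel_measurable (F k)" "\<And>h. h \<in> Box J n \<Longrightarrow> k + h \<le> l"
  shows "S J n g \<in> borel_measurable (F l)"
  unfolding S_def using assms by (intro borel_measurable_sum sh_F') auto

lemma S_nrm_le: "g \<in> L2 \<Longrightarrow> nrm (S J n g) \<le> card (Box J n) * nrm g"
  unfolding S_def using nrm_sum[of "Box J n" "\<lambda>k. sh k g"] by (simp add: sh_L2 nrm_sh)

end

section \<open>A second moment bound for sums over boxes\<close>

text \<open>
  The doubling hypothesis gives \<open>a (2 N) \<le> sqrt 2 (a N + b)\<close>, so \<open>a (2\<^sup>s) / sqrt (2\<^sup>s)\<close> grows by at most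
  \<open>b\<^sub>s / sqrt (2\<^sup>s)\<close> per step.  A general \<open>N\<close> is the sum of its largest power of two and of a rest of at
  most half its size; the resulting geometric series is absorbed by the factor \<open>4\<close>.
\<close>

lemma dyadic_doubling_bound:
  fixes a b :: "nat \<Rightarrow> real"
  assumes a: "\<And>N. 0 \<le> a N" and b: "\<And>s. 0 \<le> b s"
    and sub: "\<And>M N. a (M + N) \<le> a M + a N"
    and dbl: "\<And>s. (a (2 * 2 ^ s))\<^sup>2 \<le> 2 * (a (2 ^ s))\<^sup>2 + 2 * (a (2 ^ s) * b s)"
    and N: "1 \<le> N" "N \<le> 2 ^ R"
  shows "a N \<le> 4 * sqrt (real N) * (a 1 + (\<Sum>q<R. b q / sqrt (2 ^ q)))"
proof -
  define B where "B = a 1 + (\<Sum>q<R. b q / sqrt (2 ^ q))"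
  have B0: "0 \<le> B" unfolding B_def using a b by (intro add_nonneg_nonneg sum_nonneg) auto
  have pow: "a (2 ^ s) \<le> sqrt (2 ^ s) * (a 1 + (\<Sum>q<s. b q / sqrt (2 ^ q)))" for s
  proof (induction s)
    case (Suc s)
    have "(a (2 * 2 ^ s))\<^sup>2 \<le> (sqrt 2 * (a (2 ^ s) + b s))\<^sup>2"
    proof -
      have "(sqrt 2 * (a (2 ^ s) + b s))\<^sup>2 = 2 * (a (2 ^ s))\<^sup>2 + 2 * (b s)\<^sup>2 + 4 * (a (2 ^ s) * b s)"
        by (simp add: power_mult_distrib power2_sum)
      moreover have "0 \<le> 2 * (b s)\<^sup>2 + 2 * (a (2 ^ s) * b s)" using a[of "2 ^ s"] b[of s] by simp
      ultimately show ?thesis using dbl[of s] by linarith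
    qed
    then have "a (2 * 2 ^ s) \<le> sqrt 2 * (a (2 ^ s) + b s)"
      by (rule power2_le_imp_le) (use a b in auto)
    also have "\<dots> \<le> sqrt 2 * (sqrt (2 ^ s) * (a 1 + (\<Sum>q<s. b q / sqrt (2 ^ q))) + b s)"
      using Suc by simp
    also have "\<dots> = sqrt (2 ^ Suc s) * (a 1 + (\<Sum>q<Suc s. b q / sqrt (2 ^ q)))"
      by (simp add: real_sqrt_mult field_simps)
    finally show ?case by simp
  qed simp
  have powB: "a (2 ^ s) \<le> sqrt (2 ^ s) * B" if "s \<le> R" for s
  proof -
    have "(\<Sum>q<s. b q / sqrt (2 ^ q)) \<le> (\<Sum>q<R. b q / sqrt (2 ^ q))"
      using that b by (intro sum_mono2) auto
    then have "sqrt (2 ^ s) * (a 1 + (\<Sum>q<s. b q / sqrt (2 ^ q))) \<le> sqrt (2 ^ s) * B"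
      by (simp add: B_def)
    then show ?thesis using pow[of s] by linarith
  qed
  have "a N \<le> 4 * sqrt (real N) * B" using N
  proof (induction N rule: less_induct)
    case (less N)
    obtain s where s: "2 ^ s \<le> N" "N < 2 ^ (s + 1)"
      using ex_power_ivl1[of 2 N] less.prems by auto
    have sR: "s \<le> R"
    proof (rule ccontr)
      assume "\<not> s \<le> R"
      then have "(2::nat) ^ R < 2 ^ s" by (intro power_strict_increasing) auto
      then show False using s less.prems by linarith
    qed
    have 1: "a (2 ^ s) \<le> sqrt N * B"
    proof -
      have "real (2 ^ s) \<le> real N" using s(1) of_nat_le_iff by blast
      then have "sqrt (2 ^ s) \<le> sqrt N" by simp
      then show ?thesis using powB[OF sR] mult_right_mono[OF _ B0] by (meson order_trans)
    qed
    show ?case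
    proof (cases "N = 2 ^ s")
      case True
      have "sqrt N * B \<ge> 0" using B0 by simp
      then show ?thesis using 1 True by simp
    next
      case False
      define K where "K = N - 2 ^ s"
      have K: "K < N" "1 \<le> K" "K \<le> 2 ^ R" "N = 2 ^ s + K" "2 * K \<le> N"
        using s False less.prems by (auto simp: K_def)
      have "2 * real K \<le> real N" using K(5) by linarith
      then have "sqrt (real K) \<le> sqrt (real N / 2)" by simp
      also have "\<dots> = sqrt (real N) / sqrt 2" by (simp add: real_sqrt_divide)
      also have "\<dots> \<le> sqrt (real N) * (3 / 4)"
      proof -
        have "(4 / 3)\<^sup>2 \<le> (2::real)" by (simp add: power2_eq_square)
        then have "4 / 3 \<le> sqrt (2::real)" by (rule real_le_rsqrt)
        then have "1 / sqrt 2 \<le> (3 / 4 :: real)" by (simp add: field_simps)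
        then show ?thesis using mult_left_mono[of "1 / sqrt 2" "3/4" "sqrt (real N)"] by simp
      qed
      finally have "4 * sqrt K * B \<le> 3 * sqrt N * B"
        using mult_right_mono[OF _ B0, of "4 * sqrt K" "3 * sqrt N"] by simp
      moreover have "a N \<le> a (2 ^ s) + a K" unfolding K(4) by (rule sub)
      ultimately show ?thesis using less.IH[OF K(1-3)] 1 by (simp add: algebra_simps)
    qed
  qed
  then show ?thesis by (simp add: B_def)
qed

text \<open>
  A function \<open>r\<close> assigns a dyadic scale to every direction.  Scale \<open>0\<close> means that nothing is summed in that
  direction, scale \<open>s + 1\<close> that the coordinate runs over \<open>1, \<dots>, 2\<^sup>s\<close>.  With truncated subtraction
  \<open>2 ^ (r j - 1)\<close> is the number of summands in both cases, and \<open>wt r\<close> is the inverse square root of the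
  volume of the box.
\<close>

definition rset :: "'d set \<Rightarrow> nat \<Rightarrow> ('d \<Rightarrow> nat) set" where
  "rset J R = {r. \<forall>j. if j \<in> J then r j \<le> R else r j = 0}"

definition supp :: "('d \<Rightarrow> nat) \<Rightarrow> 'd set" where "supp r = {j. r j \<noteq> 0}"

definition dyadic :: "('d \<Rightarrow> nat) \<Rightarrow> int ^ 'd::finite" where
  "dyadic r = (\<chi> j. 2 ^ (r j - 1))"

definition wt :: "('d::finite \<Rightarrow> nat) \<Rightarrow> real" where
  "wt r = (\<Prod>j\<in>UNIV. 1 / sqrt (2 ^ (r j - 1)))"

definition single :: "'d \<Rightarrow> nat \<Rightarrow> 'd \<Rightarrow> nat" where "single i s = (\<lambda>j. if j = i then s else 0)"

lemma wt_pos: "0 < wt r" unfolding wt_def by (intro prod_pos) auto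

lemma wt_0: "wt (\<lambda>_. 0) = 1" by (simp add: wt_def)

lemma wt_upd: assumes "r i = 0" shows "wt (r(i := s)) = wt r / sqrt (2 ^ (s - 1))"
proof -
  have rem: "wt q = (1 / sqrt (2 ^ (q i - 1))) * (\<Prod>j\<in>UNIV - {i}. 1 / sqrt (2 ^ (q j - 1)))" for q
    unfolding wt_def by (rule prod.remove) auto
  have eq: "(\<Prod>j\<in>UNIV - {i}. 1 / sqrt (2 ^ ((r(i := s)) j - 1))) = (\<Prod>j\<in>UNIV - {i}. 1 / sqrt (2 ^ (r j - 1)))"
    by (intro prod.cong) auto
  show ?thesis unfolding rem[of "r(i := s)"] rem[of r] eq using assms by simp
qed

lemma wt_single: "wt (single i s) = 1 / sqrt (2 ^ (s - 1))"
proof -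
  have "single i s = (\<lambda>_. 0)(i := s)" by (auto simp: single_def)
  then show ?thesis using wt_upd[of "\<lambda>_. 0" i s] by (simp add: wt_0)
qed

lemma rset_empty: "rset {} R = {\<lambda>_. 0}" by (auto simp: rset_def)

lemma rset_insert_bij: assumes "i \<notin> J"
  shows "bij_betw (\<lambda>(s, r). r(i := s)) ({..R} \<times> rset J R) (rset (insert i J) R)"
  by (rule bij_betw_byWitness[where f'="\<lambda>r. (r i, r(i := 0))"])
    (use assms in \<open>auto simp: rset_def fun_eq_iff split: if_splits\<close>)

lemma finite_rset: "finite (J :: 'd::finite set) \<Longrightarrow> finite (rset J R)"
proof (induction rule: finite_induct)
  case (insert i J)
  then show ?case using bij_betw_finite[OF rset_insert_bij[of i J R]] by auto
qed (simp add: rset_empty)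

lemma rset_insert_sum: assumes "i \<notin> J"
  shows "(\<Sum>r\<in>rset (insert i J) R. f r) = (\<Sum>s\<le>R. \<Sum>r\<in>rset J R. f (r(i := s)))"
  by (subst sum.reindex_bij_betw[OF rset_insert_bij[OF assms], symmetric])
    (simp add: sum.cartesian_product case_prod_beta)

context commuting_system begin

definition H :: "('a \<Rightarrow> real) set" where "H = {g \<in> L2. g \<in> borel_measurable (F 0)}"

lemma H_L2: "g \<in> H \<Longrightarrow> g \<in> L2" and H_F: "g \<in> H \<Longrightarrow> g \<in> borel_measurable (F 0)"
  by (auto simp: H_def)

lemma E0_H: "g \<in> L2 \<Longrightarrow> E 0 g \<in> H" using E_L2 E_meas by (simp add: H_def)

text \<open>
  The box sum at the scales \<open>r\<close>, projected on the past of \<open>0\<close>; composing two of these in complementary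
  directions gives another one.
\<close>

definition V :: "('d \<Rightarrow> nat) \<Rightarrow> ('a \<Rightarrow> real) \<Rightarrow> 'a \<Rightarrow> real" where
  "V r g = E 0 (S (supp r) (dyadic r) g)"

lemma V_H: "g \<in> L2 \<Longrightarrow> V r g \<in> H" unfolding V_def by (intro E0_H S_L2)

lemma V_0: "V (\<lambda>_. 0) g = E 0 g" by (simp add: V_def supp_def)

lemma S_single: "S {i} n g = (\<lambda>x. \<Sum>c\<in>{1..n $ i}. sh (axis i c) g x)"
  using S_insert[of i "{}" n g] by simp

lemma S_insert': assumes "i \<notin> J" shows "S (insert i J) n g = S J n (S {i} n g)"
  unfolding S_insert[OF assms] S_single S_sum S_sh[symmetric] by simp

lemma Box_nonneg: "k \<in> Box J n \<Longrightarrow> 0 \<le> k"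
proof (unfold less_eq_vec_def, intro allI)
  fix j assume "k \<in> Box J n"
  then have "if j \<in> J then 1 \<le> k $ j \<and> k $ j \<le> n $ j else k $ j = 0" by (simp add: Box_def)
  then show "0 $ j \<le> k $ j" by (auto split: if_splits)
qed

text \<open>
  The sites of the box are nonnegative, so their pasts contain that of \<open>0\<close> and the inner projection is
  absorbed.
\<close>

lemma E0_S_E0: assumes "h \<in> L2" shows "E 0 (S J n (E 0 h)) \<doteq> E 0 (S J n h)"
proof -
  have "E 0 (S J n (E 0 h)) \<doteq> (\<lambda>x. \<Sum>k\<in>Box J n. E 0 (sh k (E 0 h)) x)"
    unfolding S_def by (intro E_sum sh_L2 E_L2 assms)
  also have "\<dots> \<doteq> (\<lambda>x. \<Sum>k\<in>Box J n. E 0 (sh k h) x)"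
  proof (rule aeq_sum)
    fix k assume "k \<in> Box J n"
    then have k: "0 \<le> k" by (rule Box_nonneg)
    have "E 0 (sh k (E 0 h)) \<doteq> E 0 (E k (sh k h))"
      using E_sh[OF assms, of 0 k] by (intro E_cong sh_L2 E_L2 assms) (auto intro: aeq_sym)
    also have "\<dots> \<doteq> E 0 (sh k h)" by (rule E_tower[OF sh_L2[OF assms] k])
    finally show "E 0 (sh k (E 0 h)) \<doteq> E 0 (sh k h)" .
  qed
  also have "\<dots> \<doteq> E 0 (S J n h)"
    unfolding S_def by (rule aeq_sym) (intro E_sum sh_L2 assms)
  finally show ?thesis .
qed

lemma V_comp: assumes g: "g \<in> L2" and r: "r i = 0"
  shows "V r (V (single i s) g) \<doteq> V (r(i := s)) g"
proof (cases "s = 0")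
  case True
  then have "single i s = (\<lambda>_. 0)" "r(i := s) = r" using r by (auto simp: single_def)
  then show ?thesis using E0_S_E0[OF g] by (simp add: V_0) (simp add: V_def)
next
  case False
  have i: "i \<notin> supp r" using r by (simp add: supp_def)
  have su: "supp (single i s) = {i}" "supp (r(i := s)) = insert i (supp r)"
    using False by (auto simp: supp_def single_def)
  have "V r (V (single i s) g) \<doteq> E 0 (S (supp r) (dyadic r) (S {i} (dyadic (single i s)) g))"
    unfolding V_def su by (rule E0_S_E0[OF S_L2[OF g]])
  also have "S (supp r) (dyadic r) (S {i} (dyadic (single i s)) g)
      = S (supp r) (dyadic (r(i := s))) (S {i} (dyadic (r(i := s))) g)"
    using i by (subst S_cong[of "{i}" "dyadic (single i s)" "dyadic (r(i := s))"],
      simp add: dyadic_def single_def, intro S_cong) (auto simp: dyadic_def)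
  also have "\<dots> = S (supp (r(i := s))) (dyadic (r(i := s))) g"
    unfolding su by (rule S_insert'[OF i, symmetric])
  finally show ?thesis by (simp add: V_def)
qed

text \<open>
  Doubling the box in one direction: the second half is correlated with the first only through its
  projection on the past of the first half, and by commutation this projection is a box sum, over the
  other directions, of a projected one-dimensional sum.
\<close>

lemma box_doubling:
  assumes g: "g \<in> H" and i: "i \<notin> J" and n: "\<And>j. 1 \<le> n $ j" and m: "1 \<le> m"
  defines "u \<equiv> (\<lambda>x. \<Sum>c\<in>{1..m}. sh (axis i c) g x)"
  shows "(\<integral>x. S J n u x * sh (axis i m) (S J n u) x \<partial>M) \<le> nrm (S J n u) * nrm (S J n (E 0 u))"
proof -
  \<comment> \<open>the past of the corner of the old half, for which the sum over that half is measurable\<close>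
  define \<kappa> where "\<kappa> = idx i m n"
  have u: "u \<in> L2" unfolding u_def using g by (intro L2_sum sh_L2) (simp add: H_L2)
  have uF: "u \<in> borel_measurable (F (axis i m))"
    unfolding u_def
  proof (intro borel_measurable_sum sh_F'[OF H_F[OF g]])
    fix c assume "c \<in> {1..m}"
    then show "0 + axis i c \<le> axis i m" by (auto simp: less_eq_vec_def axis_nth')
  qed
  have PF: "S J n u \<in> borel_measurable (F \<kappa>)"
  proof (rule S_F[OF uF])
    fix h assume "h \<in> Box J n"
    then have h: "if j \<in> J then 1 \<le> h $ j \<and> h $ j \<le> n $ j else h $ j = 0" for j by (simp add: Box_def)
    show "axis i m + h \<le> \<kappa>"
    proof (unfold less_eq_vec_def, intro allI)
      fix j show "(axis i m + h) $ j \<le> \<kappa> $ j" using h[of j] i n[of j] by (auto simp: \<kappa>_def axis_nth' split: if_splits)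
    qed
  qed
  have "E \<kappa> (sh (axis i m) (S J n u)) \<doteq> sh (axis i m) (S J n (E 0 u))"
  proof -
    have eq: "sh (axis i m) (S J n f) = (\<lambda>x. \<Sum>k\<in>Box J n. sh (axis i m + k) f x)" for f
      by (simp add: S_def sh_def T_T add.commute)
    have "E \<kappa> (sh (axis i m) (S J n u)) \<doteq> (\<lambda>x. \<Sum>k\<in>Box J n. E \<kappa> (sh (axis i m + k) u) x)"
      unfolding eq by (intro E_sum sh_L2 u)
    also have "\<dots> \<doteq> (\<lambda>x. \<Sum>k\<in>Box J n. sh (axis i m + k) (E 0 u) x)"
    proof (rule aeq_sum)
      fix k assume "k \<in> Box J n"
      then have k: "if j \<in> J then 1 \<le> k $ j \<and> k $ j \<le> n $ j else k $ j = 0" for j by (simp add: Box_def)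
      let ?l = "axis i m + k" let ?L = "axis i m + ?l"
      have vm: "vmin ?L \<kappa> = ?l"
      proof (unfold vec_eq_iff, intro allI)
        fix j show "vmin ?L \<kappa> $ j = ?l $ j" using k[of j] i n[of j] m by (auto simp: \<kappa>_def axis_nth' split: if_splits)
      qed
      have "sh ?l u \<in> borel_measurable (F ?L)" by (rule sh_F[OF uF])
      then have "E \<kappa> (sh ?l u) \<doteq> E \<kappa> (E ?L (sh ?l u))"
        by (intro aeq_sym[OF E_cong[OF E_id]] E_L2 sh_L2 u)
      also have "\<dots> \<doteq> E ?l (sh ?l u)" using E_E[OF sh_L2[OF u], of \<kappa> ?L] vm by simp
      also have "\<dots> \<doteq> sh ?l (E 0 u)" using E_sh[OF u, of 0 ?l] by simp
      finally show "E \<kappa> (sh ?l u) \<doteq> sh ?l (E 0 u)" .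
    qed
    finally show ?thesis unfolding eq .
  qed
  note * = this
  have "(\<integral>x. S J n u x * sh (axis i m) (S J n u) x \<partial>M) = (\<integral>x. S J n u x * E \<kappa> (sh (axis i m) (S J n u)) x \<partial>M)"
    by (intro E_int PF S_L2 sh_L2 u)
  also have "\<dots> \<le> nrm (S J n u) * nrm (E \<kappa> (sh (axis i m) (S J n u)))"
    by (intro L2_CS S_L2 sh_L2 E_L2 u)
  also have "nrm (E \<kappa> (sh (axis i m) (S J n u))) = nrm (S J n (E 0 u))"
    using nrm_aeq[OF *] nrm_sh[of "S J n (E 0 u)" "axis i m"] u by (simp add: S_L2 sh_L2 E_L2)
  finally show ?thesis .
qed

lemma box_one_direction:
  assumes g: "g \<in> H" and i: "i \<notin> J" and n: "\<And>j. 1 \<le> n $ j" and R: "n $ i \<le> 2 ^ R"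
  shows "nrm (S (insert i J) n g) \<le> 4 * sqrt (n $ i) * (\<Sum>s\<le>R. nrm (S J n (V (single i s) g)) / sqrt (2 ^ (s - 1)))"
proof -
  have gL: "g \<in> L2" using g by (rule H_L2)
  define u where "u = (\<lambda>N x. \<Sum>c\<in>{1..int N}. sh (axis i c) g x)"
  define a where "a N = nrm (S J n (u N))" for N
  define b where "b s = nrm (S J n (E 0 (u (2 ^ s))))" for s
  have uL: "u N \<in> L2" for N unfolding u_def by (intro L2_sum sh_L2 gL)
  have split: "u (N + K) = (\<lambda>x. u N x + sh (axis i (int N)) (u K) x)" for N K
  proof
    fix x
    have "{1..int (N + K)} = {1..int N} \<union> (\<lambda>c. int N + c) ` {1..int K}"
      by auto
    then have "u (N + K) x = (\<Sum>c\<in>{1..int N}. sh (axis i c) g x) + (\<Sum>c\<in>(\<lambda>c. int N + c) ` {1..int K}. sh (axis i c) g x)"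
      unfolding u_def by (simp only:) (rule sum.union_disjoint, auto)
    also have "(\<Sum>c\<in>(\<lambda>c. int N + c) ` {1..int K}. sh (axis i c) g x) = sh (axis i (int N)) (u K) x"
      by (subst sum.reindex) (auto simp: u_def sh_def T_T axis_add add.commute)
    finally show "u (N + K) x = u N x + sh (axis i (int N)) (u K) x" by (simp add: u_def)
  qed
  have Ssplit: "S J n (u (N + K)) = (\<lambda>x. S J n (u N) x + sh (axis i (int N)) (S J n (u K)) x)" for N K
    unfolding split S_add S_sh by simp
  have "a (nat (n $ i)) \<le> 4 * sqrt (real (nat (n $ i))) * (a 1 + (\<Sum>q<R. b q / sqrt (2 ^ q)))"
  proof (rule dyadic_doubling_bound)
    show "0 \<le> a N" "0 \<le> b N" for N by (auto simp: a_def b_def)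
    show "a (N + K) \<le> a N + a K" for N K
      using nrm_add[OF S_L2[OF uL] sh_L2[OF S_L2[OF uL]]] nrm_sh[OF S_L2[OF uL]]
      unfolding a_def Ssplit by metis
    show "(a (2 * 2 ^ s))\<^sup>2 \<le> 2 * (a (2 ^ s))\<^sup>2 + 2 * (a (2 ^ s) * b s)" for s
    proof -
      let ?P = "S J n (u (2 ^ s))"
      let ?Q = "sh (axis i (int (2 ^ s))) ?P"
      have L: "?P \<in> L2" "?Q \<in> L2" by (intro sh_L2 S_L2 uL)+
      have "a (2 * 2 ^ s) = nrm (\<lambda>x. ?P x + ?Q x)"
        unfolding a_def mult_2 Ssplit ..
      then have "(a (2 * 2 ^ s))\<^sup>2 = (\<integral>x. (?P x)\<^sup>2 + 2 * (?P x * ?Q x) + (?Q x)\<^sup>2 \<partial>M)"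
        by (simp add: nrm_sq power2_sum algebra_simps)
      also have "\<dots> = (nrm ?P)\<^sup>2 + 2 * (\<integral>x. ?P x * ?Q x \<partial>M) + (nrm ?Q)\<^sup>2"
        using L L2_sq L2_mult by (simp add: nrm_sq)
      also have "nrm ?Q = nrm ?P" by (rule nrm_sh[OF L(1)])
      finally show ?thesis
        using box_doubling[OF g i n, of "int (2 ^ s)"] by (simp add: a_def b_def u_def)
    qed
    show "1 \<le> nat (n $ i)" using n[of i] by simp
    show "nat (n $ i) \<le> 2 ^ R" using R by (simp add: nat_le_iff)
  qed
  moreover have "S (insert i J) n g = S J n (u (nat (n $ i)))"
    unfolding S_insert'[OF i] S_single u_def using n[of i] by simp
  moreover have "real (nat (n $ i)) = n $ i" using n[of i] by simp
  moreover have "a 1 + (\<Sum>q<R. b q / sqrt (2 ^ q)) = (\<Sum>s\<le>R. nrm (S J n (V (single i s) g)) / sqrt (2 ^ (s - 1)))"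
  proof -
    have "a 1 = nrm (S J n g)"
    proof -
      have "u 1 = sh (axis i 1) g" by (simp add: u_def)
      then show ?thesis unfolding a_def using nrm_sh[OF S_L2[OF gL]] by (simp add: S_sh)
    qed
    also have "\<dots> = nrm (S J n (V (single i 0) g))"
    proof -
      have "single i 0 = (\<lambda>_. 0)" by (auto simp: single_def)
      then have "V (single i 0) g \<doteq> g" using E_id[OF H_F[OF g] gL] by (simp add: V_0)
      from nrm_aeq[OF S_aeq[OF this]] show ?thesis using gL by (simp add: S_L2 V_H[THEN H_L2])
    qed
    finally have 1: "a 1 = nrm (S J n (V (single i 0) g))" .
    have 2: "b q = nrm (S J n (V (single i (Suc q)) g))" for q
    proof -
      have "supp (single i (Suc q)) = {i}" by (auto simp: supp_def single_def)
      then have "V (single i (Suc q)) g = E 0 (u (2 ^ q))"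
        by (simp add: V_def S_single u_def dyadic_def single_def)
      then show ?thesis by (simp add: b_def)
    qed
    show ?thesis unfolding 1 2 by (subst sum.atMost_shift) simp
  qed
  ultimately show ?thesis by (simp add: a_def)
qed

text \<open>Iterating over the directions; every direction contributes a dyadic scale to the index \<open>r\<close>.\<close>

lemma box_sum_bound:
  assumes n: "\<And>j. 1 \<le> n $ j" "\<And>j. n $ j \<le> 2 ^ R" and g: "g \<in> H"
  shows "nrm (S J n g) \<le> 4 ^ card J * sqrt (vol_on J n) * (\<Sum>r\<in>rset J R. wt r * nrm (V r g))"
proof -
  have "finite J" by simp
  then show ?thesis using g
  proof (induction J arbitrary: g rule: finite_induct)
    case empty
    have "nrm (V (\<lambda>_. 0) g) = nrm g"
      unfolding V_0 using empty by (intro nrm_aeq E_id E_L2) (auto simp: H_def)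
    then show ?case by (simp add: rset_empty vol_on_def wt_0)
  next
    case (insert i J)
    have gL: "g \<in> L2" using insert.prems by (rule H_L2)
    have "nrm (S (insert i J) n g) \<le> 4 * sqrt (n $ i) * (\<Sum>s\<le>R. nrm (S J n (V (single i s) g)) / sqrt (2 ^ (s - 1)))"
      by (rule box_one_direction) (use insert n in auto)
    also have "\<dots> \<le> 4 * sqrt (n $ i) * (\<Sum>s\<le>R. (4 ^ card J * sqrt (vol_on J n) * (\<Sum>r\<in>rset J R. wt r * nrm (V r (V (single i s) g)))) / sqrt (2 ^ (s - 1)))"
      using n(1)[of i] by (intro mult_left_mono sum_mono divide_right_mono insert.IH V_H gL) auto
    also have "\<dots> = 4 ^ card (insert i J) * sqrt (vol_on (insert i J) n) * (\<Sum>s\<le>R. \<Sum>r\<in>rset J R. wt r / sqrt (2 ^ (s - 1)) * nrm (V r (V (single i s) g)))"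
      using insert.hyps by (simp add: vol_on_insert real_sqrt_mult sum_distrib_left sum_divide_distrib mult_ac)
    also have "(\<Sum>s\<le>R. \<Sum>r\<in>rset J R. wt r / sqrt (2 ^ (s - 1)) * nrm (V r (V (single i s) g)))
        = (\<Sum>s\<le>R. \<Sum>r\<in>rset J R. wt (r(i := s)) * nrm (V (r(i := s)) g))"
    proof (intro sum.cong refl)
      fix s r assume "r \<in> rset J R"
      then have r: "r i = 0" using insert.hyps by (simp add: rset_def)
      have "nrm (V r (V (single i s) g)) = nrm (V (r(i := s)) g)"
        by (rule nrm_aeq[OF V_comp[where r=r and i=i, OF gL r]]) (auto intro: V_H[THEN H_L2] gL)
      then show "wt r / sqrt (2 ^ (s - 1)) * nrm (V r (V (single i s) g)) = wt (r(i := s)) * nrm (V (r(i := s)) g)"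
        using wt_upd[where r=r and i=i and s=s, OF r] by simp
    qed
    also have "\<dots> = (\<Sum>r\<in>rset (insert i J) R. wt r * nrm (V r g))"
      using rset_insert_sum[OF insert.hyps(2), of "\<lambda>r. wt r * nrm (V r g)" R] by simp
    finally show ?case .
  qed
qed

end

section \<open>From the projective series to its dyadic form\<close>

text \<open>
  Average the inequality \<open>a m \<le> a c + a (m - c)\<close> over all \<open>c\<close> from \<open>0\<close> to \<open>m\<close>.
\<close>

lemma subadditive_average:
  fixes a :: "int \<Rightarrow> real"
  assumes "0 \<le> m" "a 0 = 0" "\<And>c. 0 \<le> a c"
    and sub: "\<And>c. 0 \<le> c \<Longrightarrow> c \<le> m \<Longrightarrow> a m \<le> a c + a (m - c)"
  shows "real_of_int m * a m \<le> 2 * (\<Sum>c\<in>{1..m}. a c)"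
proof -
  have "(real_of_int m + 1) * a m = (\<Sum>c\<in>{0..m}. a m)" using assms(1) by simp
  also have "\<dots> \<le> (\<Sum>c\<in>{0..m}. a c + a (m - c))" using sub by (intro sum_mono) auto
  also have "\<dots> = (\<Sum>c\<in>{0..m}. a c) + (\<Sum>c\<in>{0..m}. a (m - c))" by (rule sum.distrib)
  also have "(\<Sum>c\<in>{0..m}. a (m - c)) = (\<Sum>c\<in>{0..m}. a c)"
    by (rule sum.reindex_bij_witness[of _ "\<lambda>c. m - c" "\<lambda>c. m - c"]) auto
  also have "(\<Sum>c\<in>{0..m}. a c) = (\<Sum>c\<in>{1..m}. a c)"
  proof (intro sum.mono_neutral_right ballI)
    fix c assume "c \<in> {0..m} - {1..m}"
    then have "c = 0" by auto
    then show "a c = 0" using assms(2) by simp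
  qed auto
  finally show ?thesis using assms(3)[of m] by (simp add: algebra_simps)
qed

text \<open>
  In the averaging of \<open>a m\<close> below, the coordinates in \<open>J\<close> have already been averaged over.
\<close>

definition mix :: "'d set \<Rightarrow> int ^ 'd \<Rightarrow> int ^ 'd \<Rightarrow> int ^ 'd::finite" where
  "mix J k m = (\<chi> j. if j \<in> J then k $ j else m $ j)"

lemma subadditive_box_average:
  fixes a :: "int ^ 'd::finite \<Rightarrow> real"
  assumes a0: "\<And>u i. a (idx i 0 u) = 0" and a: "\<And>u. 0 \<le> a u"
    and sub: "\<And>u i c m. 0 \<le> c \<Longrightarrow> c \<le> m \<Longrightarrow> a (idx i m u) \<le> a (idx i c u) + a (idx i (m - c) u)"
    and m: "\<And>j. 0 \<le> m $ j"
  shows "vol m * a m \<le> 2 ^ CARD('d) * (\<Sum>u\<in>Box UNIV m. a u)"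
proof -
  have "vol_on J m * a m \<le> 2 ^ card J * (\<Sum>k\<in>Box J m. a (mix J k m))" for J
  proof -
    have "finite J" by simp
    then show ?thesis
    proof induction
      case empty
      have "mix {} 0 m = m" by (auto simp: mix_def vec_eq_iff)
      then show ?case by (simp add: vol_on_def)
    next
      case (insert i J)
      have "vol_on (insert i J) m * a m = m $ i * (vol_on J m * a m)"
        using insert.hyps by (simp add: vol_on_insert)
      also have "\<dots> \<le> m $ i * (2 ^ card J * (\<Sum>k\<in>Box J m. a (mix J k m)))"
        using m[of i] insert.IH by (intro mult_left_mono) auto
      also have "\<dots> = 2 ^ card J * (\<Sum>k\<in>Box J m. m $ i * a (mix J k m))"
        by (simp add: sum_distrib_left mult_ac)
      also have "\<dots> \<le> 2 ^ card J * (\<Sum>k\<in>Box J m. 2 * (\<Sum>c\<in>{1..m $ i}. a (mix (insert i J) (axis i c + k) m)))"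
      proof (intro mult_left_mono sum_mono)
        fix k assume "k \<in> Box J m"
        then have k: "k $ i = 0" using insert.hyps by (auto simp: Box_def)
        have 1: "mix (insert i J) (axis i c + k) m = idx i c (mix J k m)" for c
          using k insert.hyps by (auto simp: vec_eq_iff mix_def axis_nth')
        have 2: "idx i (m $ i) (mix J k m) = mix J k m"
          using insert.hyps by (auto simp: vec_eq_iff mix_def)
        have "m $ i * a (idx i (m $ i) (mix J k m)) \<le> 2 * (\<Sum>c\<in>{1..m $ i}. a (idx i c (mix J k m)))"
          by (rule subadditive_average) (use m[of i] a0 a sub in auto)
        then show "m $ i * a (mix J k m) \<le> 2 * (\<Sum>c\<in>{1..m $ i}. a (mix (insert i J) (axis i c + k) m))"
          unfolding 1 2 .
      qed simp
      also have "\<dots> = 2 ^ card (insert i J) * (\<Sum>k\<in>Box J m. \<Sum>c\<in>{1..m $ i}. a (mix (insert i J) (axis i c + k) m))"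
        using insert.hyps by (simp add: sum_distrib_left mult_ac)
      also have "(\<Sum>k\<in>Box J m. \<Sum>c\<in>{1..m $ i}. a (mix (insert i J) (axis i c + k) m))
          = (\<Sum>k\<in>Box (insert i J) m. a (mix (insert i J) k m))"
        by (subst sum.swap, subst sum.reindex_bij_betw[OF Box_insert_bij[OF insert.hyps(2)], symmetric])
          (simp add: sum.cartesian_product case_prod_beta)
      finally show ?case .
    qed
  qed
  from this[of UNIV] show ?thesis by (simp add: vol_UNIV mix_def)
qed

text \<open>
  Since \<open>2 powr (- 3 / 2) \<le> 1 / 2\<close>, every term is at most twice its difference with the next one and the
  sum telescopes.  Scales \<open>0\<close> and \<open>1\<close> both stand for one summand, whence another factor \<open>2\<close>.
\<close>

lemma dyadic_tail_sum:
  fixes u :: real assumes u: "0 < u"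
  shows "(\<Sum>s\<le>R. if u \<le> 2 ^ (s - 1) then (2 ^ (s - 1)) powr (- 3 / 2) else 0) \<le> 4 * u powr (- 3 / 2)"
proof -
  let ?f = "\<lambda>q::nat. if u \<le> 2 ^ q then (2 ^ q) powr (- 3 / 2) else (0 :: real)"
  have half: "2 powr (- 3 / 2) \<le> (1 / 2 :: real)"
  proof -
    have "2 powr (- 3 / 2) \<le> 2 powr (- 1 :: real)" by (rule powr_mono) auto
    also have "\<dots> = 1 / 2" by (rule powr_neg_one) simp
    finally show ?thesis .
  qed
  have *: "(\<Sum>q<n. ?f q) \<le> 2 * (u powr (- 3 / 2) - min (u powr (- 3 / 2)) ((2 ^ n) powr (- 3 / 2)))" for n
  proof (induction n)
    case (Suc n)
    have p: "(2 ^ Suc n :: real) powr (- 3 / 2) = 2 powr (- 3 / 2) * (2 ^ n) powr (- 3 / 2)"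
      by (simp add: powr_mult)
    have p2: "(2 ^ Suc n :: real) powr (- 3 / 2) \<le> (2 ^ n) powr (- 3 / 2) / 2"
      unfolding p using mult_right_mono[OF half, of "(2 ^ n) powr (- 3 / 2)"] by simp
    show ?case
    proof (cases "u \<le> 2 ^ n")
      case True
      have 1: "(2 ^ n :: real) powr (- 3 / 2) \<le> u powr (- 3 / 2)"
        using True u by (intro powr_mono2') auto
      have "(\<Sum>q<Suc n. ?f q) = (\<Sum>q<n. ?f q) + (2 ^ n) powr (- 3 / 2)" using True by simp
      then show ?thesis using Suc 1 p2 by (simp add: min_def split: if_splits)
    next
      case False
      have "?f q = 0" if "q < Suc n" for q
      proof -
        have "(2::real) ^ q \<le> 2 ^ n" using that by (intro power_increasing) auto
        then have "\<not> u \<le> 2 ^ q" using False by linarith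
        then show ?thesis by simp
      qed
      then have "(\<Sum>q<Suc n. ?f q) = 0" by (intro sum.neutral) auto
      then show ?thesis by simp
    qed
  qed (simp add: min_def)
  have "(\<Sum>s\<le>R. ?f (s - 1)) = ?f 0 + (\<Sum>q<R. ?f q)"
    unfolding sum.atMost_shift diff_Suc_1 by simp
  also have "\<dots> \<le> (\<Sum>q<Suc R. ?f q) + (\<Sum>q<Suc R. ?f q)"
  proof (rule add_mono)
    show "?f 0 \<le> (\<Sum>q<Suc R. ?f q)" by (rule member_le_sum) auto
    show "(\<Sum>q<R. ?f q) \<le> (\<Sum>q<Suc R. ?f q)" by (rule sum_mono2) auto
  qed
  also have "\<dots> \<le> 4 * u powr (- 3 / 2)"
  proof -
    have "0 \<le> min (u powr (- 3 / 2)) ((2 ^ Suc R) powr (- 3 / 2))" by (intro min.boundedI powr_ge_zero)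
    then have "2 * (u powr (- 3 / 2) - min (u powr (- 3 / 2)) ((2 ^ Suc R) powr (- 3 / 2))) \<le> 2 * u powr (- 3 / 2)"
      by (simp only: mult_le_cancel_left_pos zero_less_numeral diff_le_eq le_add_same_cancel1)
    with *[of "Suc R"] have "(\<Sum>q<Suc R. ?f q) \<le> 2 * u powr (- 3 / 2)" by (rule order_trans)
    from add_mono[OF this this] show ?thesis by (simp only: distrib_right[symmetric]) simp
  qed
  finally show ?thesis .
qed

lemma vol_powr: assumes "\<And>j. 1 \<le> u $ j" shows "vol u powr p = (\<Prod>j\<in>UNIV. real_of_int (u $ j) powr p)"
proof -
  have "(\<Prod>j\<in>J. real_of_int (u $ j)) powr p = (\<Prod>j\<in>J. real_of_int (u $ j) powr p)" for J
  proof (induction J rule: infinite_finite_induct)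
    case (insert j J)
    have "0 \<le> (\<Prod>j\<in>J. real_of_int (u $ j))" "0 \<le> u $ j"
      using assms by (auto intro!: prod_nonneg intro: order_trans[OF zero_le_one])
    then show ?case using insert by (simp add: powr_mult)
  qed auto
  then show ?thesis by (simp add: vol_def)
qed

lemma powr_minus_half: assumes "0 < (x::real)" shows "x powr (- 1 / 2) = 1 / sqrt x"
proof -
  have "x powr (- 1 / 2) = x powr (- (1 / 2))" by (rule arg_cong[where f="(powr) x"]) simp
  also have "\<dots> = inverse (x powr (1 / 2))" by (rule powr_minus)
  finally show ?thesis using assms by (simp add: powr_half_sqrt inverse_eq_divide)
qed

lemma powr_minus_3_half: assumes "0 < (x::real)" shows "x powr (- 3 / 2) = x powr (- 1 / 2) / x"
proof -
  have "x powr (- 3 / 2) = x powr (- 1 / 2 - 1)" by (rule arg_cong[where f="(powr) x"]) simp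
  also have "\<dots> = x powr (- 1 / 2) / x powr 1" by (rule powr_diff)
  finally show ?thesis using assms by simp
qed

lemma rset_UNIV: "rset UNIV R = PiE UNIV (\<lambda>_. {..R})" by (auto simp: rset_def PiE_iff)

text \<open>
  The average over the box of \<open>u \<le> m\<close> dominates \<open>a m\<close> up to the factor \<open>2\<^sup>d\<close>; summing over
  dyadic \<open>m\<close>, each \<open>u\<close> receives a geometric sum over \<open>m \<ge> u\<close> in every direction.
\<close>

lemma dyadic_sum_le:
  fixes a :: "int ^ 'd::finite \<Rightarrow> real"
  assumes a0: "\<And>u i. a (idx i 0 u) = 0" and a: "\<And>u. 0 \<le> a u"
    and sub: "\<And>u i c m. 0 \<le> c \<Longrightarrow> c \<le> m \<Longrightarrow> a (idx i m u) \<le> a (idx i c u) + a (idx i (m - c) u)"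
    and B: "\<And>n. (\<Sum>u\<in>Box UNIV n. vol u powr (- 3 / 2) * a u) \<le> B"
  shows "(\<Sum>r\<in>rset UNIV R. wt r * a (dyadic r)) \<le> 2 ^ CARD('d) * 4 ^ CARD('d) * B"
proof -
  define N :: "int ^ 'd" where "N = (\<chi> j. 2 ^ R)"
  let ?w = "\<lambda>r. vol (dyadic r :: int ^ 'd) powr (- 3 / 2)"
  have d1: "1 \<le> (dyadic r :: int ^ 'd) $ j" for r j by (simp add: dyadic_def)
  have vpos: "0 < vol (dyadic r :: int ^ 'd)" for r unfolding vol_UNIV by (rule vol_on_pos[OF d1])
  have w: "wt r / vol (dyadic r :: int ^ 'd) = ?w r" for r :: "'d \<Rightarrow> nat"
  proof -
    have "wt r = vol (dyadic r :: int ^ 'd) powr (- 1 / 2)"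
      unfolding vol_powr[OF d1] wt_def
    proof (intro prod.cong refl)
      fix j
      have "real_of_int ((dyadic r :: int ^ 'd) $ j) = 2 ^ (r j - 1)" by (simp add: dyadic_def)
      then show "1 / sqrt (2 ^ (r j - 1)) = real_of_int ((dyadic r :: int ^ 'd) $ j) powr (- 1 / 2)"
        by (simp only: powr_minus_half[of "2 ^ (r j - 1)"] zero_less_power zero_less_numeral)
    qed
    then show ?thesis using powr_minus_3_half[OF vpos[of r]] by (simp only:)
  qed
  have fin: "finite (rset UNIV R :: ('d \<Rightarrow> nat) set)" by (rule finite_rset) simp
  have "(\<Sum>r\<in>rset UNIV R. wt r * a (dyadic r))
      \<le> (\<Sum>r\<in>rset UNIV R. 2 ^ CARD('d) * (\<Sum>u\<in>Box UNIV (dyadic r). ?w r * a u))"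
  proof (rule sum_mono)
    fix r :: "'d \<Rightarrow> nat"
    have "vol (dyadic r) * a (dyadic r) \<le> 2 ^ CARD('d) * (\<Sum>u\<in>Box UNIV (dyadic r). a u)"
      using subadditive_box_average[OF a0 a sub, of "dyadic r"] d1[of r] by (meson order_trans zero_le_one)
    then have "?w r * (vol (dyadic r) * a (dyadic r)) \<le> ?w r * (2 ^ CARD('d) * (\<Sum>u\<in>Box UNIV (dyadic r). a u))"
      by (rule mult_left_mono) simp
    moreover have "?w r * (vol (dyadic r) * a (dyadic r)) = wt r * a (dyadic r)"
      unfolding w[symmetric] using vpos[of r] by simp
    ultimately show "wt r * a (dyadic r) \<le> 2 ^ CARD('d) * (\<Sum>u\<in>Box UNIV (dyadic r). ?w r * a u)"
      by (simp only: sum_distrib_left[symmetric] mult.left_commute)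
  qed
  also have "\<dots> = 2 ^ CARD('d) * (\<Sum>r\<in>rset UNIV R. \<Sum>u\<in>{u \<in> Box UNIV N. u \<in> Box UNIV (dyadic r)}. ?w r * a u)"
  proof -
    have "Box UNIV (dyadic r) = {u \<in> Box UNIV N. u \<in> Box UNIV (dyadic r)}" if "r \<in> rset UNIV R" for r :: "'d \<Rightarrow> nat"
    proof -
      have "(dyadic r :: int ^ 'd) $ j \<le> N $ j" for j
      proof -
        have "r j - 1 \<le> R" using that by (simp add: rset_def) (meson diff_le_self order_trans)
        then show ?thesis unfolding dyadic_def N_def by (simp add: power_increasing)
      qed
      then show ?thesis unfolding Box_def by (auto intro: order_trans)
    qed
    then show ?thesis by (simp add: sum_distrib_left)
  qed
  also have "(\<Sum>r\<in>rset UNIV R. \<Sum>u\<in>{u \<in> Box UNIV N. u \<in> Box UNIV (dyadic r)}. ?w r * a u)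
      = (\<Sum>u\<in>Box UNIV N. \<Sum>r\<in>{r \<in> rset UNIV R. u \<in> Box UNIV (dyadic r)}. ?w r * a u)"
    by (rule sum.swap_restrict) (auto simp: fin)
  also have "\<dots> \<le> (\<Sum>u\<in>Box UNIV N. 4 ^ CARD('d) * (vol u powr (- 3 / 2) * a u))"
  proof (rule sum_mono)
    fix u assume u: "u \<in> Box UNIV N"
    then have u1: "1 \<le> u $ j" for j by (simp add: Box_def)
    let ?g = "\<lambda>j s. if real_of_int (u $ j) \<le> 2 ^ (s - 1) then (2 ^ (s - 1)) powr (- 3 / 2) else (0 :: real)"
    have "(\<Sum>r\<in>{r \<in> rset UNIV R. u \<in> Box UNIV (dyadic r)}. ?w r)
        = (\<Sum>r\<in>rset UNIV R. if u \<in> Box UNIV (dyadic r) then ?w r else 0)"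
      by (rule sum.inter_filter[OF fin])
    also have "\<dots> = (\<Sum>r\<in>rset UNIV R. \<Prod>j\<in>UNIV. ?g j (r j))"
    proof (intro sum.cong refl)
      fix r :: "'d \<Rightarrow> nat"
      have iff: "u $ j \<le> (dyadic r :: int ^ 'd) $ j \<longleftrightarrow> real_of_int (u $ j) \<le> 2 ^ (r j - 1)" for j
      proof -
        have "real_of_int (2 ^ (r j - 1)) = 2 ^ (r j - 1)" by simp
        then show ?thesis unfolding dyadic_def by (metis of_int_le_iff vec_lambda_beta)
      qed
      show "(if u \<in> Box UNIV (dyadic r) then ?w r else 0) = (\<Prod>j\<in>UNIV. ?g j (r j))"
      proof (cases "u \<in> Box UNIV (dyadic r)")
        case True
        then have "real_of_int (u $ j) \<le> 2 ^ (r j - 1)" for j using iff[of j] by (simp add: Box_def)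
        then show ?thesis using True unfolding vol_powr[OF d1] by (simp add: dyadic_def)
      next
        case False
        then obtain j where "\<not> real_of_int (u $ j) \<le> 2 ^ (r j - 1)" using u1 iff by (auto simp: Box_def)
        then have g0: "?g j (r j) = 0" by simp
        have "\<exists>j\<in>UNIV. ?g j (r j) = 0" by (rule bexI[where x=j]) (rule g0, simp)
        then have "(\<Prod>j\<in>UNIV. ?g j (r j)) = 0" by (rule prod_zero[OF finite])
        then show ?thesis using False by simp
      qed
    qed
    also have "\<dots> = (\<Prod>j\<in>UNIV. \<Sum>s\<le>R. ?g j s)"
      unfolding rset_UNIV by (rule prod_sum_PiE[symmetric]) auto
    also have "\<dots> \<le> (\<Prod>j\<in>(UNIV::'d set). 4 * real_of_int (u $ j) powr (- 3 / 2))"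
    proof (rule prod_mono)
      fix j
      have "0 < u $ j" using u1[of j] by simp
      then have "(\<Sum>s\<le>R. ?g j s) \<le> 4 * real_of_int (u $ j) powr (- 3 / 2)"
        by (intro dyadic_tail_sum) simp
      moreover have "0 \<le> (\<Sum>s\<le>R. ?g j s)" by (intro sum_nonneg) auto
      ultimately show "0 \<le> (\<Sum>s\<le>R. ?g j s) \<and> (\<Sum>s\<le>R. ?g j s) \<le> 4 * real_of_int (u $ j) powr (- 3 / 2)" by simp
    qed
    also have "\<dots> = 4 ^ CARD('d) * vol u powr (- 3 / 2)"
      unfolding vol_powr[OF u1] by (simp add: prod.distrib)
    finally have "(\<Sum>r\<in>{r \<in> rset UNIV R. u \<in> Box UNIV (dyadic r)}. ?w r) * a u \<le> 4 ^ CARD('d) * vol u powr (- 3 / 2) * a u"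
      by (rule mult_right_mono[OF _ a])
    then show "(\<Sum>r\<in>{r \<in> rset UNIV R. u \<in> Box UNIV (dyadic r)}. ?w r * a u) \<le> 4 ^ CARD('d) * (vol u powr (- 3 / 2) * a u)"
      by (simp only: sum_distrib_right mult.assoc)
  qed
  also have "\<dots> \<le> 4 ^ CARD('d) * B"
    using B[of N] by (simp add: sum_distrib_left[symmetric])
  finally show ?thesis by simp
qed

context commuting_system begin

text \<open>
  The dyadic form of the projective series, as a property and as a seminorm.
\<close>

definition summ :: "('a \<Rightarrow> real) \<Rightarrow> bool" where
  "summ g \<longleftrightarrow> (\<lambda>r. wt r * nrm (V r g)) summable_on UNIV"

definition MW :: "('a \<Rightarrow> real) \<Rightarrow> real" where
  "MW g = (\<Sum>\<^sub>\<infinity>r. wt r * nrm (V r g))"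

lemma nrm_E_mono: assumes "g \<in> L2" "k \<le> l" shows "nrm (E k g) \<le> nrm (E l g)"
proof -
  have "nrm (E k g) = nrm (E k (E l g))"
    by (rule nrm_aeq[OF aeq_sym[OF E_tower[OF assms]]]) (auto intro: E_L2 assms)
  also have "\<dots> \<le> nrm (E l g)" by (intro E_nrm E_L2 assms)
  finally show ?thesis .
qed

lemma nrm_E_sh: assumes "g \<in> L2" shows "nrm (E k (sh h g)) = nrm (E (k - h) g)"
  using nrm_aeq[OF E_sh'[OF assms, of k h]] nrm_sh[OF E_L2[OF assms]] by (simp add: E_L2 sh_L2 assms)

text \<open>
  Up to a translation into the past, which can only decrease the norm, \<open>V r X\<close> is the conditional
  expectation of the sum over the box of sides \<open>dyadic r\<close>.
\<close>

lemma summ_I: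
  assumes X: "X \<in> L2"
    and B: "\<And>n. (\<Sum>u\<in>Box UNIV n. vol u powr (- 3 / 2) * nrm (E 1 (S UNIV u X))) \<le> B"
  shows "summ X"
proof -
  define a where "a u = nrm (E 1 (S UNIV u X))" for u
  define u1 where "u1 i = (UNIV - {i} :: 'd set)" for i
  have S1: "S UNIV u X = (\<lambda>x. \<Sum>c\<in>{1..u $ i}. sh (axis i c) (S (u1 i) u X) x)" for u i
    using S_insert[of i "u1 i" u X] by (simp add: u1_def insert_UNIV)
  have S2: "S (u1 i) (idx i m u) X = S (u1 i) u X" for i m u by (rule S_cong) (auto simp: u1_def)
  have zero: "a (idx i 0 u) = 0" for u i
  proof -
    have "S UNIV (idx i 0 u) X = (\<lambda>x. 0)" by (subst S1[of _ i]) simp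
    moreover have "E 1 (\<lambda>x. 0) \<doteq> (\<lambda>x. 0)" by (rule E_id) (auto intro: L2_const)
    ultimately have "a (idx i 0 u) = nrm (\<lambda>x. 0)"
      unfolding a_def using nrm_aeq[of "E 1 (\<lambda>x. 0)" "\<lambda>x. 0"] by (auto intro: L2_const E_L2)
    then show ?thesis by (simp add: nrm_def)
  qed
  have sub: "a (idx i m u) \<le> a (idx i c u) + a (idx i (m - c) u)" if c: "0 \<le> c" "c \<le> m" for u i c m
  proof -
    have eq: "S UNIV (idx i m u) X = (\<lambda>x. S UNIV (idx i c u) X x + sh (axis i c) (S UNIV (idx i (m - c) u) X) x)"
    proof
      fix x
      have *: "{1..m} = {1..c} \<union> (\<lambda>b. c + b) ` {1..m - c}" using c by auto
      have "(\<Sum>b\<in>{1..m}. sh (axis i b) (S (u1 i) u X) x)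
        = (\<Sum>b\<in>{1..c}. sh (axis i b) (S (u1 i) u X) x) + (\<Sum>b\<in>(\<lambda>b. c + b) ` {1..m - c}. sh (axis i b) (S (u1 i) u X) x)"
        unfolding * by (rule sum.union_disjoint) auto
      also have "(\<Sum>b\<in>(\<lambda>b. c + b) ` {1..m - c}. sh (axis i b) (S (u1 i) u X) x)
        = (\<Sum>b\<in>{1..m - c}. sh (axis i b) (S (u1 i) u X) (T (axis i c) x))"
        by (subst sum.reindex) (auto simp: sh_def T_T axis_add add.commute)
      finally show "S UNIV (idx i m u) X x = S UNIV (idx i c u) X x + sh (axis i c) (S UNIV (idx i (m - c) u) X) x"
        by (simp add: S1[of _ i] S2 sh_def[of "axis i c" "\<lambda>x. \<Sum>c\<in>{1..m - c}. _ c x"])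
    qed
    let ?A = "S UNIV (idx i c u) X" let ?B = "S UNIV (idx i (m - c) u) X"
    have L: "?A \<in> L2" "?B \<in> L2" by (intro S_L2 X)+
    have "a (idx i m u) = nrm (\<lambda>x. E 1 ?A x + E 1 (sh (axis i c) ?B) x)"
      unfolding a_def eq by (rule nrm_aeq[OF E_add]) (auto intro: L sh_L2 E_L2 L2_add)
    also have "\<dots> \<le> a (idx i c u) + nrm (E 1 (sh (axis i c) ?B))"
      unfolding a_def by (intro nrm_add E_L2 L sh_L2)
    also have "nrm (E 1 (sh (axis i c) ?B)) \<le> a (idx i (m - c) u)"
      unfolding a_def nrm_E_sh[OF L(2)]
      by (rule nrm_E_mono[OF L(2)]) (use c in \<open>auto simp: less_eq_vec_def axis_nth'\<close>)
    finally show ?thesis by simp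
  qed
  have Va: "nrm (V r X) \<le> a (dyadic r)" for r
  proof -
    define h :: "int ^ 'd" where "h = (\<chi> j. if r j = 0 then 1 else 0)"
    have "S (supp r) (dyadic r) X = sh (- h) (S UNIV (dyadic r) X)"
    proof
      fix x
      have "(\<Sum>k\<in>Box (supp r) (dyadic r). sh k X x) = (\<Sum>k\<in>Box UNIV (dyadic r). sh (k - h) X x)"
      proof (rule sum.reindex_bij_witness[of _ "\<lambda>k. k - h" "\<lambda>k. k + h"])
        fix k :: "int ^ 'd" assume k: "k \<in> Box (supp r) (dyadic r)"
        have "1 \<le> (k + h) $ j \<and> (k + h) $ j \<le> dyadic r $ j" for j
        proof -
          have "if j \<in> supp r then 1 \<le> k $ j \<and> k $ j \<le> dyadic r $ j else k $ j = 0" using k unfolding Box_def by blast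
          then show ?thesis by (auto simp: h_def supp_def dyadic_def split: if_splits)
        qed
        then show "k + h \<in> Box UNIV (dyadic r)" by (simp add: Box_def)
      next
        fix k :: "int ^ 'd" assume k: "k \<in> Box UNIV (dyadic r)"
        have "if j \<in> supp r then 1 \<le> (k - h) $ j \<and> (k - h) $ j \<le> dyadic r $ j else (k - h) $ j = 0" for j
        proof -
          have "1 \<le> k $ j \<and> k $ j \<le> dyadic r $ j" using k unfolding Box_def by simp
          then show ?thesis by (auto simp: h_def supp_def dyadic_def split: if_splits)
        qed
        then show "k - h \<in> Box (supp r) (dyadic r)" unfolding Box_def by blast
      qed auto
      then show "S (supp r) (dyadic r) X x = sh (- h) (S UNIV (dyadic r) X) x"
        by (simp add: S_def sh_def T_T)
    qed
    then have "nrm (V r X) = nrm (E (0 - (- h)) (S UNIV (dyadic r) X))"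
      unfolding V_def by (simp only: nrm_E_sh[OF S_L2[OF X]])
    also have "\<dots> \<le> a (dyadic r)"
      unfolding a_def by (rule nrm_E_mono[OF S_L2[OF X]]) (auto simp: less_eq_vec_def h_def)
    finally show ?thesis .
  qed
  show ?thesis unfolding summ_def
  proof (rule nonneg_bdd_above_summable_on)
    show nn: "0 \<le> wt r * nrm (V r X)" for r using wt_pos[of r] by simp
    show "bdd_above (sum (\<lambda>r. wt r * nrm (V r X)) ` {F. F \<subseteq> UNIV \<and> finite F})"
    proof (rule bdd_aboveI2)
      fix Fs :: "('d \<Rightarrow> nat) set" assume "Fs \<in> {F. F \<subseteq> UNIV \<and> finite F}"
      then have fin: "finite Fs" by simp
      define R where "R = (\<Sum>r\<in>Fs. \<Sum>j\<in>UNIV. r j)"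
      have "r j \<le> R" if "r \<in> Fs" for r j
      proof -
        have "r j \<le> (\<Sum>j\<in>UNIV. r j)" by (rule member_le_sum) auto
        also have "\<dots> \<le> R" unfolding R_def using that fin by (intro member_le_sum[of r Fs "\<lambda>r. \<Sum>j\<in>UNIV. r j"]) auto
        finally show ?thesis .
      qed
      then have "Fs \<subseteq> rset UNIV R" by (auto simp: rset_def)
      then have "(\<Sum>r\<in>Fs. wt r * nrm (V r X)) \<le> (\<Sum>r\<in>rset UNIV R. wt r * nrm (V r X))"
        using nn by (intro sum_mono2 finite_rset) auto
      also have "\<dots> \<le> (\<Sum>r\<in>rset UNIV R. wt r * a (dyadic r))"
        using wt_pos by (intro sum_mono mult_left_mono Va) (auto intro: less_imp_le)
      also have "\<dots> \<le> 2 ^ CARD('d) * 4 ^ CARD('d) * B"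
        by (rule dyadic_sum_le) (use zero sub B in \<open>auto simp: a_def\<close>)
      finally show "(\<Sum>r\<in>Fs. wt r * nrm (V r X)) \<le> 2 ^ CARD('d) * 4 ^ CARD('d) * B" .
    qed
  qed
qed

end

section \<open>Approximation by orthomartingale differences\<close>

context commuting_system begin

lemma summ_le:
  assumes f: "summ f" and le: "\<And>r. nrm (V r g) \<le> c * nrm (V r f)"
  shows "summ g" "MW g \<le> c * MW f"
proof -
  have s: "(\<lambda>r. c * (wt r * nrm (V r f))) summable_on UNIV"
    using f unfolding summ_def by (rule summable_on_cmult_right)
  have 1: "wt r * nrm (V r g) \<le> c * (wt r * nrm (V r f))" for r
    using mult_left_mono[OF le[of r] less_imp_le[OF wt_pos[of r]]] by (simp add: mult_ac)
  have 2: "0 \<le> wt r * nrm (V r g)" for r using wt_pos[of r] by simp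
  show "summ g" unfolding summ_def by (rule summable_on_comparison_test[OF s]) (use 1 2 in auto)
  then have "MW g \<le> (\<Sum>\<^sub>\<infinity>r. c * (wt r * nrm (V r f)))"
    unfolding MW_def summ_def by (intro infsum_mono s 1)
  also have "\<dots> = c * MW f" unfolding MW_def by (rule infsum_cmult_right')
  finally show "MW g \<le> c * MW f" .
qed

lemma MW_nonneg: "0 \<le> MW g"
  unfolding MW_def by (intro infsum_nonneg mult_nonneg_nonneg) (simp_all add: wt_pos less_imp_le)

lemma V_cong: "f \<doteq> g \<Longrightarrow> f \<in> L2 \<Longrightarrow> g \<in> L2 \<Longrightarrow> nrm (V r f) = nrm (V r g)"
  unfolding V_def by (intro nrm_aeq E_cong S_aeq E_L2 S_L2)

lemma nrm_V_add: assumes "f \<in> L2" "g \<in> L2"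
  shows "nrm (V r (\<lambda>x. f x + g x)) \<le> nrm (V r f) + nrm (V r g)"
proof -
  have "nrm (V r (\<lambda>x. f x + g x)) = nrm (\<lambda>x. V r f x + V r g x)"
    unfolding V_def S_add by (intro nrm_aeq E_add S_L2 assms E_L2 L2_add)
  also have "\<dots> \<le> nrm (V r f) + nrm (V r g)" unfolding V_def by (intro nrm_add E_L2 S_L2 assms)
  finally show ?thesis .
qed

lemma nrm_V_cmult: assumes "g \<in> L2" shows "nrm (V r (\<lambda>x. c * g x)) = \<bar>c\<bar> * nrm (V r g)"
proof -
  have "nrm (V r (\<lambda>x. c * g x)) = nrm (\<lambda>x. c * V r g x)"
    unfolding V_def S_cmult by (intro nrm_aeq E_cmult S_L2 assms E_L2 L2_cmult)
  then show ?thesis by (simp add: nrm_cmult)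
qed

lemma nrm_V_sum: assumes "finite I" "\<And>i. i \<in> I \<Longrightarrow> f i \<in> L2"
  shows "nrm (V r (\<lambda>x. \<Sum>i\<in>I. f i x)) \<le> (\<Sum>i\<in>I. nrm (V r (f i)))"
  using assms
proof (induction I)
  case empty
  have "nrm (V r (\<lambda>x. 0 * 0)) = \<bar>0\<bar> * nrm (V r (\<lambda>x. 0))" by (rule nrm_V_cmult[OF L2_const])
  then show ?case by simp
next
  case (insert i I)
  then show ?case using nrm_V_add[of "f i" "\<lambda>x. \<Sum>i\<in>I. f i x" r] L2_sum[of I f] by fastforce
qed

lemma summ_add: assumes "f \<in> L2" "g \<in> L2" "summ f" "summ g" shows "summ (\<lambda>x. f x + g x)"
proof -
  have s: "(\<lambda>r. wt r * nrm (V r f) + wt r * nrm (V r g)) summable_on UNIV"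
    using assms(3,4) unfolding summ_def by (rule summable_on_add)
  have 1: "wt r * nrm (V r (\<lambda>x. f x + g x)) \<le> wt r * nrm (V r f) + wt r * nrm (V r g)" for r
    using mult_left_mono[OF nrm_V_add[OF assms(1,2), of r] less_imp_le[OF wt_pos[of r]]]
    by (simp add: distrib_left)
  have 2: "0 \<le> wt r * nrm (V r (\<lambda>x. f x + g x))" for r using wt_pos[of r] by simp
  show ?thesis unfolding summ_def by (rule summable_on_comparison_test[OF s]) (use 1 2 in auto)
qed

lemma summ_cmult: assumes "g \<in> L2" "summ g" shows "summ (\<lambda>x. c * g x)"
  by (rule summ_le(1)[OF assms(2), where c="\<bar>c\<bar>"]) (simp add: nrm_V_cmult assms(1))

lemma summ_diff: assumes "f \<in> L2" "g \<in> L2" "summ f" "summ g" shows "summ (\<lambda>x. f x - g x)"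
  using summ_add[OF assms(1) L2_cmult[OF assms(2)] assms(3) summ_cmult[OF assms(2,4)], of "-1"] by simp

lemma summ_sum: assumes "finite I" "\<And>i. i \<in> I \<Longrightarrow> f i \<in> L2" "\<And>i. i \<in> I \<Longrightarrow> summ (f i)" "summ (\<lambda>x. 0)"
  shows "summ (\<lambda>x. \<Sum>i\<in>I. f i x)"
  using assms by (induction I) (auto intro!: summ_add L2_sum)

lemma H_diff: "f \<in> H \<Longrightarrow> g \<in> H \<Longrightarrow> (\<lambda>x. f x - g x) \<in> H"
  and H_cmult: "g \<in> H \<Longrightarrow> (\<lambda>x. c * g x) \<in> H"
  unfolding H_def by (auto intro: L2_diff L2_cmult borel_measurable_diff)

lemma H_sum: assumes "\<And>i. i \<in> I \<Longrightarrow> f i \<in> H" shows "(\<lambda>x. \<Sum>i\<in>I. f i x) \<in> H"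
  using assms unfolding H_def by (auto intro!: L2_sum borel_measurable_sum)

text \<open>
  For a given box only finitely many scales enter \<open>box_sum_bound\<close>.
\<close>

lemma box_MW:
  assumes g: "g \<in> H" "summ g" and n: "\<And>j. 1 \<le> n $ j"
  shows "nrm (S J n g) \<le> 4 ^ card J * sqrt (vol_on J n) * MW g"
proof -
  define R where "R = nat (\<Sum>j\<in>UNIV. n $ j)"
  have R: "n $ j \<le> 2 ^ R" for j
  proof -
    have "n $ j \<le> (\<Sum>j\<in>UNIV. n $ j)" by (rule member_le_sum) (use n in \<open>auto intro: order_trans[OF zero_le_one]\<close>)
    also have "\<dots> \<le> int R" by (simp add: R_def)
    also have "\<dots> \<le> 2 ^ R"
    proof -
      have "R \<le> 2 ^ R" using less_exp[of R] by simp
      then show ?thesis by (metis of_nat_le_iff of_nat_numeral of_nat_power)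
    qed
    finally show ?thesis .
  qed
  have "(\<Sum>r\<in>rset J R. wt r * nrm (V r g)) \<le> MW g"
    unfolding MW_def using g(2) wt_pos[THEN less_imp_le]
    by (intro finite_sum_le_infsum finite_rset) (auto simp: summ_def intro!: mult_nonneg_nonneg)
  then have "4 ^ card J * sqrt (vol_on J n) * (\<Sum>r\<in>rset J R. wt r * nrm (V r g)) \<le> 4 ^ card J * sqrt (vol_on J n) * MW g"
    using vol_on_pos[of J n] n by (intro mult_left_mono) (auto intro: less_imp_le)
  with box_sum_bound[OF n R g(1), of J] show ?thesis by linarith
qed

text \<open>
  Used for the remainder of the martingale approximation: finitely many scales carry almost all of the
  seminorm of \<open>f\<close>, and on these the convergence is termwise.
\<close>

lemma MW_dominated:
  assumes f: "summ f" and le: "\<And>s r. nrm (V r (g s)) \<le> nrm (V r f)"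
    and lim: "\<And>r. (\<lambda>s::nat. nrm (V r (g s))) \<longlonglongrightarrow> 0" and d: "0 < \<delta>"
  shows "\<exists>s. MW (g s) \<le> \<delta>"
proof -
  let ?f = "\<lambda>r. wt r * nrm (V r f)" and ?g = "\<lambda>s r. wt r * nrm (V r (g s))"
  have fs: "?f summable_on UNIV" using f by (simp add: summ_def)
  obtain A where A: "finite A" "dist (sum ?f A) (infsum ?f UNIV) \<le> \<delta> / 2"
    using infsum_finite_approximation[OF fs, of "\<delta> / 2"] d by auto
  have "(\<lambda>s. \<Sum>r\<in>A. ?g s r) \<longlonglongrightarrow> (\<Sum>r\<in>A. wt r * 0)"
    by (intro tendsto_sum tendsto_mult tendsto_const lim)
  then have "\<forall>\<^sub>F s in sequentially. (\<Sum>r\<in>A. ?g s r) < \<delta> / 2"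
    using order_tendstoD(2)[of "\<lambda>s. \<Sum>r\<in>A. ?g s r" 0 sequentially "\<delta> / 2"] d by simp
  then obtain s where s: "(\<Sum>r\<in>A. ?g s r) < \<delta> / 2" by (auto simp: eventually_sequentially)
  have wt0: "0 \<le> wt r" for r using wt_pos[of r] by simp
  have "MW (g s) \<le> \<delta>" unfolding MW_def
  proof (rule infsum_le_finite_sums)
    show "?g s summable_on UNIV"
      using summ_le(1)[OF f, of "g s" 1] le by (simp add: summ_def)
    fix B :: "('d \<Rightarrow> nat) set" assume B: "finite B"
    have "sum (?g s) B \<le> sum (?g s) (A \<union> (B - A))"
      using A(1) B wt0 by (intro sum_mono2) (auto intro!: mult_nonneg_nonneg)
    also have "\<dots> = sum (?g s) A + sum (?g s) (B - A)"
      using A(1) B by (intro sum.union_disjoint) auto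
    also have "sum (?g s) (B - A) \<le> sum ?f (B - A)"
      by (intro sum_mono mult_left_mono le wt0)
    also have "sum ?f (B - A) = sum ?f (A \<union> (B - A)) - sum ?f A"
      using A(1) B by (subst sum.union_disjoint) auto
    also have "sum ?f (A \<union> (B - A)) \<le> infsum ?f UNIV"
      using A(1) B fs wt0 by (intro finite_sum_le_infsum) (auto intro!: mult_nonneg_nonneg)
    finally have "sum (?g s) B \<le> sum (?g s) A + (infsum ?f UNIV - sum ?f A)" by simp
    moreover have "infsum ?f UNIV - sum ?f A \<le> \<delta> / 2"
      using A(2) unfolding dist_real_def by (rule order_trans[OF _ , rotated]) (simp add: abs_minus_commute[of "sum ?f A"])
    ultimately show "sum (?g s) B \<le> \<delta>" using s by linarith
  qed
  then show ?thesis ..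
qed

text \<open>
  The operators from which martingale approximations are built, the one-step prediction and the projection
  on the past in one direction, do not increase the dyadic seminorm.
\<close>

lemma nrm_V_E0_sh: assumes g: "g \<in> L2" and h: "0 \<le> h"
  shows "nrm (V r (E 0 (sh h g))) \<le> nrm (V r g)"
proof -
  have "nrm (V r (E 0 (sh h g))) = nrm (E 0 (S (supp r) (dyadic r) (sh h g)))"
    unfolding V_def by (rule nrm_aeq[OF E0_S_E0]) (intro E_L2 S_L2 sh_L2 g)+
  also have "\<dots> = nrm (E (0 - h) (S (supp r) (dyadic r) g))"
    unfolding S_sh by (rule nrm_E_sh[OF S_L2[OF g]])
  also have "\<dots> \<le> nrm (V r g)"
    unfolding V_def by (rule nrm_E_mono[OF S_L2[OF g]]) (use h in \<open>simp add: less_eq_vec_def\<close>)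
  finally show ?thesis .
qed

text \<open>
  By commutation \<open>E\<^sub>0 E\<^bsub>k - e\<^esub>\<close> is \<open>E\<^sub>0\<close> when \<open>k\<^sub>i \<ge> 1\<close> and \<open>E\<^bsub>- e\<^esub>\<close> when \<open>k\<^sub>i = 0\<close>.  All sites of one box fall
  under the same case, so one projection can be pulled out of the sum.
\<close>

lemma nrm_V_past: assumes g: "g \<in> H" shows "nrm (V r (E (- axis i 1) g)) \<le> nrm (V r g)"
proof -
  define \<kappa> :: "int ^ 'd" where "\<kappa> = (if r i = 0 then - axis i 1 else 0)"
  let ?e = "axis i 1 :: int ^ 'd" let ?S = "S (supp r) (dyadic r)"
  have gL: "g \<in> L2" using g by (rule H_L2)
  have "E 0 (?S (E (- ?e) g)) \<doteq> (\<lambda>x. \<Sum>k\<in>Box (supp r) (dyadic r). E 0 (sh k (E (- ?e) g)) x)"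
    unfolding S_def by (intro E_sum sh_L2 E_L2 gL)
  also have "\<dots> \<doteq> (\<lambda>x. \<Sum>k\<in>Box (supp r) (dyadic r). E \<kappa> (sh k g) x)"
  proof (rule aeq_sum)
    fix k assume "k \<in> Box (supp r) (dyadic r)"
    then have k: "if r j \<noteq> 0 then 1 \<le> k $ j \<and> k $ j \<le> dyadic r $ j else k $ j = 0" for j
      by (simp add: Box_def supp_def split: if_splits)
    have "E 0 (sh k (E (- ?e) g)) \<doteq> E 0 (E (k - ?e) (sh k g))"
      using E_sh[OF gL, of "- ?e" k] by (intro E_cong sh_L2 E_L2 gL) (simp add: aeq_sym)
    also have "\<dots> \<doteq> E (vmin (k - ?e) 0) (sh k g)" by (rule E_E[OF sh_L2[OF gL]])
    also have "vmin (k - ?e) 0 = \<kappa>"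
    proof (unfold vec_eq_iff, intro allI)
      fix j show "vmin (k - ?e) 0 $ j = \<kappa> $ j"
        using k[of j] by (auto simp: \<kappa>_def axis_nth' split: if_splits)
    qed
    finally show "E 0 (sh k (E (- ?e) g)) \<doteq> E \<kappa> (sh k g)" .
  qed
  also have "\<dots> \<doteq> E \<kappa> (?S g)" unfolding S_def by (intro aeq_sym[OF E_sum] sh_L2 gL)
  finally have "nrm (V r (E (- ?e) g)) = nrm (E \<kappa> (?S g))"
    unfolding V_def by (rule nrm_aeq) (intro E_L2 S_L2 gL)+
  also have "\<dots> \<le> nrm (V r g)" unfolding V_def
    by (rule nrm_E_mono[OF S_L2[OF gL]]) (auto simp: \<kappa>_def less_eq_vec_def axis_nth')
  finally show ?thesis .
qed

lemma E_past_H: assumes "g \<in> L2" shows "E (- axis i 1) g \<in> H"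
proof -
  have "- axis i 1 \<le> (0 :: int ^ 'd)" by (auto simp: less_eq_vec_def axis_nth')
  then show ?thesis using F_meas_mono[OF _ E_meas] E_L2[OF assms] by (simp add: H_def)
qed

text \<open>
  For \<open>I = UNIV\<close> the translates of an adapted \<open>g\<close> are orthomartingale differences.
\<close>

definition mds :: "'d set \<Rightarrow> ('a \<Rightarrow> real) \<Rightarrow> bool" where
  "mds I g \<longleftrightarrow> (\<forall>i\<in>I. E (- axis i 1) g \<doteq> (\<lambda>x. 0))"

definition asymp_le :: "('a \<Rightarrow> real) \<Rightarrow> real \<Rightarrow> bool" where
  "asymp_le g \<epsilon> \<longleftrightarrow> (\<exists>L\<ge>1. \<forall>n. (\<forall>j. L \<le> n $ j) \<longrightarrow> nrm (S UNIV n g) \<le> \<epsilon> * sqrt (vol n))"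

text \<open>
  Summation by parts; for \<open>N = m\<close> the middle term disappears.
\<close>

lemma abel_identity:
  fixes q :: "nat \<Rightarrow> real" assumes "m \<noteq> 0"
  shows "(\<Sum>k<N. (1 - real k / m) * (q k - q (Suc k))) = q 0 - (1 - real N / m) * q N - (1 / m) * (\<Sum>k<N. q (Suc k))"
proof (induction N)
  case (Suc N)
  have alg: "a0 - (1 - a) * x - b * s + (1 - a) * (x - y) = a0 - (1 - a - b) * y - b * (s + y)" for a0 a x b s y :: real
    by algebra
  have "1 - real (Suc N) / m = 1 - real N / m - 1 / m" by (simp add: add_divide_distrib)
  then show ?case by (simp only: sum.lessThan_Suc Suc.IH alg)
qed simp

lemma E_zero: "E k (\<lambda>x. 0) \<doteq> (\<lambda>x. 0)" by (rule E_id) (auto intro: L2_const)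

text \<open>
  One direction of the martingale approximation.  With the Cesaro-averaged potential \<open>G\<close> one has
  \<open>X = (G - Q G) + R\<close>, where \<open>Q\<close> is the one-step prediction; \<open>G - Q G\<close> differs from the martingale
  difference \<open>G - E(G | past)\<close> by a coboundary, whose box sums collapse to the two end slices.
\<close>

lemma martingale_step:
  assumes X: "X \<in> H" "summ X" "mds I X" and i: "i \<notin> I" and \<epsilon>: "0 < \<epsilon>"
  shows "\<exists>D. D \<in> H \<and> summ D \<and> mds (insert i I) D \<and> asymp_le (\<lambda>x. X x - D x) \<epsilon>"
proof -
  have XL: "X \<in> L2" using X(1) by (rule H_L2)
  define e where "e = (\<lambda>k::int. axis i k :: int ^ 'd)"
  define q where "q k = E 0 (sh (e (int k)) X)" for k
  have e0: "0 \<le> e k" if "0 \<le> k" for k using that by (auto simp: e_def less_eq_vec_def axis_nth')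
  have qH: "q k \<in> H" for k unfolding q_def by (intro E0_H sh_L2 XL)
  have qL: "q k \<in> L2" for k using qH by (rule H_L2)
  have Vq: "nrm (V r (q k)) \<le> nrm (V r X)" for r k unfolding q_def by (intro nrm_V_E0_sh XL e0) simp
  have qS: "summ (q k)" for k by (rule summ_le(1)[OF X(2), where c=1]) (simp add: Vq)
  have zS: "summ (\<lambda>x. 0)" using summ_cmult[OF XL X(2), of 0] by simp
  have q0: "q 0 \<doteq> X" unfolding q_def e_def using E_id[OF H_F[OF X(1)] XL] by simp
  have Eq: "E 0 (sh (e 1) (q k)) \<doteq> q (Suc k)" for k
  proof -
    have "E 0 (sh (e 1) (q k)) \<doteq> E 0 (E (e 1) (sh (e 1) (sh (e (int k)) X)))"
      unfolding q_def using E_sh[of "sh (e (int k)) X" 0 "e 1"] XL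
      by (intro E_cong sh_L2 E_L2) (auto intro: aeq_sym sh_L2)
    also have "\<dots> \<doteq> E 0 (sh (e 1) (sh (e (int k)) X))" by (intro E_tower sh_L2 XL e0) simp
    also have "sh (e 1) (sh (e (int k)) X) = sh (e (int (Suc k))) X" by (simp add: sh_sh e_def axis_add)
    finally show ?thesis by (simp add: q_def)
  qed
  \<comment> \<open>averages over \<open>2\<^sup>s\<close> steps, so that their norms are among the terms of the dyadic seminorm of \<open>X\<close>\<close>
  define Rm where "Rm s = (\<lambda>x. (1 / 2 ^ s) * (\<Sum>k<2 ^ s. q (Suc k) x))" for s
  have RL: "Rm s \<in> H" for s unfolding Rm_def by (intro H_cmult H_sum qH)
  have VR: "nrm (V r (Rm s)) \<le> nrm (V r X)" for r s
  proof -
    have "nrm (V r (Rm s)) = (1 / 2 ^ s) * nrm (V r (\<lambda>x. \<Sum>k<2 ^ s. q (Suc k) x))"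
      unfolding Rm_def by (subst nrm_V_cmult) (auto intro: L2_sum qL)
    also have "\<dots> \<le> (1 / 2 ^ s) * (\<Sum>k<2 ^ s. nrm (V r (q (Suc k))))"
      by (intro mult_left_mono nrm_V_sum qL) auto
    also have "\<dots> \<le> (1 / 2 ^ s) * (\<Sum>k<(2::nat) ^ s. nrm (V r X))"
      by (intro mult_left_mono sum_mono Vq) auto
    finally show ?thesis by simp
  qed
  have nR: "nrm (Rm s) \<le> MW X / sqrt (2 ^ s)" for s
  proof -
    let ?r = "single i (Suc s)"
    have "supp ?r = {i}" by (auto simp: supp_def single_def)
    then have Veq: "V ?r X = E 0 (\<lambda>x. \<Sum>c\<in>{1..2 ^ s}. sh (e c) X x)"
      by (simp add: V_def S_single dyadic_def single_def e_def)
    have "V ?r X \<doteq> (\<lambda>x. \<Sum>c\<in>{1..2 ^ s}. E 0 (sh (e c) X) x)"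
      unfolding Veq by (intro E_sum sh_L2 XL)
    also have "(\<lambda>x. \<Sum>c\<in>{1..2 ^ s}. E 0 (sh (e c) X) x) = (\<lambda>x. \<Sum>k<2 ^ s. q (Suc k) x)"
    proof
      fix x
      show "(\<Sum>c\<in>{1..2 ^ s}. E 0 (sh (e c) X) x) = (\<Sum>k<2 ^ s. q (Suc k) x)"
      proof (rule sum.reindex_bij_witness[of _ "\<lambda>k. int (Suc k)" "\<lambda>c. nat (c - 1)"])
        fix k :: nat assume "k \<in> {..<2 ^ s}"
        then have "Suc k \<le> 2 ^ s" by simp
        then have "int (Suc k) \<le> int (2 ^ s)" by (simp only: of_nat_le_iff)
        then show "int (Suc k) \<in> {1..2 ^ s}" by simp
      qed (auto simp: q_def nat_less_iff)
    qed
    finally have "V ?r X \<doteq> (\<lambda>x. \<Sum>k<2 ^ s. q (Suc k) x)" .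
    then have "nrm (V ?r X) = nrm (\<lambda>x. \<Sum>k<2 ^ s. q (Suc k) x)"
      by (rule nrm_aeq) (auto intro: V_H[THEN H_L2] XL L2_sum qL)
    then have 1: "nrm (Rm s) = (1 / 2 ^ s) * nrm (V ?r X)" unfolding Rm_def nrm_cmult by simp
    have "sum (\<lambda>r. wt r * nrm (V r X)) {?r} \<le> MW X"
      unfolding MW_def using X(2) wt_pos[THEN less_imp_le] by (intro finite_sum_le_infsum) (auto simp: summ_def intro!: mult_nonneg_nonneg)
    then have "nrm (V ?r X) \<le> MW X * sqrt (2 ^ s)" by (simp add: wt_single divide_le_eq)
    then have "nrm (Rm s) \<le> (1 / 2 ^ s) * (MW X * sqrt (2 ^ s))" unfolding 1 by (intro mult_left_mono) auto
    also have "\<dots> = MW X / sqrt (2 ^ s)"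
    proof -
      have "(2::real) ^ s = sqrt (2 ^ s) * sqrt (2 ^ s)" by simp
      then show ?thesis by (simp add: field_simps)
    qed
    finally show ?thesis .
  qed
  have lim: "(\<lambda>s. nrm (V r (Rm s))) \<longlonglongrightarrow> 0" for r
  proof (rule tendsto_sandwich[OF always_eventually always_eventually tendsto_const])
    let ?c = "real (card (Box (supp r) (dyadic r :: int ^ 'd)))"
    show "\<forall>s. 0 \<le> nrm (V r (Rm s))" by simp
    show "\<forall>s. nrm (V r (Rm s)) \<le> ?c * (MW X / sqrt (2 ^ s))"
    proof
      fix s
      have "nrm (V r (Rm s)) \<le> nrm (S (supp r) (dyadic r) (Rm s))"
        unfolding V_def by (intro E_nrm S_L2 H_L2 RL)
      also have "\<dots> \<le> ?c * nrm (Rm s)" by (intro S_nrm_le H_L2 RL)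
      also have "\<dots> \<le> ?c * (MW X / sqrt (2 ^ s))" by (intro mult_left_mono nR) auto
      finally show "nrm (V r (Rm s)) \<le> ?c * (MW X / sqrt (2 ^ s))" .
    qed
    have "(\<lambda>s. (?c * MW X) * (1 / sqrt 2) ^ s) \<longlonglongrightarrow> (?c * MW X) * 0"
      by (intro tendsto_mult tendsto_const LIMSEQ_power_zero) simp
    then show "(\<lambda>s. ?c * (MW X / sqrt (2 ^ s))) \<longlonglongrightarrow> 0"
      by (simp add: real_sqrt_power power_one_over divide_inverse mult.assoc power_inverse)
  qed
  obtain s where s: "MW (Rm s) \<le> \<epsilon> / (2 * 4 ^ CARD('d))"
    using MW_dominated[OF X(2) VR lim, of "\<epsilon> / (2 * 4 ^ CARD('d))"] \<epsilon> by auto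
  define m where "m = real (2 ^ s)"
  have m0: "m \<noteq> 0" by (simp add: m_def)
  define G where "G = (\<lambda>x. \<Sum>k<2 ^ s. (1 - real k / m) * q k x)"
  define Z where "Z = E 0 (sh (e 1) G)"
  define D where "D = (\<lambda>x. G x - E (- e 1) G x)"
  have GH: "G \<in> H" unfolding G_def by (intro H_sum H_cmult qH)
  have GL: "G \<in> L2" using GH by (rule H_L2)
  have GS: "summ G" unfolding G_def by (intro summ_sum L2_cmult qL summ_cmult qS zS) auto
  have ZH: "Z \<in> H" unfolding Z_def by (intro E0_H sh_L2 GL)
  have ZS: "summ Z"
    by (rule summ_le(1)[OF GS, where c=1]) (simp add: Z_def nrm_V_E0_sh[OF GL e0])
  have PH: "E (- e 1) G \<in> H" unfolding e_def by (rule E_past_H[OF GL])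
  have PS: "summ (E (- e 1) G)"
    by (rule summ_le(1)[OF GS, where c=1]) (simp add: e_def nrm_V_past[OF GH])
  have DH: "D \<in> H" unfolding D_def by (intro H_diff GH PH)
  have DS: "summ D" unfolding D_def by (intro summ_diff GL H_L2[OF PH] GS PS)
  have Zq: "Z \<doteq> (\<lambda>x. \<Sum>k<2 ^ s. (1 - real k / m) * q (Suc k) x)"
  proof -
    have "sh (e 1) G = (\<lambda>x. \<Sum>k<2 ^ s. (1 - real k / m) * sh (e 1) (q k) x)"
      unfolding G_def sh_def ..
    then have "Z \<doteq> (\<lambda>x. \<Sum>k<2 ^ s. E 0 (\<lambda>x. (1 - real k / m) * sh (e 1) (q k) x) x)"
      unfolding Z_def by (simp only:) (intro E_sum L2_cmult sh_L2 qL)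
    also have "\<dots> \<doteq> (\<lambda>x. \<Sum>k<2 ^ s. (1 - real k / m) * q (Suc k) x)"
      by (intro aeq_sum aeq_trans[OF E_cmult aeq_cmult] sh_L2 qL Eq)
    finally show ?thesis .
  qed
  have dec: "X \<doteq> (\<lambda>x. (G x - Z x) + Rm s x)"
  proof -
    have "(\<lambda>x. G x - (\<Sum>k<2 ^ s. (1 - real k / m) * q (Suc k) x) + Rm s x) = q 0"
    proof
      fix x
      have "G x - (\<Sum>k<2 ^ s. (1 - real k / m) * q (Suc k) x) = (\<Sum>k<2 ^ s. (1 - real k / m) * (q k x - q (Suc k) x))"
        by (simp add: G_def sum_subtractf[symmetric] right_diff_distrib)
      also have "\<dots> = q 0 x - (1 - real (2 ^ s) / m) * q (2 ^ s) x - (1 / m) * (\<Sum>k<2 ^ s. q (Suc k) x)"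
        by (rule abel_identity[where N="2 ^ s" and q="\<lambda>k. q k x", OF m0])
      finally show "G x - (\<Sum>k<2 ^ s. (1 - real k / m) * q (Suc k) x) + Rm s x = q 0 x"
        by (simp add: m_def Rm_def)
    qed
    moreover have "(\<lambda>x. G x - Z x + Rm s x) \<doteq> (\<lambda>x. G x - (\<Sum>k<2 ^ s. (1 - real k / m) * q (Suc k) x) + Rm s x)"
      by (intro aeq_add aeq_diff Zq aeq_refl)
    ultimately show ?thesis using q0 by (metis aeq_sym aeq_trans)
  qed
  have cob: "E (- e 1) G \<doteq> sh (- e 1) Z"
    using E_sh'[of "sh (e 1) G" "- e 1" "- e 1"] GL by (simp add: Z_def sh_sh sh_L2)
  have XD: "(\<lambda>x. X x - D x) \<doteq> (\<lambda>x. Rm s x + (sh (- e 1) Z x - Z x))"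
    using dec cob unfolding aeq_def D_def by eventually_elim simp
  have md: "mds (insert i I) D" unfolding mds_def
  proof
    fix j assume "j \<in> insert i I"
    have "E (- e 1) D \<doteq> (\<lambda>x. 0)"
    proof -
      have "E (- e 1) D \<doteq> (\<lambda>x. E (- e 1) G x - E (- e 1) (E (- e 1) G) x)"
        unfolding D_def by (intro E_diff GL E_L2)
      also have "\<dots> \<doteq> (\<lambda>x. E (- e 1) G x - E (- e 1) G x)"
        by (intro aeq_diff aeq_refl E_tower GL) simp
      finally show ?thesis by simp
    qed
    moreover have "E (- axis j 1) D \<doteq> (\<lambda>x. 0)" if j: "j \<in> I"
    proof -
      let ?f = "- axis j 1 :: int ^ 'd"
      have jX: "E ?f X \<doteq> (\<lambda>x. 0)" using X(3) j by (simp add: mds_def)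
      have Ej: "E ?f (q k) \<doteq> (\<lambda>x. 0)" for k
      proof -
        have le: "?f \<le> e (int k) + ?f" "?f \<le> 0" by (auto simp: e_def less_eq_vec_def axis_nth')
        have "E ?f (q k) \<doteq> E ?f (sh (e (int k)) X)" unfolding q_def by (intro E_tower sh_L2 XL le)
        also have "\<dots> \<doteq> E ?f (E (e (int k) + ?f) (sh (e (int k)) X))" by (intro aeq_sym[OF E_tower] sh_L2 XL le)
        also have "\<dots> \<doteq> E ?f (sh (e (int k)) (E ?f X))"
          using E_sh[OF XL, of ?f "e (int k)"] by (intro E_cong E_L2 sh_L2 XL) (simp add: add.commute)
        also have "\<dots> \<doteq> E ?f (sh (e (int k)) (\<lambda>x. 0))" by (intro E_cong sh_aeq jX sh_L2 E_L2 XL L2_const)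
        also have "sh (e (int k)) (\<lambda>x. 0) = (\<lambda>x. 0)" by (simp add: sh_def)
        also have "E ?f (\<lambda>x. 0) \<doteq> (\<lambda>x. 0)" by (rule E_zero)
        finally show ?thesis .
      qed
      have EG: "E ?f G \<doteq> (\<lambda>x. 0)"
      proof -
        have "E ?f G \<doteq> (\<lambda>x. \<Sum>k<2 ^ s. E ?f (\<lambda>x. (1 - real k / m) * q k x) x)"
          unfolding G_def by (intro E_sum L2_cmult qL)
        also have "\<dots> \<doteq> (\<lambda>x. \<Sum>k<(2::nat) ^ s. (1 - real k / m) * 0)"
          by (intro aeq_sum aeq_trans[OF E_cmult aeq_cmult] qL Ej)
        finally show ?thesis by simp
      qed
      have "E ?f D \<doteq> (\<lambda>x. E ?f G x - E ?f (E (- e 1) G) x)" unfolding D_def by (intro E_diff GL E_L2)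
      also have "\<dots> \<doteq> (\<lambda>x. 0 - 0)"
      proof (intro aeq_diff EG)
        have "E ?f (E (- e 1) G) \<doteq> E (- e 1) (E ?f G)" by (rule E_commute[OF GL])
        also have "\<dots> \<doteq> E (- e 1) (\<lambda>x. 0)" by (intro E_cong EG E_L2 GL L2_const)
        also have "\<dots> \<doteq> (\<lambda>x. 0)" by (rule E_zero)
        finally show "E ?f (E (- e 1) G) \<doteq> (\<lambda>x. 0)" .
      qed
      finally show ?thesis by simp
    qed
    ultimately show "E (- axis j 1) D \<doteq> (\<lambda>x. 0)" using \<open>j \<in> insert i I\<close> by (auto simp: e_def)
  qed
  have "asymp_le (\<lambda>x. X x - D x) \<epsilon>" unfolding asymp_le_def
  proof -
    define C where "C = 2 * 4 ^ CARD('d) * MW Z"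
    define L where "L = max 1 \<lceil>(2 * C / \<epsilon>)\<^sup>2\<rceil>"
    show "\<exists>L\<ge>1. \<forall>n. (\<forall>j. L \<le> n $ j) \<longrightarrow> nrm (S UNIV n (\<lambda>x. X x - D x)) \<le> \<epsilon> * sqrt (vol n)"
    proof (rule exI[of _ L], intro conjI allI impI)
      show "1 \<le> L" by (simp add: L_def)
      fix n :: "int ^ 'd" assume n: "\<forall>j. L \<le> n $ j"
      have n1: "1 \<le> n $ j" for j using n[rule_format, of j] by (simp add: L_def)
      have vp: "0 < vol_on K n" for K by (rule vol_on_pos[OF n1])
      have 1: "nrm (S UNIV n (Rm s)) \<le> \<epsilon> / 2 * sqrt (vol n)"
      proof -
        have RS: "summ (Rm s)" by (rule summ_le(1)[OF X(2), where c=1]) (simp add: VR)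
        have "nrm (S UNIV n (Rm s)) \<le> 4 ^ CARD('d) * sqrt (vol n) * MW (Rm s)"
          using box_MW[OF RL RS n1, of UNIV] by (simp add: vol_UNIV)
        also have "\<dots> \<le> 4 ^ CARD('d) * sqrt (vol n) * (\<epsilon> / (2 * 4 ^ CARD('d)))"
          using vp[of UNIV] by (intro mult_left_mono s) (auto simp: vol_UNIV)
        also have "\<dots> = \<epsilon> / 2 * sqrt (vol n)" by simp
        finally show ?thesis .
      qed
      define Y where "Y = S (UNIV - {i}) n Z"
      have YL: "Y \<in> L2" unfolding Y_def by (intro S_L2 H_L2 ZH)
      have 2: "nrm (S UNIV n (\<lambda>x. sh (- e 1) Z x - Z x)) \<le> 2 * nrm Y"
      proof -
        have Sf: "S UNIV n f = (\<lambda>x. \<Sum>c\<in>{1..n $ i}. sh (e c) (S (UNIV - {i}) n f) x)" for f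
          using S_insert[of i "UNIV - {i}" n f] by (simp add: insert_UNIV e_def)
        have "S UNIV n (\<lambda>x. sh (- e 1) Z x - Z x) = (\<lambda>x. \<Sum>c\<in>{1..n $ i}. sh (e c) (\<lambda>x. sh (- e 1) Y x - Y x) x)"
          by (subst Sf) (simp only: S_diff S_sh Y_def)
        also have "\<dots> = (\<lambda>x. Y x - sh (e (n $ i)) Y x)"
        proof
          fix x
          have "(\<Sum>c\<in>{1..int N}. sh (e c) (\<lambda>x. sh (- e 1) Y x - Y x) x) = Y x - sh (e (int N)) Y x" for N
          proof (induction N)
            case (Suc N)
            have *: "{1..int (Suc N)} = insert (int (Suc N)) {1..int N}" by auto
            show ?case unfolding *
              by (subst sum.insert) (auto simp: Suc, simp add: sh_def T_T e_def axis_add axis_uminus)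
          qed (simp add: e_def)
          from this[of "nat (n $ i)"] show "(\<Sum>c\<in>{1..n $ i}. sh (e c) (\<lambda>x. sh (- e 1) Y x - Y x) x) = Y x - sh (e (n $ i)) Y x"
            using n1[of i] by simp
        qed
        finally have "S UNIV n (\<lambda>x. sh (- e 1) Z x - Z x) = (\<lambda>x. Y x - sh (e (n $ i)) Y x)" .
        then show ?thesis using nrm_diff[OF YL sh_L2[OF YL], of "e (n $ i)"] nrm_sh[OF YL] by simp
      qed
      have 3: "2 * nrm Y \<le> \<epsilon> / 2 * sqrt (vol n)"
      proof -
        have "nrm Y \<le> 4 ^ card (UNIV - {i}) * sqrt (vol_on (UNIV - {i}) n) * MW Z"
          unfolding Y_def by (rule box_MW[OF ZH ZS n1])
        also have "\<dots> \<le> 4 ^ CARD('d) * sqrt (vol_on (UNIV - {i}) n) * MW Z"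
        proof (intro mult_right_mono)
          show "(4::real) ^ card (UNIV - {i}) \<le> 4 ^ CARD('d)" by (intro power_increasing card_mono) auto
          show "0 \<le> MW Z" by (rule MW_nonneg)
        qed (use vp[of "UNIV - {i}"] in auto)
        finally have a: "2 * nrm Y \<le> C * sqrt (vol_on (UNIV - {i}) n)" by (simp add: C_def mult_ac)
        have "vol n = n $ i * vol_on (UNIV - {i}) n"
          using vol_on_insert[of i "UNIV - {i}" n] by (simp add: insert_UNIV vol_UNIV)
        then have b: "sqrt (vol n) = sqrt (n $ i) * sqrt (vol_on (UNIV - {i}) n)" by (simp add: real_sqrt_mult)
        have "(2 * C / \<epsilon>)\<^sup>2 \<le> n $ i" using n[rule_format, of i] unfolding L_def by linarith
        then have "2 * C / \<epsilon> \<le> sqrt (n $ i)" by (rule real_le_rsqrt)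
        then have "C \<le> \<epsilon> / 2 * sqrt (n $ i)" using \<epsilon> by (simp add: field_simps)
        then have "C * sqrt (vol_on (UNIV - {i}) n) \<le> \<epsilon> / 2 * sqrt (n $ i) * sqrt (vol_on (UNIV - {i}) n)"
          using vp[of "UNIV - {i}"] by (intro mult_right_mono) auto
        then show ?thesis using a unfolding b by (simp add: mult.assoc)
      qed
      have "nrm (S UNIV n (\<lambda>x. X x - D x)) = nrm (S UNIV n (\<lambda>x. Rm s x + (sh (- e 1) Z x - Z x)))"
        by (rule nrm_aeq[OF S_aeq[OF XD]]) (intro S_L2 L2_add L2_diff sh_L2 XL H_L2 DH RL ZH)+
      also have "\<dots> \<le> nrm (S UNIV n (Rm s)) + nrm (S UNIV n (\<lambda>x. sh (- e 1) Z x - Z x))"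
        unfolding S_add by (intro nrm_add S_L2 L2_diff sh_L2 H_L2 RL ZH)
      finally show "nrm (S UNIV n (\<lambda>x. X x - D x)) \<le> \<epsilon> * sqrt (vol n)"
        using 1 2 3 by (simp add: field_simps)
    qed
  qed
  with DH DS md show ?thesis by blast
qed

lemma asymp_le_add:
  assumes "asymp_le f \<delta>" "asymp_le g \<epsilon>" "f \<in> L2" "g \<in> L2"
  shows "asymp_le (\<lambda>x. f x + g x) (\<delta> + \<epsilon>)"
proof -
  from assms(1,2) obtain L K where L: "1 \<le> L" "\<And>n. (\<forall>j. L \<le> n $ j) \<Longrightarrow> nrm (S UNIV n f) \<le> \<delta> * sqrt (vol n)"
    and K: "1 \<le> K" "\<And>n. (\<forall>j. K \<le> n $ j) \<Longrightarrow> nrm (S UNIV n g) \<le> \<epsilon> * sqrt (vol n)"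
    unfolding asymp_le_def by blast
  show ?thesis unfolding asymp_le_def
  proof (rule exI[of _ "max L K"], intro conjI allI impI)
    fix n :: "int ^ 'd" assume n: "\<forall>j. max L K \<le> n $ j"
    have "nrm (S UNIV n (\<lambda>x. f x + g x)) \<le> nrm (S UNIV n f) + nrm (S UNIV n g)"
      unfolding S_add by (intro nrm_add S_L2 assms)
    also have "\<dots> \<le> \<delta> * sqrt (vol n) + \<epsilon> * sqrt (vol n)" using n by (intro add_mono L K) auto
    finally show "nrm (S UNIV n (\<lambda>x. f x + g x)) \<le> (\<delta> + \<epsilon>) * sqrt (vol n)" by (simp add: distrib_right)
  qed (use L in auto)
qed

text \<open>
  One direction after the other; the differences already achieved survive the later steps.
\<close>

lemma martingale_approximation_H:
  assumes X: "X \<in> H" "summ X" and \<epsilon>: "0 < \<epsilon>"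
  shows "\<exists>D. D \<in> H \<and> summ D \<and> mds I D \<and> asymp_le (\<lambda>x. X x - D x) \<epsilon>"
proof -
  have "finite I" by simp
  then show ?thesis using \<epsilon>
  proof (induction I arbitrary: \<epsilon> rule: finite_induct)
    case empty
    have "S UNIV n (\<lambda>x. X x - X x) = (\<lambda>x. 0)" for n by (simp add: S_def sh_def)
    moreover have "0 \<le> \<epsilon> * sqrt (vol n)" if "\<forall>j. 1 \<le> n $ j" for n :: "int ^ 'd"
      using empty vol_on_pos[of UNIV n] that by (simp add: vol_UNIV)
    ultimately have "asymp_le (\<lambda>x. X x - X x) \<epsilon>"
      unfolding asymp_le_def by (intro exI[of _ 1]) (auto simp: nrm_def)
    then show ?case using X by (auto simp: mds_def)
  next
    case (insert i I)
    obtain D where D: "D \<in> H" "summ D" "mds I D" "asymp_le (\<lambda>x. X x - D x) (\<epsilon> / 2)"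
      using insert.IH[of "\<epsilon> / 2"] insert.prems by auto
    obtain D' where D': "D' \<in> H" "summ D'" "mds (insert i I) D'" "asymp_le (\<lambda>x. D x - D' x) (\<epsilon> / 2)"
      using martingale_step[OF D(1-3) insert.hyps(2), of "\<epsilon> / 2"] insert.prems by auto
    have "asymp_le (\<lambda>x. (X x - D x) + (D x - D' x)) (\<epsilon> / 2 + \<epsilon> / 2)"
      by (intro asymp_le_add D D' L2_diff H_L2 X)
    then show ?case using D' by (intro exI[of _ D']) simp
  qed
qed

text \<open>
  Projecting the translate \<open>l\<close> of \<open>h\<close> on \<open>F \<kappa>\<close> amounts to projecting it on the past of \<open>l \<and> \<kappa>\<close>, which is
  contained in that of \<open>l - e\<^sub>i\<close>.
\<close>

lemma mds_orthogonal:
  assumes h: "h \<in> H" "mds {i} h" and Z: "Z \<in> L2" "Z \<in> borel_measurable (F \<kappa>)" and l: "\<kappa> $ i < l $ i"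
  shows "(\<integral>x. Z x * sh l h x \<partial>M) = 0"
proof -
  have hL: "h \<in> L2" using h(1) by (rule H_L2)
  let ?v = "vmin l \<kappa>" and ?e = "axis i 1 :: int ^ 'd"
  have "E \<kappa> (sh l h) \<doteq> E \<kappa> (E l (sh l h))"
    using sh_F[OF H_F[OF h(1)], of l] by (intro aeq_sym[OF E_cong[OF E_id]] E_L2 sh_L2 hL) simp
  also have "\<dots> \<doteq> E ?v (sh l h)" by (rule E_E[OF sh_L2[OF hL]])
  also have "\<dots> \<doteq> E ?v (E (l - ?e) (sh l h))"
    by (intro aeq_sym[OF E_tower] sh_L2 hL) (use l in \<open>auto simp: less_eq_vec_def axis_nth'\<close>)
  also have "\<dots> \<doteq> E ?v (sh l (E (- ?e) h))"
    using E_sh[OF hL, of "- ?e" l] by (intro E_cong E_L2 sh_L2 hL) simp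
  also have "\<dots> \<doteq> E ?v (sh l (\<lambda>x. 0))"
    using h(2) by (intro E_cong sh_aeq sh_L2 E_L2 hL L2_const) (simp add: mds_def)
  also have "sh l (\<lambda>x. 0) = (\<lambda>x. 0)" by (simp add: sh_def)
  also have "E ?v (\<lambda>x. 0) \<doteq> (\<lambda>x. 0)" by (rule E_zero)
  finally have 0: "E \<kappa> (sh l h) \<doteq> (\<lambda>x. 0)" .
  have "(\<integral>x. Z x * sh l h x \<partial>M) = (\<integral>x. Z x * E \<kappa> (sh l h) x \<partial>M)"
    by (intro E_int Z sh_L2 hL)
  also have "\<dots> = (\<integral>x. 0 \<partial>M)"
    using 0 Z hL by (intro integral_cong_AE) (auto simp: aeq_def dest: L2_meas)
  finally show ?thesis by simp
qed

text \<open>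
  Two different sites differ in some direction, and there \<open>mds_orthogonal\<close> applies.
\<close>

lemma mds_nrm_S:
  assumes h: "h \<in> H" "mds UNIV h" and n: "\<And>j. 0 \<le> n $ j"
  shows "nrm (S UNIV n h) = sqrt (vol n) * nrm h"
proof -
  have hL: "h \<in> L2" using h(1) by (rule H_L2)
  have ort: "(\<integral>x. sh k h x * sh l h x \<partial>M) = (if k = l then (nrm h)\<^sup>2 else 0)" for k l
  proof (cases "k = l")
    case True
    then show ?thesis using nrm_sh[OF hL, of l] nrm_sq[of "sh l h"] by (simp add: power2_eq_square)
  next
    case False
    have *: "(\<integral>x. sh k h x * sh l h x \<partial>M) = 0" if "k $ i < l $ i" for k l i
    proof (rule mds_orthogonal[OF h(1) _ sh_L2[OF hL] _ that])
      show "mds {i} h" using h(2) by (simp add: mds_def)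
      show "sh k h \<in> borel_measurable (F k)" using sh_F[OF H_F[OF h(1)], of k] by simp
    qed
    from False obtain i where "k $ i \<noteq> l $ i" by (auto simp: vec_eq_iff)
    then consider "k $ i < l $ i" | "l $ i < k $ i" by linarith
    then show ?thesis using *[of k i l] *[of l i k] False by cases (auto simp: mult.commute)
  qed
  have "(nrm (S UNIV n h))\<^sup>2 = (\<integral>x. (\<Sum>k\<in>Box UNIV n. \<Sum>l\<in>Box UNIV n. sh k h x * sh l h x) \<partial>M)"
    unfolding nrm_sq S_def by (simp add: power2_eq_square sum_product)
  also have "\<dots> = (\<Sum>k\<in>Box UNIV n. \<Sum>l\<in>Box UNIV n. (\<integral>x. sh k h x * sh l h x \<partial>M))"
    by (subst Bochner_Integration.integral_sum) (auto intro!: Bochner_Integration.integrable_sum L2_mult sh_L2 hL sum.cong Bochner_Integration.integral_sum)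
  also have "\<dots> = card (Box UNIV n) * (nrm h)\<^sup>2" by (simp add: ort)
  also have "\<dots> = (sqrt (vol n) * nrm h)\<^sup>2"
    using n card_Box[of UNIV n] by (simp add: power_mult_distrib vol_UNIV vol_on_def prod_nonneg)
  finally show ?thesis
    using n by (intro power2_eq_imp_eq[of "nrm (S UNIV n h)"]) (auto simp: vol_def prod_nonneg)
qed

lemma truncation_nrm:
  assumes D: "D \<in> L2" and \<epsilon>: "0 < \<epsilon>"
  shows "\<exists>K>0. nrm (\<lambda>x. D x - (if \<bar>D x\<bar> \<le> K then D x else 0)) \<le> \<epsilon>"
proof -
  have "(\<lambda>K::nat. \<integral>x. (D x - (if \<bar>D x\<bar> \<le> real K then D x else 0))\<^sup>2 \<partial>M) \<longlonglongrightarrow> (\<integral>x. 0 \<partial>M)"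
  proof (rule integral_dominated_convergence[where w="\<lambda>x. (D x)\<^sup>2"])
    show "AE x in M. (\<lambda>K::nat. (D x - (if \<bar>D x\<bar> \<le> real K then D x else 0))\<^sup>2) \<longlonglongrightarrow> 0"
    proof (rule AE_I2)
      fix x
      have "\<forall>\<^sub>F K in sequentially. \<bar>D x\<bar> \<le> real K"
        using eventually_ge_at_top[of "nat \<lceil>\<bar>D x\<bar>\<rceil>"] by eventually_elim linarith
      then have "\<forall>\<^sub>F K in sequentially. (D x - (if \<bar>D x\<bar> \<le> real K then D x else 0))\<^sup>2 = 0"
        by eventually_elim simp
      then show "(\<lambda>K::nat. (D x - (if \<bar>D x\<bar> \<le> real K then D x else 0))\<^sup>2) \<longlonglongrightarrow> 0"
        by (rule tendsto_eventually)
    qed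
  qed (use L2_meas[OF D] L2_sq[OF D] in auto)
  then have "\<forall>\<^sub>F K in sequentially. (\<integral>x. (D x - (if \<bar>D x\<bar> \<le> real K then D x else 0))\<^sup>2 \<partial>M) < \<epsilon>\<^sup>2"
    using \<epsilon> by (intro order_tendstoD(2)[where y=0]) auto
  then have "\<forall>\<^sub>F K in sequentially. 0 < K \<and> (\<integral>x. (D x - (if \<bar>D x\<bar> \<le> real K then D x else 0))\<^sup>2 \<partial>M) < \<epsilon>\<^sup>2"
    by (rule eventually_conj[OF eventually_gt_at_top])
  then obtain K :: nat where K: "0 < K" "(\<integral>x. (D x - (if \<bar>D x\<bar> \<le> real K then D x else 0))\<^sup>2 \<partial>M) < \<epsilon>\<^sup>2"
    by (auto simp: eventually_sequentially)
  have "nrm (\<lambda>x. D x - (if \<bar>D x\<bar> \<le> real K then D x else 0)) \<le> \<epsilon>"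
    by (rule power2_le_imp_le) (use K \<epsilon> in \<open>auto simp: nrm_sq\<close>)
  then show ?thesis using K by (intro exI[of _ "real K"]) auto
qed

text \<open>
  Truncating destroys the martingale property; subtracting the conditional expectations on the past
  in one direction after the other restores it, keeps the variable bounded and, since these operators
  are contractions fixing \<open>D\<close>, does not increase its distance from \<open>D\<close>.
\<close>

lemma bounded_mds:
  assumes D: "D \<in> H" "mds UNIV D" and \<epsilon>: "0 < \<epsilon>"
  shows "\<exists>D' K. D' \<in> H \<and> (\<forall>x. \<bar>D' x\<bar> \<le> K) \<and> mds I D' \<and> nrm (\<lambda>x. D x - D' x) \<le> \<epsilon>"
proof -
  have DL: "D \<in> L2" using D(1) by (rule H_L2)
  have "finite I" by simp
  then show ?thesis
  proof (induction rule: finite_induct)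
    case empty
    obtain K where K: "0 < K" "nrm (\<lambda>x. D x - (if \<bar>D x\<bar> \<le> K then D x else 0)) \<le> \<epsilon>"
      using truncation_nrm[OF DL \<epsilon>] by blast
    let ?D = "\<lambda>x. if \<bar>D x\<bar> \<le> K then D x else 0"
    have [measurable]: "D \<in> borel_measurable (F 0)" by (rule H_F[OF D(1)])
    have m: "?D \<in> borel_measurable (F 0)" by measurable
    have b: "\<bar>?D x\<bar> \<le> K" for x using K(1) by auto
    have "?D \<in> H" using m L2_bounded[OF F_meas[OF m] b] by (simp add: H_def)
    then show ?case using K b by (intro exI[of _ ?D] exI[of _ K]) (auto simp: mds_def)
  next
    case (insert i I)
    then obtain g K where g: "g \<in> H" "\<And>x. \<bar>g x\<bar> \<le> K" "mds I g" "nrm (\<lambda>x. D x - g x) \<le> \<epsilon>" by blast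
    let ?e = "- axis i 1 :: int ^ 'd"
    have gL: "g \<in> L2" using g(1) by (rule H_L2)
    have K0: "0 \<le> K" using g(2)[of undefined] by linarith
    define p where "p = (\<lambda>x. max (- K) (min K (E ?e g x)))"
    have pE: "p \<doteq> E ?e g"
    proof -
      have "AE x in M. E ?e g x \<le> K"
        using F.real_cond_exp_le_c[of g K ?e] L2_integrable[OF gL] g(2) by (auto simp: abs_le_iff)
      moreover have "AE x in M. - K \<le> E ?e g x"
        using F.real_cond_exp_ge_c[of g "- K" ?e] L2_integrable[OF gL] g(2) by (auto simp: abs_le_iff minus_le_iff)
      ultimately show ?thesis unfolding aeq_def by eventually_elim (simp add: p_def)
    qed
    have pm: "p \<in> borel_measurable (F ?e)" unfolding p_def using E_meas by measurable
    have pH: "p \<in> H"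
    proof -
      have "?e \<le> 0" by (auto simp: less_eq_vec_def axis_nth')
      then show ?thesis using F_meas_mono[OF _ pm] L2_bounded[OF F_meas[OF pm], of K] K0
        by (auto simp: H_def p_def)
    qed
    have pL: "p \<in> L2" using pH by (rule H_L2)
    let ?g = "\<lambda>x. g x - p x"
    have gH': "?g \<in> H" by (intro H_diff g pH)
    have b: "\<bar>?g x\<bar> \<le> 2 * K" for x using g(2)[of x] K0 by (auto simp: p_def abs_le_iff max_def min_def)
    have md: "mds (insert i I) ?g" unfolding mds_def
    proof
      fix j assume j: "j \<in> insert i I"
      let ?f = "- axis j 1 :: int ^ 'd"
      have "E ?f ?g \<doteq> (\<lambda>x. E ?f g x - E ?f p x)" by (intro E_diff gL pL)
      also have "\<dots> \<doteq> (\<lambda>x. E ?f g x - E ?f (E ?e g) x)" by (intro aeq_diff aeq_refl E_cong pE pL E_L2 gL)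
      also have "\<dots> \<doteq> (\<lambda>x. 0)"
      proof (cases "j = i")
        case True
        have "(\<lambda>x. E ?e g x - E ?e (E ?e g) x) \<doteq> (\<lambda>x. E ?e g x - E ?e g x)"
          by (intro aeq_diff aeq_refl E_tower gL) simp
        then show ?thesis using True by simp
      next
        case False
        then have jg: "E ?f g \<doteq> (\<lambda>x. 0)" using j g(3) by (simp add: mds_def)
        have "E ?f (E ?e g) \<doteq> E ?e (E ?f g)" by (rule E_commute[OF gL])
        also have "\<dots> \<doteq> E ?e (\<lambda>x. 0)" by (intro E_cong jg E_L2 gL L2_const)
        also have "\<dots> \<doteq> (\<lambda>x. 0)" by (rule E_zero)
        finally have "(\<lambda>x. E ?f g x - E ?f (E ?e g) x) \<doteq> (\<lambda>x. 0 - 0)" by (intro aeq_diff jg)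
        then show ?thesis by simp
      qed
      finally show "E ?f ?g \<doteq> (\<lambda>x. 0)" .
    qed
    have "nrm (\<lambda>x. D x - ?g x) \<le> nrm (\<lambda>x. D x - g x)"
    proof -
      let ?d = "\<lambda>x. D x - g x"
      have dL: "?d \<in> L2" by (intro L2_diff DL gL)
      have "E ?e ?d \<doteq> (\<lambda>x. E ?e D x - E ?e g x)" by (intro E_diff DL gL)
      also have "\<dots> \<doteq> (\<lambda>x. 0 - p x)" using D(2) by (intro aeq_diff aeq_sym[OF pE]) (simp add: mds_def)
      finally have Ed: "E ?e ?d \<doteq> (\<lambda>x. 0 - p x)" .
      have "nrm (\<lambda>x. D x - ?g x) = nrm (\<lambda>x. ?d x - E ?e ?d x)"
        using Ed by (intro nrm_aeq L2_diff DL gL pL E_L2) (auto simp: aeq_def)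
      also have "\<dots> \<le> nrm ?d"
      proof (rule power2_le_imp_le)
        have "(\<integral>x. E ?e ?d x * ?d x \<partial>M) = (nrm (E ?e ?d))\<^sup>2"
          unfolding nrm_sq E_int[OF E_meas E_L2[OF dL] dL] by (simp add: power2_eq_square)
        moreover have "(nrm (\<lambda>x. ?d x - E ?e ?d x))\<^sup>2 = (nrm ?d)\<^sup>2 - 2 * (\<integral>x. E ?e ?d x * ?d x \<partial>M) + (nrm (E ?e ?d))\<^sup>2"
        proof -
          have "(nrm (\<lambda>x. ?d x - E ?e ?d x))\<^sup>2 = (\<integral>x. (?d x)\<^sup>2 - 2 * (E ?e ?d x * ?d x) + (E ?e ?d x)\<^sup>2 \<partial>M)"
            unfolding nrm_sq by (intro Bochner_Integration.integral_cong refl) (simp add: power2_eq_square algebra_simps)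
          also have "\<dots> = (nrm ?d)\<^sup>2 - 2 * (\<integral>x. E ?e ?d x * ?d x \<partial>M) + (nrm (E ?e ?d))\<^sup>2"
            using L2_sq[OF dL] L2_sq[OF E_L2[OF dL]] L2_mult[OF E_L2[OF dL] dL] by (simp add: nrm_sq)
          finally show ?thesis .
        qed
        ultimately show "(nrm (\<lambda>x. ?d x - E ?e ?d x))\<^sup>2 \<le> (nrm ?d)\<^sup>2" by simp
      qed simp
      finally show ?thesis .
    qed
    then show ?case using gH' b md g(4) by (intro exI[of _ ?g] exI[of _ "2 * K"]) auto
  qed
qed

theorem bounded_orthomartingale_approximation:
  assumes X: "X \<in> H" "summ X" and \<epsilon>: "0 < \<epsilon>"
  shows "\<exists>D K. D \<in> H \<and> (\<forall>x. \<bar>D x\<bar> \<le> K) \<and> mds UNIV D \<and> asymp_le (\<lambda>x. X x - D x) \<epsilon>"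
proof -
  obtain D where D: "D \<in> H" "mds UNIV D" "asymp_le (\<lambda>x. X x - D x) (\<epsilon> / 2)"
    using martingale_approximation_H[OF X, of "\<epsilon> / 2" UNIV] \<epsilon> by auto
  obtain D' K where D': "D' \<in> H" "\<And>x. \<bar>D' x\<bar> \<le> K" "mds UNIV D'" "nrm (\<lambda>x. D x - D' x) \<le> \<epsilon> / 2"
    using bounded_mds[OF D(1,2), of "\<epsilon> / 2" UNIV] \<epsilon> by auto
  have "mds UNIV (\<lambda>x. D x - D' x)" unfolding mds_def
  proof
    fix i :: 'd
    let ?e = "- axis i 1 :: int ^ 'd"
    have "E ?e (\<lambda>x. D x - D' x) \<doteq> (\<lambda>x. E ?e D x - E ?e D' x)" by (intro E_diff H_L2 D D')
    also have "\<dots> \<doteq> (\<lambda>x. 0 - 0)" using D(2) D'(3) by (intro aeq_diff) (simp_all add: mds_def)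
    finally show "E ?e (\<lambda>x. D x - D' x) \<doteq> (\<lambda>x. 0)" by simp
  qed
  then have nS: "nrm (S UNIV n (\<lambda>x. D x - D' x)) = sqrt (vol n) * nrm (\<lambda>x. D x - D' x)" if "\<And>j. 0 \<le> n $ j" for n
    using mds_nrm_S[OF H_diff[OF D(1) D'(1)]] that by blast
  have "asymp_le (\<lambda>x. D x - D' x) (\<epsilon> / 2)" unfolding asymp_le_def
  proof (rule exI[of _ 1], intro conjI allI impI)
    fix n :: "int ^ 'd" assume n: "\<forall>j. 1 \<le> n $ j"
    then have n0: "0 \<le> n $ j" for j by (meson order_trans zero_le_one)
    have "0 \<le> vol n" by (simp add: vol_def prod_nonneg n0)
    then show "nrm (S UNIV n (\<lambda>x. D x - D' x)) \<le> \<epsilon> / 2 * sqrt (vol n)"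
      unfolding nS[OF n0] using mult_left_mono[OF D'(4), of "sqrt (vol n)"] by (simp add: mult.commute)
  qed simp
  then have "asymp_le (\<lambda>x. (X x - D x) + (D x - D' x)) (\<epsilon> / 2 + \<epsilon> / 2)"
    by (intro asymp_le_add D L2_diff H_L2 X D')
  then show ?thesis using D' by (intro exI[of _ D'] exI[of _ K]) simp
qed

end

section \<open>Bounded variables and a mean ergodic theorem\<close>

context prob_space begin

definition bdd :: "('a \<Rightarrow> real) \<Rightarrow> bool" where
  "bdd g \<longleftrightarrow> g \<in> borel_measurable M \<and> (\<exists>K. \<forall>x. \<bar>g x\<bar> \<le> K)"

lemma bdd_meas: "bdd g \<Longrightarrow> g \<in> borel_measurable M" by (simp add: bdd_def)

lemma bdd_I: "g \<in> borel_measurable M \<Longrightarrow> (\<And>x. \<bar>g x\<bar> \<le> K) \<Longrightarrow> bdd g" by (auto simp: bdd_def)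

lemma bdd_const: "bdd (\<lambda>x. c)" by (auto simp: bdd_def)

lemma bdd_L2: "bdd g \<Longrightarrow> g \<in> L2" unfolding bdd_def using L2_bounded by blast

lemma bdd_integrable: "bdd g \<Longrightarrow> integrable M g" by (intro L2_integrable bdd_L2)

lemma bdd_add: assumes "bdd f" "bdd g" shows "bdd (\<lambda>x. f x + g x)"
proof -
  from assms obtain K L where "\<And>x. \<bar>f x\<bar> \<le> K" "\<And>x. \<bar>g x\<bar> \<le> L" by (auto simp: bdd_def)
  then have "\<bar>f x + g x\<bar> \<le> K + L" for x using abs_triangle_ineq[of "f x" "g x"] by (meson add_mono order_trans)
  then show ?thesis using assms by (auto simp: bdd_def)
qed

lemma bdd_mult: assumes "bdd f" "bdd g" shows "bdd (\<lambda>x. f x * g x)"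
proof -
  from assms obtain K L where K: "\<And>x. \<bar>f x\<bar> \<le> K" and L: "\<And>x. \<bar>g x\<bar> \<le> L" by (auto simp: bdd_def)
  have "0 \<le> K" using K[of undefined] by linarith
  then have "\<bar>f x * g x\<bar> \<le> K * L" for x
    unfolding abs_mult by (intro mult_mono K L) auto
  then show ?thesis using assms by (auto simp: bdd_def)
qed

lemma bdd_cmult: "bdd g \<Longrightarrow> bdd (\<lambda>x. c * g x)" by (rule bdd_mult[OF bdd_const])

lemma bdd_divide: "bdd g \<Longrightarrow> bdd (\<lambda>x. g x / c)" using bdd_cmult[of g "1 / c"] by simp

lemma bdd_diff: "bdd f \<Longrightarrow> bdd g \<Longrightarrow> bdd (\<lambda>x. f x - g x)"
  using bdd_add[OF _ bdd_cmult[of g "-1"]] by simp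

lemma bdd_power: "bdd g \<Longrightarrow> bdd (\<lambda>x. g x ^ p)"
  by (induction p) (auto intro: bdd_const bdd_mult)

lemma bdd_sum: "(\<And>i. i \<in> I \<Longrightarrow> bdd (f i)) \<Longrightarrow> bdd (\<lambda>x. \<Sum>i\<in>I. f i x)"
  by (induction I rule: infinite_finite_induct) (auto intro: bdd_const bdd_add)

lemmas bdd_intros = bdd_const bdd_add bdd_mult bdd_cmult bdd_diff bdd_power bdd_sum bdd_divide

text \<open>
  The mean ergodic theorem for bounded functions.  The norms of the dyadic averages decrease to the
  infimum of the norms over the convex hull of the orbit, so that by the parallelogram identity these
  averages are Cauchy in mean square; the upper limit along a fast subsequence is strictly invariant.
\<close>

lemma mean_ergodic_bounded:
  fixes \<tau> :: "'a \<Rightarrow> 'a" and h :: "'a \<Rightarrow> real"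
  assumes sp: "space M = UNIV" and \<tau>: "\<tau> \<in> measurable M M" "distr M M \<tau> = M"
    and erg: "\<And>A. A \<in> sets M \<Longrightarrow> \<tau> -` A = A \<Longrightarrow> prob A = 0 \<or> prob A = 1"
    and h: "h \<in> borel_measurable M" "\<And>x. \<bar>h x\<bar> \<le> K"
  shows "(\<lambda>m. nrm (\<lambda>x. (\<Sum>c<m. h ((\<tau> ^^ c) x)) / real m - expectation h)) \<longlonglongrightarrow> 0"
proof -
  define A where "A m x = (\<Sum>c<m. h ((\<tau> ^^ c) x)) / real m" for m x
  have K0: "0 \<le> K" using h(2)[of undefined] by linarith
  have pm: "\<tau> ^^ c \<in> measurable M M" for c using \<tau>(1) by (induction c) (auto simp: id_def intro: measurable_comp)
  have pd: "distr M M (\<tau> ^^ c) = M" for c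
  proof (induction c)
    case (Suc c)
    have "distr M M (\<tau> \<circ> \<tau> ^^ c) = distr (distr M M (\<tau> ^^ c)) M \<tau>"
      using \<tau>(1) pm by (intro distr_distr[symmetric])
    also have "\<dots> = M" unfolding Suc by (rule \<tau>(2))
    finally show ?case by (simp only: funpow.simps(2))
  qed (simp add: id_def distr_id)
  have nrmc: "nrm (\<lambda>x. g ((\<tau> ^^ c) x)) = nrm g" if "g \<in> borel_measurable M" for g c
    unfolding nrm_def using integral_distr[of "\<tau> ^^ c" M M "\<lambda>x. (g x)\<^sup>2"] pm pd that by simp
  have sumK: "\<bar>\<Sum>c<m. h ((\<tau> ^^ c) x)\<bar> \<le> real m * K" for m x
  proof -
    have "\<bar>\<Sum>c<m. h ((\<tau> ^^ c) x)\<bar> \<le> (\<Sum>c<m. \<bar>h ((\<tau> ^^ c) x)\<bar>)" by (rule sum_abs)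
    also have "\<dots> \<le> (\<Sum>c<m. K)" using h(2) by (intro sum_mono) auto
    finally show ?thesis by simp
  qed
  have Abd: "\<bar>A m x\<bar> \<le> K" for m x
    using sumK[of x m] K0 by (cases "m = 0") (auto simp: A_def abs_divide divide_le_eq mult.commute)
  have hc: "(\<lambda>x. h ((\<tau> ^^ c) x)) \<in> borel_measurable M" for c using measurable_compose[OF pm h(1)] .
  have Am: "A m \<in> borel_measurable M" for m unfolding A_def using hc by measurable
  have Ab: "bdd (A m)" for m using Am Abd by (intro bdd_I)
  have AL: "A m \<in> L2" for m using Ab by (rule bdd_L2)
  have sh1: "\<bar>A m (\<tau> y) - A m y\<bar> \<le> 2 * K / m" for m y
  proof -
    have "(\<Sum>c<m. h ((\<tau> ^^ c) (\<tau> y))) - (\<Sum>c<m. h ((\<tau> ^^ c) y)) = h ((\<tau> ^^ m) y) - h y"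
    proof (induction m)
      case (Suc m)
      then show ?case by (simp add: funpow_swap1)
    qed simp
    then have "A m (\<tau> y) - A m y = (h ((\<tau> ^^ m) y) - h y) / m"
      by (simp add: A_def diff_divide_distrib[symmetric])
    moreover have "\<bar>h ((\<tau> ^^ m) y) - h y\<bar> \<le> 2 * K"
      using h(2)[of y] h(2)[of "(\<tau> ^^ m) y"] by linarith
    ultimately show ?thesis by (simp add: abs_divide divide_right_mono)
  qed
  have shc: "\<bar>A m ((\<tau> ^^ c) y) - A m y\<bar> \<le> real c * (2 * K / m)" for m c y
  proof (induction c)
    case (Suc c)
    have gen: "\<bar>p - q\<bar> \<le> u \<Longrightarrow> \<bar>q - r\<bar> \<le> real c * u \<Longrightarrow> \<bar>p - r\<bar> \<le> real (Suc c) * u" for p q r u :: real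
      by (simp add: distrib_right)
    show ?case unfolding funpow.simps comp_apply by (rule gen[OF sh1 Suc])
  qed simp
  \<comment> \<open>averaging \<open>A m\<close> over \<open>N\<close> further steps gives almost \<open>A N\<close>\<close>
  have avg: "\<bar>(\<Sum>j<N. A m ((\<tau> ^^ j) x)) / N - A N x\<bar> \<le> real m * (2 * K / N)" if m: "1 \<le> m" for m N x
  proof -
    have "(\<Sum>j<N. A m ((\<tau> ^^ j) x)) / N = (\<Sum>c<m. A N ((\<tau> ^^ c) x)) / m"
    proof -
      have "(\<Sum>j<N. \<Sum>c<m. h ((\<tau> ^^ c) ((\<tau> ^^ j) x))) = (\<Sum>c<m. \<Sum>j<N. h ((\<tau> ^^ j) ((\<tau> ^^ c) x)))"
        by (subst sum.swap) (simp add: funpow_add[symmetric, unfolded comp_def fun_eq_iff, rule_format] add.commute)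
      then show ?thesis by (simp add: A_def sum_divide_distrib[symmetric] mult.commute)
    qed
    then have "(\<Sum>j<N. A m ((\<tau> ^^ j) x)) / N - A N x = (\<Sum>c<m. A N ((\<tau> ^^ c) x) - A N x) / m"
      using m by (simp add: sum_subtractf diff_divide_distrib)
    also have "\<bar>\<dots>\<bar> \<le> (\<Sum>c<m. real m * (2 * K / N)) / m"
    proof -
      have "\<bar>\<Sum>c<m. A N ((\<tau> ^^ c) x) - A N x\<bar> \<le> (\<Sum>c<m. \<bar>A N ((\<tau> ^^ c) x) - A N x\<bar>)" by (rule sum_abs)
      also have "\<dots> \<le> (\<Sum>c<m. real m * (2 * K / N))"
      proof (rule sum_mono)
        fix c assume "c \<in> {..<m}"
        then have "real c * (2 * K / N) \<le> real m * (2 * K / N)" using K0 by (intro mult_right_mono) auto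
        then show "\<bar>A N ((\<tau> ^^ c) x) - A N x\<bar> \<le> real m * (2 * K / N)" using shc[of N c x] by linarith
      qed
      finally show ?thesis by (simp only: abs_divide abs_of_nat) (rule divide_right_mono, auto)
    qed
    finally show ?thesis using m by simp
  qed
  have nrm_avg: "nrm (\<lambda>x. (\<Sum>j<N. g ((\<tau> ^^ j) x)) / N) \<le> nrm g" if g: "bdd g" for N g
  proof (cases "N = 0")
    case False
    have gL: "(\<lambda>x. g ((\<tau> ^^ j) x)) \<in> L2" for j
    proof -
      from g obtain L where "\<And>x. \<bar>g x\<bar> \<le> L" by (auto simp: bdd_def)
      then show ?thesis using measurable_compose[OF pm bdd_meas[OF g]] by (intro L2_bounded) auto
    qed
    have "nrm (\<lambda>x. (1 / N) * (\<Sum>j<N. g ((\<tau> ^^ j) x))) = (1 / N) * nrm (\<lambda>x. \<Sum>j<N. g ((\<tau> ^^ j) x))"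
      by (simp only: nrm_cmult) simp
    also have "\<dots> \<le> (1 / N) * (\<Sum>j<N. nrm (\<lambda>x. g ((\<tau> ^^ j) x)))"
      by (intro mult_left_mono nrm_sum gL) auto
    also have "\<dots> = nrm g" using False by (simp add: nrmc[OF bdd_meas[OF g]])
    finally show ?thesis by simp
  qed (simp add: nrm_def)
  have nrm_le_const: "nrm g \<le> c" if "g \<in> borel_measurable M" "\<And>x. \<bar>g x\<bar> \<le> c" for g c
  proof -
    have c0: "0 \<le> c" using that(2)[of undefined] by linarith
    have gL: "g \<in> L2" using that by (rule L2_bounded)
    have "(\<integral>x. (g x)\<^sup>2 \<partial>M) \<le> (\<integral>x. c\<^sup>2 \<partial>M)"
      using L2_sq[OF gL] that(2) c0 by (intro integral_mono) (auto simp: abs_le_square_iff[symmetric])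
    then have "(nrm g)\<^sup>2 \<le> c\<^sup>2" by (simp add: nrm_sq prob_space)
    then show ?thesis using c0 by (rule power2_le_imp_le)
  qed
  define a where "a r = nrm (A (2 ^ r))" for r :: nat
  define \<alpha> where "\<alpha> = Inf (range a)"
  have bb: "bdd_below (range a)" by (rule bdd_belowI2[where m=0]) (simp add: a_def)
  have \<alpha>_le: "\<alpha> \<le> a r" for r unfolding \<alpha>_def by (rule cInf_lower[OF _ bb]) auto
  have \<alpha>0: "0 \<le> \<alpha>" unfolding \<alpha>_def by (rule cInf_greatest) (auto simp: a_def)
  have dec: "a (Suc r) \<le> a r" for r
  proof -
    let ?B = "\<lambda>x. A (2 ^ r) ((\<tau> ^^ (2 ^ r)) x)"
    have eq: "A (2 ^ Suc r) = (\<lambda>x. (1 / 2) * (A (2 ^ r) x + ?B x))"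
    proof
      fix x
      have "(\<Sum>c<2 ^ Suc r. h ((\<tau> ^^ c) x)) = (\<Sum>c<2 ^ r. h ((\<tau> ^^ c) x)) + (\<Sum>c<2 ^ r. h ((\<tau> ^^ (c + 2 ^ r)) x))"
        using sum.nat_group[of "\<lambda>c. h ((\<tau> ^^ c) x)" "2 ^ r" 2] 
        by (simp add: mult_2 sum.shift_bounds_nat_ivl[of _ 0 "2 ^ r" "2 ^ r", simplified] lessThan_atLeast0 sum.atLeastLessThan_concat[of 0 "2 ^ r" "2 ^ r + 2 ^ r", symmetric])
      then show "A (2 ^ Suc r) x = (1 / 2) * (A (2 ^ r) x + ?B x)"
        by (simp add: A_def funpow_add add_divide_distrib)
    qed
    have BL: "?B \<in> L2" using measurable_compose[OF pm Am] Abd by (intro L2_bounded) auto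
    have "a (Suc r) \<le> (1 / 2) * (a r + nrm ?B)"
      unfolding a_def eq nrm_cmult using nrm_add[OF AL BL] by simp
    then show ?thesis using nrmc[OF Am, of "2 ^ r" "2 ^ r"] by (simp add: a_def)
  qed
  have mono: "a s \<le> a r" if "r \<le> s" for r s using lift_Suc_antimono_le[of a r s] dec that by blast
  have low: "\<alpha> \<le> nrm (\<lambda>x. (1 / 2) * (A m x + A n x))" if mn: "1 \<le> m" "1 \<le> n" for m n
  proof -
    let ?B = "\<lambda>x. (1 / 2) * (A m x + A n x)"
    have B: "bdd ?B" by (intro bdd_intros Ab)
    have le: "\<alpha> \<le> nrm ?B + (real m + real n) * (2 * K) * (1 / 2) ^ R" for R :: nat
    proof -
      let ?N = "2 ^ R :: nat"
      let ?C = "\<lambda>x. (\<Sum>j<?N. ?B ((\<tau> ^^ j) x)) / real ?N"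
      have Cm: "?C \<in> borel_measurable M"
      proof -
        have "(\<lambda>x. ?B ((\<tau> ^^ j) x)) \<in> borel_measurable M" for j
          by (rule measurable_compose[OF pm bdd_meas[OF B]])
        then show ?thesis by measurable
      qed
      have d: "\<bar>A ?N x - ?C x\<bar> \<le> (real m + real n) * (2 * K / ?N)" for x
      proof -
        have "?C x = (1 / 2) * ((\<Sum>j<?N. A m ((\<tau> ^^ j) x)) / ?N) + (1 / 2) * ((\<Sum>j<?N. A n ((\<tau> ^^ j) x)) / ?N)"
          by (simp add: sum.distrib sum_divide_distrib[symmetric] add_divide_distrib)
        moreover have "0 \<le> real m * (2 * K / ?N)" "0 \<le> real n * (2 * K / ?N)" using K0 by auto
        ultimately show ?thesis using avg[OF mn(1), of x ?N] avg[OF mn(2), of x ?N]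
          unfolding distrib_right by linarith
      qed
      have CL: "?C \<in> L2"
        using bdd_diff[OF Ab[of ?N] bdd_I[OF borel_measurable_diff[OF Am Cm] d]] by (intro bdd_L2) simp
      have "\<alpha> \<le> nrm (\<lambda>x. ?C x + (A ?N x - ?C x))" using \<alpha>_le[of R] by (simp add: a_def)
      also have "\<dots> \<le> nrm ?C + nrm (\<lambda>x. A ?N x - ?C x)" by (intro nrm_add CL L2_diff AL)
      also have "\<dots> \<le> nrm ?B + (real m + real n) * (2 * K / ?N)"
        by (intro add_mono nrm_avg B nrm_le_const d borel_measurable_diff Am Cm)
      also have "(real m + real n) * (2 * K / ?N) = (real m + real n) * (2 * K) * (1 / 2) ^ R"
        by (simp add: power_divide)
      finally show ?thesis .
    qed
    have "(\<lambda>R. nrm ?B + (real m + real n) * (2 * K) * (1 / 2) ^ R) \<longlonglongrightarrow> nrm ?B + (real m + real n) * (2 * K) * 0"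
      by (intro tendsto_intros LIMSEQ_power_zero) simp
    then show ?thesis by (intro LIMSEQ_le_const) (use le in auto)
  qed
  have par: "(nrm (\<lambda>x. f x - g x))\<^sup>2 = 2 * (nrm f)\<^sup>2 + 2 * (nrm g)\<^sup>2 - 4 * (nrm (\<lambda>x. (1 / 2) * (f x + g x)))\<^sup>2"
    if "f \<in> L2" "g \<in> L2" for f g
  proof -
    have "(nrm (\<lambda>x. f x - g x))\<^sup>2 = (\<integral>x. (f x)\<^sup>2 + (g x)\<^sup>2 - 2 * (f x * g x) \<partial>M)"
      unfolding nrm_sq by (simp add: power2_diff algebra_simps)
    moreover have "4 * (nrm (\<lambda>x. (1 / 2) * (f x + g x)))\<^sup>2 = (\<integral>x. (f x)\<^sup>2 + (g x)\<^sup>2 + 2 * (f x * g x) \<partial>M)"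
      unfolding nrm_cmult power_mult_distrib by (simp add: nrm_sq power2_sum power_divide algebra_simps)
    ultimately show ?thesis using L2_sq[OF that(1)] L2_sq[OF that(2)] L2_mult[OF that]
      by (simp add: nrm_sq)
  qed
  have cau: "(nrm (\<lambda>x. A (2 ^ s) x - A (2 ^ r) x))\<^sup>2 \<le> 4 * ((a r)\<^sup>2 - \<alpha>\<^sup>2)" if "r \<le> s" for r s
  proof -
    have 1: "\<alpha>\<^sup>2 \<le> (nrm (\<lambda>x. (1 / 2) * (A (2 ^ s) x + A (2 ^ r) x)))\<^sup>2"
      using \<alpha>0 by (intro power_mono low) auto
    have 2: "(a s)\<^sup>2 \<le> (a r)\<^sup>2" using mono[OF that] by (intro power_mono) (auto simp: a_def)
    have gen: "n = 2 * p + 2 * q - 4 * u \<Longrightarrow> l \<le> u \<Longrightarrow> p \<le> q \<Longrightarrow> n \<le> 4 * (q - l)" for n p q u l :: real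
      by simp
    show ?thesis unfolding a_def by (rule gen[OF par[OF AL AL] 1 2[unfolded a_def]])
  qed
  have "\<exists>r. 4 * ((a r)\<^sup>2 - \<alpha>\<^sup>2) \<le> \<epsilon>" if \<epsilon>: "0 < \<epsilon>" for \<epsilon>
  proof -
    have "\<alpha> < sqrt (\<alpha>\<^sup>2 + \<epsilon> / 4)" by (rule real_less_rsqrt) (use \<epsilon> in simp)
    then obtain r where "a r < sqrt (\<alpha>\<^sup>2 + \<epsilon> / 4)"
      using cInf_lessD[of "range a"] unfolding \<alpha>_def by blast
    then have "(a r)\<^sup>2 < (sqrt (\<alpha>\<^sup>2 + \<epsilon> / 4))\<^sup>2" by (intro power_strict_mono) (auto simp: a_def)
    then have "(a r)\<^sup>2 < \<alpha>\<^sup>2 + \<epsilon> / 4" using \<epsilon> by simp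
    then show ?thesis by (intro exI[of _ r]) simp
  qed
  then have "\<forall>j::nat. \<exists>r. 4 * ((a r)\<^sup>2 - \<alpha>\<^sup>2) \<le> ((1 / 2) ^ j)\<^sup>2" by simp
  then obtain \<rho> where \<rho>: "\<And>j::nat. 4 * ((a (\<rho> j))\<^sup>2 - \<alpha>\<^sup>2) \<le> ((1 / 2) ^ j)\<^sup>2" by metis
  define R where "R j = j + (\<Sum>i\<le>j. \<rho> i)" for j :: nat
  have R\<rho>: "\<rho> j \<le> R j" for j unfolding R_def by (simp add: trans_le_add2 member_le_sum)
  have Rj: "j \<le> R j" for j by (simp add: R_def)
  have RS: "R j \<le> R (Suc j)" for j by (simp add: R_def)
  define f where "f j = A (2 ^ R j)" for j
  have step: "nrm (\<lambda>x. f (Suc j) x - f j x) \<le> (1 / 2) ^ j" for j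
  proof (rule power2_le_imp_le)
    have 1: "(a (R j))\<^sup>2 \<le> (a (\<rho> j))\<^sup>2" using mono[OF R\<rho>] by (intro power_mono) (auto simp: a_def)
    have gen: "n \<le> 4 * (p - l) \<Longrightarrow> p \<le> q \<Longrightarrow> 4 * (q - l) \<le> u \<Longrightarrow> n \<le> u" for n p q l u :: real
      unfolding right_diff_distrib by linarith
    show "(nrm (\<lambda>x. f (Suc j) x - f j x))\<^sup>2 \<le> ((1 / 2) ^ j)\<^sup>2"
      unfolding f_def by (rule gen[OF cau[OF RS] 1 \<rho>])
  qed simp
  have fm [measurable]: "f j \<in> borel_measurable M" for j unfolding f_def by (rule Am)
  have fb: "\<bar>f j x\<bar> \<le> K" for j x unfolding f_def by (rule Abd)
  have conv: "AE x in M. convergent (\<lambda>j. f j x)"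
  proof -
    have "(\<integral>\<^sup>+x. (\<Sum>j. ennreal \<bar>f (Suc j) x - f j x\<bar>) \<partial>M) = (\<Sum>j. \<integral>\<^sup>+x. ennreal \<bar>f (Suc j) x - f j x\<bar> \<partial>M)"
      by (rule nn_integral_suminf) measurable
    also have "\<dots> \<le> (\<Sum>j. ennreal ((1 / 2) ^ j))"
    proof (rule suminf_le)
      fix j
      have L: "(\<lambda>x. f (Suc j) x - f j x) \<in> L2" unfolding f_def by (intro L2_diff AL)
      have "(\<integral>\<^sup>+x. ennreal \<bar>f (Suc j) x - f j x\<bar> \<partial>M) = ennreal (\<integral>x. \<bar>f (Suc j) x - f j x\<bar> \<partial>M)"
        using L2_integrable[OF L] by (intro nn_integral_eq_integral) auto
      also have "\<dots> \<le> ennreal ((1 / 2) ^ j)"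
        using integral_abs_le_nrm[OF L] step[of j] by (intro ennreal_leI) linarith
      finally show "(\<integral>\<^sup>+x. ennreal \<bar>f (Suc j) x - f j x\<bar> \<partial>M) \<le> ennreal ((1 / 2) ^ j)" .
    qed auto
    also have "\<dots> = ennreal (\<Sum>j. (1 / 2) ^ j)" by (rule suminf_ennreal2) (auto intro: summable_geometric)
    also have "\<dots> < \<infinity>" by simp
    finally have "(\<integral>\<^sup>+x. (\<Sum>j. ennreal \<bar>f (Suc j) x - f j x\<bar>) \<partial>M) \<noteq> \<infinity>" by simp
    then have "AE x in M. (\<Sum>j. ennreal \<bar>f (Suc j) x - f j x\<bar>) \<noteq> \<infinity>"
      by (intro nn_integral_PInf_AE) measurable
    then show ?thesis
    proof eventually_elim
      fix x assume "(\<Sum>j. ennreal \<bar>f (Suc j) x - f j x\<bar>) \<noteq> \<infinity>"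
      then have "summable (\<lambda>j. \<bar>f (Suc j) x - f j x\<bar>)" by (intro summable_suminf_not_top) auto
      then have "summable (\<lambda>j. f (Suc j) x - f j x)" by (rule summable_rabs_cancel)
      then have "convergent (\<lambda>n. \<Sum>j<n. f (Suc j) x - f j x)" by (simp add: summable_iff_convergent)
      moreover have "(\<Sum>j<n. f (Suc j) x - f j x) = f n x - f 0 x" for n by (induction n) auto
      ultimately have "convergent (\<lambda>n. f n x - f 0 x)" by (simp only:)
      then show "convergent (\<lambda>j. f j x)" by (simp only: convergent_diff_const_right_iff)
    qed
  qed
  define g where "g x = real_of_ereal (limsup (\<lambda>j. ereal (f j x)))" for x
  have gm [measurable]: "g \<in> borel_measurable M" unfolding g_def by measurable
  have ginv: "g (\<tau> x) = g x" for x
  proof -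
    let ?d = "\<lambda>j. f j (\<tau> x) - f j x"
    have "?d \<longlonglongrightarrow> 0"
    proof (rule Lim_null_comparison)
      show "\<forall>\<^sub>F j in sequentially. norm (?d j) \<le> 2 * K * (1 / 2) ^ j"
      proof (rule always_eventually, rule allI)
        fix j
        have "norm (?d j) \<le> 2 * K / 2 ^ R j" using sh1[of "2 ^ R j" x] by (simp add: f_def)
        also have "\<dots> \<le> 2 * K / 2 ^ j" using Rj[of j] K0 by (intro divide_left_mono power_increasing) auto
        finally show "norm (?d j) \<le> 2 * K * (1 / 2) ^ j" by (simp add: power_divide)
      qed
      have "(\<lambda>j. 2 * K * (1 / 2) ^ j) \<longlonglongrightarrow> 2 * K * 0" by (intro tendsto_mult tendsto_const LIMSEQ_power_zero) simp
      then show "(\<lambda>j. 2 * K * (1 / 2) ^ j) \<longlonglongrightarrow> 0" by simp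
    qed
    then have "(\<lambda>j. ereal (?d j)) \<longlonglongrightarrow> ereal 0" by simp
    then have "limsup (\<lambda>j. ereal (?d j) + ereal (f j x)) = ereal 0 + limsup (\<lambda>j. ereal (f j x))"
      by (rule ereal_limsup_lim_add) simp
    then show ?thesis by (simp add: g_def)
  qed
  have glim: "AE x in M. (\<lambda>j. f j x) \<longlonglongrightarrow> g x"
    using conv
  proof eventually_elim
    fix x assume "convergent (\<lambda>j. f j x)"
    then obtain l where l: "(\<lambda>j. f j x) \<longlonglongrightarrow> l" by (auto simp: convergent_def)
    then have "(\<lambda>j. ereal (f j x)) \<longlonglongrightarrow> ereal l" by simp
    then have "limsup (\<lambda>j. ereal (f j x)) = ereal l" by (intro lim_imp_Limsup) auto
    then show "(\<lambda>j. f j x) \<longlonglongrightarrow> g x" using l by (simp add: g_def)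
  qed
  have gb: "AE x in M. \<bar>g x\<bar> \<le> K"
    using glim
  proof eventually_elim
    fix x assume "(\<lambda>j. f j x) \<longlonglongrightarrow> g x"
    then have "(\<lambda>j. \<bar>f j x\<bar>) \<longlonglongrightarrow> \<bar>g x\<bar>" by (rule tendsto_rabs)
    then show "\<bar>g x\<bar> \<le> K" by (rule LIMSEQ_le_const2) (use fb in auto)
  qed
  have gi: "integrable M g" by (rule integrable_const_bound[of _ K]) (use gb in auto)
  define \<gamma> where "\<gamma> = expectation g"
  \<comment> \<open>the set where \<open>u\<close> exceeds its mean is invariant and cannot have probability one\<close>
  have "AE x in M. u x \<le> expectation u" if u: "integrable M u" "\<And>x. u (\<tau> x) = u x" for u :: "'a \<Rightarrow> real"
  proof -
    have [measurable]: "u \<in> borel_measurable M" using u(1) by auto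
    let ?A = "{x. expectation u < u x}"
    have A: "?A \<in> sets M"
    proof -
      have "u -` {expectation u<..} \<inter> space M \<in> sets M"
      proof (rule measurable_sets)
        show "u \<in> borel_measurable M" using u(1) by auto
        show "{expectation u<..} \<in> sets borel" by (rule borel_open[OF open_greaterThan])
      qed
      moreover have "u -` {expectation u<..} \<inter> space M = ?A" by (auto simp: sp)
      ultimately show ?thesis by (simp only:)
    qed
    have "\<tau> -` ?A = ?A" by (auto simp: u(2))
    then have "prob ?A = 0 \<or> prob ?A = 1" by (rule erg[OF A])
    then show ?thesis
    proof
      assume "prob ?A = 0"
      then have "AE x in M. x \<notin> ?A" using A by (simp add: prob_eq_0)
      then show ?thesis by eventually_elim simp
    next
      assume "prob ?A = 1"
      then have ae: "AE x in M. x \<in> ?A" using A by (simp add: prob_eq_1)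
      have "expectation (\<lambda>x. expectation u) < expectation u"
        by (rule integral_less_AE_space) (use ae u(1) sp in \<open>auto simp: emeasure_space_1[unfolded sp]\<close>)
      then show ?thesis by (simp add: prob_space)
    qed
  qed
  from this[OF gi ginv] this[of "\<lambda>x. - g x"] gi ginv
  have "AE x in M. g x \<le> \<gamma>" "AE x in M. - g x \<le> - \<gamma>" by (auto simp: \<gamma>_def)
  then have g\<gamma>: "AE x in M. g x = \<gamma>" by eventually_elim simp
  have Eh: "\<gamma> = expectation h"
  proof -
    have "(\<lambda>j. expectation (f j)) \<longlonglongrightarrow> expectation g"
      by (rule integral_dominated_convergence[where w="\<lambda>_. K"]) (use glim fb in auto)
    moreover have "expectation (f j) = expectation h" for j
    proof -
      have ih: "integrable M (\<lambda>x. h ((\<tau> ^^ c) x))" for c by (rule bdd_integrable[OF bdd_I[OF hc]]) (rule h)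
      have "expectation (f j) = (\<Sum>c<2 ^ R j. expectation (\<lambda>x. h ((\<tau> ^^ c) x))) / 2 ^ R j"
        unfolding f_def A_def using ih by simp
      also have "\<dots> = expectation h"
        using integral_distr[OF pm, of h] h(1) pd by simp
      finally show ?thesis .
    qed
    ultimately show ?thesis unfolding \<gamma>_def by (simp add: LIMSEQ_const_iff)
  qed
  have L2lim: "(\<lambda>j. \<integral>x. (f j x - \<gamma>)\<^sup>2 \<partial>M) \<longlonglongrightarrow> (\<integral>x. 0 \<partial>M)"
  proof (rule integral_dominated_convergence[where w="\<lambda>_. (K + \<bar>\<gamma>\<bar>)\<^sup>2"])
    show "AE x in M. (\<lambda>j. (f j x - \<gamma>)\<^sup>2) \<longlonglongrightarrow> 0"
      using glim g\<gamma>
    proof eventually_elim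
      fix x assume "(\<lambda>j. f j x) \<longlonglongrightarrow> g x" "g x = \<gamma>"
      then have "(\<lambda>j. (f j x - \<gamma>)\<^sup>2) \<longlonglongrightarrow> (\<gamma> - \<gamma>)\<^sup>2" by (intro tendsto_intros) simp
      then show "(\<lambda>j. (f j x - \<gamma>)\<^sup>2) \<longlonglongrightarrow> 0" by simp
    qed
    show "AE x in M. norm ((f j x - \<gamma>)\<^sup>2) \<le> (K + \<bar>\<gamma>\<bar>)\<^sup>2" for j
    proof (rule AE_I2)
      fix x
      have "\<bar>f j x - \<gamma>\<bar> \<le> \<bar>K + \<bar>\<gamma>\<bar>\<bar>" using fb[of j x] K0 by linarith
      then show "norm ((f j x - \<gamma>)\<^sup>2) \<le> (K + \<bar>\<gamma>\<bar>)\<^sup>2" by (simp add: abs_le_square_iff)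
    qed
  qed auto
  show ?thesis unfolding Eh[symmetric] A_def[symmetric]
  proof (rule LIMSEQ_I)
    fix \<epsilon> :: real assume \<epsilon>: "0 < \<epsilon>"
    have "\<forall>\<^sub>F j in sequentially. (\<integral>x. (f j x - \<gamma>)\<^sup>2 \<partial>M) < (\<epsilon> / 2)\<^sup>2"
      using L2lim \<epsilon> by (intro order_tendstoD(2)[where y=0]) auto
    then obtain j where "(\<integral>x. (f j x - \<gamma>)\<^sup>2 \<partial>M) < (\<epsilon> / 2)\<^sup>2" by (auto simp: eventually_sequentially)
    then have j: "nrm (\<lambda>x. f j x - \<gamma>) < \<epsilon> / 2"
      by (intro power2_less_imp_less[of _ "\<epsilon> / 2"]) (use \<epsilon> in \<open>auto simp: nrm_sq\<close>)
    let ?m = "2 ^ R j :: nat"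
    define N where "N = nat \<lceil>8 * real ?m * K / \<epsilon>\<rceil> + 1"
    show "\<exists>no. \<forall>n\<ge>no. norm (nrm (\<lambda>x. A n x - \<gamma>) - 0) < \<epsilon>"
    proof (intro exI[of _ N] allI impI)
      fix n assume n: "N \<le> n"
      then have n0: "0 < n" by (simp add: N_def)
      let ?C = "\<lambda>x. (\<Sum>i<n. f j ((\<tau> ^^ i) x)) / n"
      have Cm: "?C \<in> borel_measurable M"
      proof -
        have "(\<lambda>x. f j ((\<tau> ^^ i) x)) \<in> borel_measurable M" for i by (rule measurable_compose[OF pm fm])
        then show ?thesis by measurable
      qed
      have d: "\<bar>?C x - A n x\<bar> \<le> real ?m * (2 * K / n)" for x unfolding f_def by (rule avg) simp
      have CL: "?C \<in> L2" using bdd_add[OF Ab[of n] bdd_I[OF borel_measurable_diff[OF Cm Am] d]] by (intro bdd_L2) simp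
      have "nrm (\<lambda>x. A n x - \<gamma>) = nrm (\<lambda>x. (?C x - \<gamma>) - (?C x - A n x))" by simp
      also have "\<dots> \<le> nrm (\<lambda>x. ?C x - \<gamma>) + nrm (\<lambda>x. ?C x - A n x)"
        by (intro nrm_diff L2_diff CL AL L2_const)
      also have "\<dots> \<le> nrm (\<lambda>x. f j x - \<gamma>) + real ?m * (2 * K / n)"
      proof (rule add_mono)
        have "(\<lambda>x. ?C x - \<gamma>) = (\<lambda>x. (\<Sum>i<n. (f j ((\<tau> ^^ i) x) - \<gamma>)) / n)"
          using n0 by (simp add: sum_subtractf diff_divide_distrib)
        then show "nrm (\<lambda>x. ?C x - \<gamma>) \<le> nrm (\<lambda>x. f j x - \<gamma>)"
          using nrm_avg[of "\<lambda>x. f j x - \<gamma>" n] bdd_diff[OF Ab bdd_const] by (simp add: f_def)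
        show "nrm (\<lambda>x. ?C x - A n x) \<le> real ?m * (2 * K / n)"
          by (intro nrm_le_const d borel_measurable_diff Cm Am)
      qed
      also have "real ?m * (2 * K / n) \<le> \<epsilon> / 4"
      proof -
        have "8 * real ?m * K / \<epsilon> \<le> real n" using n unfolding N_def by linarith
        then have "8 * real ?m * K \<le> real n * \<epsilon>" using \<epsilon> by (simp add: divide_le_eq)
        then show ?thesis using n0 by (simp add: divide_le_eq mult_ac)
      qed
      finally have "nrm (\<lambda>x. A n x - \<gamma>) < \<epsilon>" using j \<epsilon> by linarith
      then show "norm (nrm (\<lambda>x. A n x - \<gamma>) - 0) < \<epsilon>" by simp
    qed
  qed
qed

section \<open>Moments of martingale sums\<close>

text \<open>
  The mixed term with the cube of the partial sum vanishes, and the one with its square is controlled by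
  Cauchy-Schwarz; so the square root of the fourth moment grows at most linearly.
\<close>

lemma fourth_moment_martingale:
  assumes Y: "\<And>c. bdd (Y c)" and b: "\<And>c. c < N \<Longrightarrow> (\<integral>x. (Y c x) ^ 4 \<partial>M) \<le> b"
    and orth: "\<And>c. c < N \<Longrightarrow> (\<integral>x. (\<Sum>a<c. Y a x) ^ 3 * Y c x \<partial>M) = 0"
  shows "(\<integral>x. (\<Sum>c<N. Y c x) ^ 4 \<partial>M) \<le> 16 * (real N)\<^sup>2 * b"
  using b orth
proof (induction N)
  case (Suc N)
  define P where "P x = (\<Sum>c<N. Y c x)" for x
  have bP: "bdd P" unfolding P_def by (intro bdd_intros Y)
  have b0: "0 \<le> b" using order_trans[OF integral_nonneg_AE Suc.prems(1)[of N]] by simp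
  have IH: "(\<integral>x. (P x) ^ 4 \<partial>M) \<le> 16 * (real N)\<^sup>2 * b"
    unfolding P_def using Suc by simp
  have o: "(\<integral>x. (P x) ^ 3 * Y N x \<partial>M) = 0" unfolding P_def using Suc.prems(2)[of N] by simp
  have yb: "(\<integral>x. (Y N x) ^ 4 \<partial>M) \<le> b" using Suc.prems(1) by simp
  have alg: "(p + y) ^ 4 \<le> p ^ 4 + 4 * (p ^ 3 * y) + 8 * (p\<^sup>2 * y\<^sup>2) + 3 * y ^ 4" for p y :: real
  proof -
    have "(p + y) ^ 4 + 2 * y\<^sup>2 * (p - y)\<^sup>2 = p ^ 4 + 4 * (p ^ 3 * y) + 8 * (p\<^sup>2 * y\<^sup>2) + 3 * y ^ 4"
      by algebra
    moreover have "0 \<le> 2 * y\<^sup>2 * (p - y)\<^sup>2" by simp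
    ultimately show ?thesis by linarith
  qed
  have "(\<integral>x. (\<Sum>c<Suc N. Y c x) ^ 4 \<partial>M) \<le> (\<integral>x. (P x) ^ 4 + 4 * ((P x) ^ 3 * Y N x) + 8 * ((P x)\<^sup>2 * (Y N x)\<^sup>2) + 3 * (Y N x) ^ 4 \<partial>M)"
  proof (rule integral_mono)
    show "integrable M (\<lambda>x. (\<Sum>c<Suc N. Y c x) ^ 4)" by (intro bdd_integrable bdd_intros Y)
    show "integrable M (\<lambda>x. (P x) ^ 4 + 4 * ((P x) ^ 3 * Y N x) + 8 * ((P x)\<^sup>2 * (Y N x)\<^sup>2) + 3 * (Y N x) ^ 4)"
      by (intro bdd_integrable bdd_intros Y bP)
    show "(\<Sum>c<Suc N. Y c x) ^ 4 \<le> (P x) ^ 4 + 4 * ((P x) ^ 3 * Y N x) + 8 * ((P x)\<^sup>2 * (Y N x)\<^sup>2) + 3 * (Y N x) ^ 4" for x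
      using alg[of "P x" "Y N x"] by (simp add: P_def)
  qed
  also have "\<dots> = (\<integral>x. (P x) ^ 4 \<partial>M) + 4 * (\<integral>x. (P x) ^ 3 * Y N x \<partial>M) + 8 * (\<integral>x. (P x)\<^sup>2 * (Y N x)\<^sup>2 \<partial>M) + 3 * (\<integral>x. (Y N x) ^ 4 \<partial>M)"
    using bdd_integrable[OF bdd_power[OF bP, of 4]] bdd_integrable[OF bdd_mult[OF bdd_power[OF bP, of 3] Y[of N]]]
      bdd_integrable[OF bdd_mult[OF bdd_power[OF bP, of 2] bdd_power[OF Y[of N], of 2]]] bdd_integrable[OF bdd_power[OF Y[of N], of 4]]
    by simp
  also have "(\<integral>x. (P x)\<^sup>2 * (Y N x)\<^sup>2 \<partial>M) \<le> 4 * real N * b"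
  proof -
    have "(\<integral>x. (P x)\<^sup>2 * (Y N x)\<^sup>2 \<partial>M) \<le> nrm (\<lambda>x. (P x)\<^sup>2) * nrm (\<lambda>x. (Y N x)\<^sup>2)"
      by (intro L2_CS bdd_L2 bdd_intros bP Y)
    also have "\<dots> \<le> (4 * real N * sqrt b) * sqrt b"
    proof (rule mult_mono)
      have "nrm (\<lambda>x. (P x)\<^sup>2) \<le> sqrt (16 * (real N)\<^sup>2 * b)"
        unfolding nrm_def using IH by (simp add: power_mult[symmetric])
      also have "\<dots> = 4 * real N * sqrt b" by (simp add: real_sqrt_mult)
      finally show "nrm (\<lambda>x. (P x)\<^sup>2) \<le> 4 * real N * sqrt b" .
      show "nrm (\<lambda>x. (Y N x)\<^sup>2) \<le> sqrt b" unfolding nrm_def using yb by (simp add: power_mult[symmetric])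
    qed (use b0 in auto)
    finally show ?thesis using b0 by (simp add: mult.assoc)
  qed
  finally have "(\<integral>x. (\<Sum>c<Suc N. Y c x) ^ 4 \<partial>M) \<le> 16 * (real N)\<^sup>2 * b + 32 * real N * b + 3 * b"
    using IH o yb by linarith
  also have "\<dots> \<le> 16 * (real (Suc N))\<^sup>2 * b"
    using b0 by (simp add: power2_eq_square algebra_simps)
  finally show ?case .
qed simp

end

text \<open>
  Bessel's inequality with the operator norm of the Gram matrix of the \<open>z b\<close> replaced by its
  Hilbert-Schmidt norm: if these vectors are almost orthogonal, the latter is about the square root of
  their number instead of their number.
\<close>

lemma almost_orthogonal_bessel:
  fixes z :: "'b \<Rightarrow> 'c \<Rightarrow> real" and S :: "'c \<Rightarrow> real"
  assumes "finite B" "finite C"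
  shows "(\<Sum>b\<in>B. (\<Sum>c\<in>C. z b c * S c)\<^sup>2)
    \<le> (\<Sum>c\<in>C. (S c)\<^sup>2) * sqrt (\<Sum>b\<in>B. \<Sum>b'\<in>B. (\<Sum>c\<in>C. z b c * z b' c)\<^sup>2)"
proof -
  define \<alpha> where "\<alpha> b = (\<Sum>c\<in>C. z b c * S c)" for b
  define t where "t = (\<Sum>b\<in>B. (\<alpha> b)\<^sup>2)"
  define s where "s = (\<Sum>c\<in>C. (S c)\<^sup>2)"
  define G where "G b b' = (\<Sum>c\<in>C. z b c * z b' c)" for b b'
  define g where "g = sqrt (\<Sum>b\<in>B. \<Sum>b'\<in>B. (G b b')\<^sup>2)"
  have t0: "0 \<le> t" "0 \<le> s" "0 \<le> g" unfolding t_def s_def g_def by (auto intro!: sum_nonneg)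
  have "t = (\<Sum>c\<in>C. S c * (\<Sum>b\<in>B. \<alpha> b * z b c))"
  proof -
    have "t = (\<Sum>b\<in>B. \<Sum>c\<in>C. \<alpha> b * (z b c * S c))"
      unfolding t_def power2_eq_square by (subst (2) \<alpha>_def) (simp add: sum_distrib_left)
    also have "\<dots> = (\<Sum>c\<in>C. \<Sum>b\<in>B. \<alpha> b * (z b c * S c))" by (rule sum.swap)
    finally show ?thesis by (simp add: sum_distrib_left mult_ac)
  qed
  then have 1: "t\<^sup>2 \<le> s * (\<Sum>c\<in>C. (\<Sum>b\<in>B. \<alpha> b * z b c)\<^sup>2)"
    unfolding s_def by (simp only:) (rule Cauchy_Schwarz_ineq_sum)
  have "(\<Sum>c\<in>C. (\<Sum>b\<in>B. \<alpha> b * z b c)\<^sup>2) = (\<Sum>p\<in>B \<times> B. (\<alpha> (fst p) * \<alpha> (snd p)) * G (fst p) (snd p))"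
  proof -
    have "(\<Sum>c\<in>C. (\<Sum>b\<in>B. \<alpha> b * z b c)\<^sup>2) = (\<Sum>c\<in>C. \<Sum>b\<in>B. \<Sum>b'\<in>B. (\<alpha> b * \<alpha> b') * (z b c * z b' c))"
      by (simp add: power2_eq_square sum_product mult_ac)
    also have "\<dots> = (\<Sum>b\<in>B. \<Sum>c\<in>C. \<Sum>b'\<in>B. (\<alpha> b * \<alpha> b') * (z b c * z b' c))" by (rule sum.swap)
    also have "\<dots> = (\<Sum>b\<in>B. \<Sum>b'\<in>B. \<Sum>c\<in>C. (\<alpha> b * \<alpha> b') * (z b c * z b' c))"
      by (intro sum.cong refl sum.swap)
    also have "\<dots> = (\<Sum>b\<in>B. \<Sum>b'\<in>B. (\<alpha> b * \<alpha> b') * G b b')"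
      by (simp add: G_def sum_distrib_left)
    finally show ?thesis by (simp add: sum.cartesian_product case_prod_beta)
  qed
  also have "\<dots> \<le> t * g"
  proof (rule power2_le_imp_le)
    have "(\<Sum>p\<in>B \<times> B. (\<alpha> (fst p) * \<alpha> (snd p)) * G (fst p) (snd p))\<^sup>2
      \<le> (\<Sum>p\<in>B \<times> B. (\<alpha> (fst p) * \<alpha> (snd p))\<^sup>2) * (\<Sum>p\<in>B \<times> B. (G (fst p) (snd p))\<^sup>2)"
      by (rule Cauchy_Schwarz_ineq_sum)
    also have "(\<Sum>p\<in>B \<times> B. (\<alpha> (fst p) * \<alpha> (snd p))\<^sup>2) = t\<^sup>2"
      unfolding t_def power2_eq_square[of "sum _ _"] by (simp add: sum_product sum.cartesian_product case_prod_beta power_mult_distrib)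
    also have "(\<Sum>p\<in>B \<times> B. (G (fst p) (snd p))\<^sup>2) = g\<^sup>2"
      unfolding g_def by (simp add: sum_nonneg sum.cartesian_product case_prod_beta)
    finally show "(\<Sum>p\<in>B \<times> B. (\<alpha> (fst p) * \<alpha> (snd p)) * G (fst p) (snd p))\<^sup>2 \<le> (t * g)\<^sup>2"
      by (simp add: power_mult_distrib)
  qed (use t0 in simp)
  finally have "t\<^sup>2 \<le> s * (t * g)" using 1 t0 by (meson mult_left_mono order_trans)
  then have "t * t \<le> t * (s * g)" by (simp add: power2_eq_square mult_ac)
  then have "t \<le> s * g" using t0 by (cases "t = 0") auto
  then show ?thesis by (simp add: t_def s_def g_def G_def \<alpha>_def)
qed

context prob_space begin

text \<open>
  The second moment of \<open>\<Sum>\<^sub>b \<langle>z\<^sub>b, x\<^sub>0 + \<dots> + x\<^bsub>b-1\<^esub>\<rangle>\<close> when the summands are orthogonal.  Cut into blocks of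
  length \<open>L\<close> and freeze the partial sum at the start of each block; inside a block the vectors \<open>z\<^sub>b\<close>
  are almost orthogonal, so only a fraction \<open>1 / sqrt L\<close> of the trivial bound remains.
\<close>

lemma martingale_bilinear_bound:
  fixes x z :: "nat \<Rightarrow> 'c \<Rightarrow> 'a \<Rightarrow> real"
  assumes C: "finite C" and xb: "\<And>b c. bdd (x b c)" and zb: "\<And>b c. bdd (z b c)"
    and W: "\<And>b \<omega>. W b \<omega> = (\<Sum>c\<in>C. z b c \<omega> * (\<Sum>a<b. x a c \<omega>))"
    and orth: "\<And>b b'. b < b' \<Longrightarrow> (\<integral>\<omega>. W b \<omega> * W b' \<omega> \<partial>M) = 0"
    and A: "0 < A"
    and z4: "\<And>b. (\<integral>\<omega>. (\<Sum>c\<in>C. (z b c \<omega>)\<^sup>2)\<^sup>2 \<partial>M) \<le> A"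
    and x4: "\<And>p q. (\<integral>\<omega>. (\<Sum>c\<in>C. (\<Sum>a\<in>{p..<p + q}. x a c \<omega>)\<^sup>2)\<^sup>2 \<partial>M) \<le> A * (real q)\<^sup>2"
    and G: "\<And>b b'. b \<noteq> b' \<Longrightarrow> \<bar>int b - int b'\<bar> < int L \<Longrightarrow> (\<integral>\<omega>. (\<Sum>c\<in>C. z b c \<omega> * z b' c \<omega>)\<^sup>2 \<partial>M) \<le> \<eta>"
    and L: "1 \<le> L" "L \<le> v" and \<eta>: "0 \<le> \<eta>"
  shows "(\<integral>\<omega>. (\<Sum>b<v. W b \<omega>)\<^sup>2 \<partial>M) \<le> 8 * sqrt A * (real v)\<^sup>2 * sqrt (A / L + \<eta>) + 4 * A * L * v"
proof -
  have bW: "bdd (W b)" for b unfolding W[abs_def] by (intro bdd_intros zb xb)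
  have WW: "(\<integral>\<omega>. W b \<omega> * W b' \<omega> \<partial>M) = (if b = b' then (\<integral>\<omega>. (W b \<omega>)\<^sup>2 \<partial>M) else 0)" for b b'
    using orth[of b b'] orth[of b' b] by (cases b b' rule: linorder_cases) (auto simp: power2_eq_square mult.commute)
  have exp: "(\<integral>\<omega>. (\<Sum>b<v. W b \<omega>)\<^sup>2 \<partial>M) = (\<Sum>b<v. (\<integral>\<omega>. (W b \<omega>)\<^sup>2 \<partial>M))"
  proof -
    have "(\<integral>\<omega>. (\<Sum>b<v. W b \<omega>)\<^sup>2 \<partial>M) = (\<integral>\<omega>. (\<Sum>b<v. \<Sum>b'<v. W b \<omega> * W b' \<omega>) \<partial>M)"
      by (simp add: power2_eq_square sum_product)
    also have "\<dots> = (\<Sum>b<v. \<Sum>b'<v. (\<integral>\<omega>. W b \<omega> * W b' \<omega> \<partial>M))"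
      by (subst Bochner_Integration.integral_sum, intro bdd_integrable bdd_intros bW)
        (intro sum.cong refl Bochner_Integration.integral_sum bdd_integrable bdd_intros bW)
    finally show ?thesis by (simp add: WW)
  qed
  define Q where "Q = v div L + 1"
  have QL: "v \<le> Q * L" "Q * L \<le> 2 * v"
  proof -
    have 1: "Q * L = v div L * L + L" by (simp add: Q_def)
    have 2: "v = v div L * L + v mod L" by simp
    have 3: "v mod L < L" using L by simp
    show "v \<le> Q * L" using 1 2 3 by linarith
    show "Q * L \<le> 2 * v" using 1 2 L by linarith
  qed
  let ?I = "\<lambda>b. (\<integral>\<omega>. (W b \<omega>)\<^sup>2 \<partial>M)"
  have block: "(\<Sum>b\<in>{p..<p + L}. ?I b) \<le> 2 * (sqrt A * real p * sqrt (real L * A + (real L)\<^sup>2 * \<eta>)) + 2 * (A * (real L)\<^sup>2)" for p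
  proof -
    define S where "S c \<omega> = (\<Sum>a<p. x a c \<omega>)" for c \<omega>
    define s where "s \<omega> = (\<Sum>c\<in>C. (S c \<omega>)\<^sup>2)" for \<omega>
    define \<alpha> where "\<alpha> b \<omega> = (\<Sum>c\<in>C. z b c \<omega> * S c \<omega>)" for b \<omega>
    define \<beta> where "\<beta> b \<omega> = (\<Sum>c\<in>C. z b c \<omega> * (\<Sum>a\<in>{p..<b}. x a c \<omega>))" for b \<omega>
    define g where "g \<omega> = sqrt (\<Sum>b\<in>{p..<p + L}. \<Sum>b'\<in>{p..<p + L}. (\<Sum>c\<in>C. z b c \<omega> * z b' c \<omega>)\<^sup>2)" for \<omega>
    have bS: "bdd (S c)" for c unfolding S_def by (intro bdd_intros xb)
    have bs: "bdd s" unfolding s_def by (intro bdd_intros bS)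
    have b\<alpha>: "bdd (\<alpha> b)" for b unfolding \<alpha>_def by (intro bdd_intros bS zb)
    have b\<beta>: "bdd (\<beta> b)" for b unfolding \<beta>_def by (intro bdd_intros xb zb)
    have bg2: "bdd (\<lambda>\<omega>. (g \<omega>)\<^sup>2)"
      unfolding g_def by (simp add: sum_nonneg) (intro bdd_intros zb)
    have gL: "g \<in> L2"
    proof -
      have "bdd (\<lambda>\<omega>. \<Sum>b\<in>{p..<p + L}. \<Sum>b'\<in>{p..<p + L}. (\<Sum>c\<in>C. z b c \<omega> * z b' c \<omega>)\<^sup>2)" by (intro bdd_intros zb)
      then have "g \<in> borel_measurable M" unfolding g_def[abs_def] using bdd_meas by measurable
      then show ?thesis using bdd_integrable[OF bg2] by (simp add: L2_def)
    qed
    have split: "W b \<omega> = \<alpha> b \<omega> + \<beta> b \<omega>" if "b \<in> {p..<p + L}" for b \<omega>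
    proof -
      have "(\<Sum>a<b. x a c \<omega>) = S c \<omega> + (\<Sum>a\<in>{p..<b}. x a c \<omega>)" for c
        unfolding S_def using that sum.atLeastLessThan_concat[of 0 p b "\<lambda>a. x a c \<omega>"] by (simp add: lessThan_atLeast0)
      then show ?thesis by (simp add: W \<alpha>_def \<beta>_def distrib_left sum.distrib)
    qed
    have nz: "nrm (\<lambda>\<omega>. \<Sum>c\<in>C. (z b c \<omega>)\<^sup>2) \<le> sqrt A" for b
      unfolding nrm_def using z4[of b] by simp
    have nx: "nrm (\<lambda>\<omega>. \<Sum>c\<in>C. (\<Sum>a\<in>{p..<p + q}. x a c \<omega>)\<^sup>2) \<le> sqrt A * real q" for p q
    proof -
      have "nrm (\<lambda>\<omega>. \<Sum>c\<in>C. (\<Sum>a\<in>{p..<p + q}. x a c \<omega>)\<^sup>2) \<le> sqrt (A * (real q)\<^sup>2)"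
        unfolding nrm_def using x4[of p q] by simp
      then show ?thesis by (simp add: real_sqrt_mult)
    qed
    have ib: "(\<integral>\<omega>. (\<beta> b \<omega>)\<^sup>2 \<partial>M) \<le> A * real L" if b: "b \<in> {p..<p + L}" for b
    proof -
      let ?u = "\<lambda>\<omega>. \<Sum>c\<in>C. (z b c \<omega>)\<^sup>2" and ?w = "\<lambda>\<omega>. \<Sum>c\<in>C. (\<Sum>a\<in>{p..<b}. x a c \<omega>)\<^sup>2"
      have bu: "bdd ?u" "bdd ?w" by (intro bdd_intros zb xb)+
      have "(\<integral>\<omega>. (\<beta> b \<omega>)\<^sup>2 \<partial>M) \<le> (\<integral>\<omega>. ?u \<omega> * ?w \<omega> \<partial>M)"
      proof (rule integral_mono)
        show "(\<beta> b \<omega>)\<^sup>2 \<le> ?u \<omega> * ?w \<omega>" for \<omega> unfolding \<beta>_def by (rule Cauchy_Schwarz_ineq_sum)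
      qed (intro bdd_integrable bdd_intros b\<beta> bu)+
      also have "\<dots> \<le> nrm ?u * nrm ?w" by (intro L2_CS bdd_L2 bu)
      also have "\<dots> \<le> sqrt A * (sqrt A * real (b - p))"
        using nx[of p "b - p"] b nz[of b] A by (intro mult_mono) auto
      also have "\<dots> = A * real (b - p)" using A by simp
      also have "\<dots> \<le> A * real L" using b A by (intro mult_left_mono) auto
      finally show ?thesis .
    qed
    have ia: "(\<integral>\<omega>. (\<Sum>b\<in>{p..<p + L}. (\<alpha> b \<omega>)\<^sup>2) \<partial>M) \<le> sqrt A * real p * sqrt (real L * A + (real L)\<^sup>2 * \<eta>)"
    proof -
      have "(\<integral>\<omega>. (\<Sum>b\<in>{p..<p + L}. (\<alpha> b \<omega>)\<^sup>2) \<partial>M) \<le> (\<integral>\<omega>. s \<omega> * g \<omega> \<partial>M)"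
      proof (rule integral_mono)
        show "integrable M (\<lambda>\<omega>. \<Sum>b\<in>{p..<p + L}. (\<alpha> b \<omega>)\<^sup>2)" by (intro bdd_integrable bdd_intros b\<alpha>)
        show "integrable M (\<lambda>\<omega>. s \<omega> * g \<omega>)" by (intro L2_mult bdd_L2 bs gL)
        show "(\<Sum>b\<in>{p..<p + L}. (\<alpha> b \<omega>)\<^sup>2) \<le> s \<omega> * g \<omega>" for \<omega>
          unfolding \<alpha>_def s_def g_def by (rule almost_orthogonal_bessel) (auto simp: C)
      qed
      also have "\<dots> \<le> nrm s * nrm g" by (intro L2_CS bdd_L2 bs gL)
      also have "\<dots> \<le> (sqrt A * real p) * sqrt (real L * A + (real L)\<^sup>2 * \<eta>)"
      proof (rule mult_mono)
        show "nrm s \<le> sqrt A * real p" using nx[of 0 p] by (simp add: s_def[abs_def] S_def lessThan_atLeast0)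
        have "(nrm g)\<^sup>2 = (\<Sum>b\<in>{p..<p + L}. \<Sum>b'\<in>{p..<p + L}. (\<integral>\<omega>. (\<Sum>c\<in>C. z b c \<omega> * z b' c \<omega>)\<^sup>2 \<partial>M))"
          unfolding nrm_sq g_def by (simp add: sum_nonneg)
            (subst Bochner_Integration.integral_sum, intro bdd_integrable bdd_intros zb,
             intro sum.cong refl Bochner_Integration.integral_sum bdd_integrable bdd_intros zb)
        also have "\<dots> \<le> (\<Sum>b\<in>{p..<p + L}. \<Sum>b'\<in>{p..<p + L}. (if b = b' then A else 0) + \<eta>)"
        proof (intro sum_mono)
          fix b b' assume bb: "b \<in> {p..<p + L}" "b' \<in> {p..<p + L}"
          show "(\<integral>\<omega>. (\<Sum>c\<in>C. z b c \<omega> * z b' c \<omega>)\<^sup>2 \<partial>M) \<le> (if b = b' then A else 0) + \<eta>"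
            using z4[of b] \<eta> G[of b b'] bb by (cases "b = b'") (auto simp: power2_eq_square)
        qed
        also have "\<dots> = real L * A + (real L)\<^sup>2 * \<eta>" by (simp add: sum.distrib power2_eq_square distrib_left mult.assoc)
        finally show "nrm g \<le> sqrt (real L * A + (real L)\<^sup>2 * \<eta>)" by (rule real_le_rsqrt)
      qed (use A in auto)
      finally show ?thesis .
    qed
    have "(\<Sum>b\<in>{p..<p + L}. ?I b) \<le> (\<Sum>b\<in>{p..<p + L}. 2 * (\<integral>\<omega>. (\<alpha> b \<omega>)\<^sup>2 \<partial>M) + 2 * (\<integral>\<omega>. (\<beta> b \<omega>)\<^sup>2 \<partial>M))"
    proof (rule sum_mono)
      fix b assume b: "b \<in> {p..<p + L}"
      have "?I b \<le> (\<integral>\<omega>. 2 * (\<alpha> b \<omega>)\<^sup>2 + 2 * (\<beta> b \<omega>)\<^sup>2 \<partial>M)"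
      proof (rule integral_mono)
        fix \<omega>
        have "0 \<le> (\<alpha> b \<omega> - \<beta> b \<omega>)\<^sup>2" by simp
        then show "(W b \<omega>)\<^sup>2 \<le> 2 * (\<alpha> b \<omega>)\<^sup>2 + 2 * (\<beta> b \<omega>)\<^sup>2"
          unfolding split[OF b] by (simp add: power2_sum power2_diff)
      qed (intro bdd_integrable bdd_intros bW b\<alpha> b\<beta>)+
      also have "\<dots> = 2 * (\<integral>\<omega>. (\<alpha> b \<omega>)\<^sup>2 \<partial>M) + 2 * (\<integral>\<omega>. (\<beta> b \<omega>)\<^sup>2 \<partial>M)"
        using bdd_integrable[OF bdd_power[OF b\<alpha>, of b 2]] bdd_integrable[OF bdd_power[OF b\<beta>, of b 2]] by simp
      finally show "?I b \<le> 2 * (\<integral>\<omega>. (\<alpha> b \<omega>)\<^sup>2 \<partial>M) + 2 * (\<integral>\<omega>. (\<beta> b \<omega>)\<^sup>2 \<partial>M)" .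
    qed
    also have "\<dots> = 2 * (\<integral>\<omega>. (\<Sum>b\<in>{p..<p + L}. (\<alpha> b \<omega>)\<^sup>2) \<partial>M) + 2 * (\<Sum>b\<in>{p..<p + L}. (\<integral>\<omega>. (\<beta> b \<omega>)\<^sup>2 \<partial>M))"
      using bdd_integrable[OF bdd_power[OF b\<alpha>]]
      by (subst Bochner_Integration.integral_sum) (auto simp: sum.distrib sum_distrib_left)
    also have "\<dots> \<le> 2 * (sqrt A * real p * sqrt (real L * A + (real L)\<^sup>2 * \<eta>)) + 2 * (\<Sum>b\<in>{p..<p + L}. A * real L)"
      using ia ib by (intro add_mono mult_left_mono sum_mono) auto
    finally show ?thesis by (simp add: power2_eq_square mult_ac)
  qed
  have sq: "sqrt (real L * A + (real L)\<^sup>2 * \<eta>) = real L * sqrt (A / L + \<eta>)"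
  proof -
    have "real L * A + (real L)\<^sup>2 * \<eta> = (real L)\<^sup>2 * (A / L + \<eta>)"
    proof -
      have "(real L)\<^sup>2 * (A / L + \<eta>) = real L * (real L * (A / L)) + (real L)\<^sup>2 * \<eta>"
        by (simp only: power2_eq_square distrib_left mult.assoc)
      also have "real L * (A / L) = A" using L by simp
      finally show ?thesis by (rule sym)
    qed
    then show ?thesis by (simp add: real_sqrt_mult)
  qed
  have "(\<Sum>b<v. ?I b) \<le> (\<Sum>b<Q * L. ?I b)"
    using QL(1) by (intro sum_mono2) auto
  also have "\<dots> = (\<Sum>q<Q. \<Sum>b\<in>{q * L..<q * L + L}. ?I b)" by (rule sum.nat_group[symmetric])
  also have "\<dots> \<le> (\<Sum>q<Q. 2 * (sqrt A * real (Q * L) * (real L * sqrt (A / L + \<eta>))) + 2 * (A * (real L)\<^sup>2))"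
  proof (rule sum_mono)
    fix q assume "q \<in> {..<Q}"
    then have "q * L \<le> Q * L" by (intro mult_right_mono) auto
    then have "real (q * L) \<le> real (Q * L)" by (simp only: of_nat_le_iff)
    then have "sqrt A * real (q * L) * (real L * sqrt (A / L + \<eta>)) \<le> sqrt A * real (Q * L) * (real L * sqrt (A / L + \<eta>))"
      using A \<eta> by (intro mult_right_mono mult_left_mono) auto
    then show "(\<Sum>b\<in>{q * L..<q * L + L}. ?I b) \<le> 2 * (sqrt A * real (Q * L) * (real L * sqrt (A / L + \<eta>))) + 2 * (A * (real L)\<^sup>2)"
      using block[of "q * L"] unfolding sq by linarith
  qed
  also have "\<dots> = 2 * sqrt A * (real (Q * L))\<^sup>2 * sqrt (A / L + \<eta>) + 2 * A * L * real (Q * L)"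
    by (simp add: power2_eq_square algebra_simps)
  also have "\<dots> \<le> 2 * sqrt A * (real (2 * v))\<^sup>2 * sqrt (A / L + \<eta>) + 2 * A * L * real (2 * v)"
  proof -
    have "real (Q * L) \<le> real (2 * v)" using QL(2) by (simp only: of_nat_le_iff)
    then show ?thesis using A \<eta> by (intro add_mono mult_right_mono mult_left_mono power_mono) auto
  qed
  also have "\<dots> = 8 * sqrt A * (real v)\<^sup>2 * sqrt (A / L + \<eta>) + 4 * A * L * v" by (simp add: power2_eq_square)
  finally show ?thesis unfolding exp .
qed

end

section \<open>Bounded orthomartingale difference fields\<close>

context commuting_system begin

lemma bdd_sh: "bdd g \<Longrightarrow> bdd (sh h g)"
  unfolding bdd_def using sh_meas by (auto simp: sh_def)

lemma bdd_S: "bdd g \<Longrightarrow> bdd (S J n g)"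
  unfolding S_def by (intro bdd_sum bdd_sh)

end

text \<open>
  Boundedness makes all powers and products below integrable; unbounded differences are reached by
  approximation.
\<close>

locale bounded_orthomartingale = commuting_system M T F
  for M :: "'a measure" and T :: "int ^ 'd::finite \<Rightarrow> 'a \<Rightarrow> 'a" and F +
  fixes D :: "'a \<Rightarrow> real" and K :: real
  assumes D_H: "D \<in> H" and D_K: "\<bar>D x\<bar> \<le> K" and D_mds: "mds UNIV D" and K_pos: "0 < K"
begin

lemma D_bdd: "bdd D" using L2_meas[OF H_L2[OF D_H]] D_K by (rule bdd_I)

lemma slice_meas:
  assumes "\<And>h. h \<in> Box J n \<Longrightarrow> l + h \<le> \<kappa>" shows "sh l (S J n D) \<in> borel_measurable (F \<kappa>)"
  unfolding S_sh[symmetric] by (rule S_F[of _ l]) (use sh_F[OF H_F[OF D_H], of l] assms in auto)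

text \<open>
  A slice all of whose sites lie beyond \<open>\<kappa>\<close> in the direction \<open>i\<close> inherits the orthogonality of its sites.
\<close>

lemma slice_orthogonal:
  assumes Z: "bdd Z" "Z \<in> borel_measurable (F \<kappa>)" and l: "\<And>h. h \<in> Box J n \<Longrightarrow> \<kappa> $ i < (l + h) $ i"
  shows "(\<integral>x. Z x * sh l (S J n D) x \<partial>M) = 0"
proof -
  have "(\<integral>x. Z x * sh l (S J n D) x \<partial>M) = (\<integral>x. (\<Sum>h\<in>Box J n. Z x * sh (l + h) D x) \<partial>M)"
    by (intro Bochner_Integration.integral_cong refl) (simp add: S_def sh_def T_T sum_distrib_left add.commute)
  also have "\<dots> = (\<Sum>h\<in>Box J n. (\<integral>x. Z x * sh (l + h) D x \<partial>M))"
    by (intro Bochner_Integration.integral_sum bdd_integrable bdd_intros Z bdd_sh D_bdd)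
  also have "\<dots> = 0"
  proof (intro sum.neutral ballI)
    fix h assume "h \<in> Box J n"
    then show "(\<integral>x. Z x * sh (l + h) D x \<partial>M) = 0"
      by (intro mds_orthogonal[OF D_H _ bdd_L2[OF Z(1)] Z(2) l]) (use D_mds in \<open>auto simp: mds_def\<close>)
  qed
  finally show ?thesis .
qed

lemma fourth_moment_box:
  assumes n: "\<And>j. 0 \<le> n $ j"
  shows "(\<integral>x. (S J n D x) ^ 4 \<partial>M) \<le> 16 ^ card J * (vol_on J n)\<^sup>2 * K ^ 4"
proof -
  have "finite J" by simp
  then show ?thesis
  proof (induction rule: finite_induct)
    case empty
    have "(\<integral>x. (D x) ^ 4 \<partial>M) \<le> (\<integral>x. K ^ 4 \<partial>M)"
    proof (rule integral_mono)
      fix x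
      have "\<bar>D x\<bar> ^ 4 \<le> K ^ 4" by (intro power_mono D_K) simp
      then show "(D x) ^ 4 \<le> K ^ 4" by simp
    qed (intro bdd_integrable bdd_intros D_bdd)+
    then show ?case by (simp add: vol_on_def prob_space)
  next
    case (insert i J)
    define N where "N = nat (n $ i)"
    define Y where "Y c = sh (axis i (int c + 1)) (S J n D)" for c
    have SY: "S (insert i J) n D x = (\<Sum>c<N. Y c x)" for x
      unfolding S_insert[OF insert.hyps(2)]
      by (rule sum.reindex_bij_witness[of _ "\<lambda>c. int c + 1" "\<lambda>c. nat (c - 1)"])
        (use n[of i] in \<open>auto simp: N_def Y_def\<close>)
    have bY: "bdd (Y c)" for c unfolding Y_def by (intro bdd_sh bdd_S D_bdd)
    have "(\<integral>x. (\<Sum>c<N. Y c x) ^ 4 \<partial>M) \<le> 16 * (real N)\<^sup>2 * (16 ^ card J * (vol_on J n)\<^sup>2 * K ^ 4)"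
    proof (rule fourth_moment_martingale[OF bY])
      fix c assume "c < N"
      have "(\<integral>x. (Y c x) ^ 4 \<partial>M) = (\<integral>x. (S J n D x) ^ 4 \<partial>M)"
        unfolding Y_def sh_def by (rule integral_T) (intro bdd_meas bdd_intros bdd_S D_bdd)
      then show "(\<integral>x. (Y c x) ^ 4 \<partial>M) \<le> 16 ^ card J * (vol_on J n)\<^sup>2 * K ^ 4"
        using insert.IH by simp
      show "(\<integral>x. (\<Sum>a<c. Y a x) ^ 3 * Y c x \<partial>M) = 0"
        unfolding Y_def[of c]
      proof (rule slice_orthogonal[where i=i and \<kappa>="idx i (int c) n"])
        show "bdd (\<lambda>x. (\<Sum>a<c. Y a x) ^ 3)" by (intro bdd_intros bY)
        have "Y a \<in> borel_measurable (F (idx i (int c) n))" if "a < c" for a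
          unfolding Y_def
        proof (rule slice_meas)
          fix h assume "h \<in> Box J n"
          then have h: "if j \<in> J then 1 \<le> h $ j \<and> h $ j \<le> n $ j else h $ j = 0" for j by (simp add: Box_def)
          show "axis i (int a + 1) + h \<le> idx i (int c) n" unfolding less_eq_vec_def
          proof
            fix j show "(axis i (int a + 1) + h) $ j \<le> idx i (int c) n $ j"
              using h[of j] n[of j] insert.hyps(2) that by (auto simp: axis_nth' split: if_splits)
          qed
        qed
        then show "(\<lambda>x. (\<Sum>a<c. Y a x) ^ 3) \<in> borel_measurable (F (idx i (int c) n))"
          by (intro borel_measurable_power borel_measurable_sum) auto
        fix h assume "h \<in> Box J n"
        then have "h $ i = 0" using insert.hyps(2) by (auto simp: Box_def)
        then show "idx i (int c) n $ i < (axis i (int c + 1) + h) $ i" by (simp add: axis_nth')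
      qed
    qed
    also have "\<dots> = 16 ^ card (insert i J) * (vol_on (insert i J) n)\<^sup>2 * K ^ 4"
      using insert.hyps n[of i] by (simp add: vol_on_insert N_def power_mult_distrib)
    finally show ?case unfolding SY .
  qed
qed

text \<open>
  Supplies the fourth moments of vectors that \<open>martingale_bilinear_bound\<close> asks for: by Cauchy-Schwarz they
  are at most those of a single coordinate, suitably scaled.
\<close>

lemma square_average_bound:
  assumes g: "bdd g" and m: "1 \<le> m" and w: "0 < w"
  shows "(\<integral>x. (\<Sum>c\<in>{1..int m}. ((1 / sqrt (real m * w)) * sh (l c) g x)\<^sup>2)\<^sup>2 \<partial>M) \<le> (1 / w\<^sup>2) * (\<integral>x. (g x) ^ 4 \<partial>M)"
proof -
  define q where "q = 1 / (real m * w)"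
  have q: "(1 / sqrt (real m * w))\<^sup>2 = q" using m w by (simp add: q_def power_divide)
  have "(\<integral>x. (\<Sum>c\<in>{1..int m}. ((1 / sqrt (real m * w)) * sh (l c) g x)\<^sup>2)\<^sup>2 \<partial>M)
      = (\<integral>x. (\<Sum>c\<in>{1..int m}. q * (sh (l c) g x)\<^sup>2)\<^sup>2 \<partial>M)"
    by (simp only: power_mult_distrib q)
  also have "\<dots> \<le> (\<integral>x. q\<^sup>2 * real m * (\<Sum>c\<in>{1..int m}. (sh (l c) g x) ^ 4) \<partial>M)"
  proof (rule integral_mono)
    fix x
    have "(\<Sum>c\<in>{1..int m}. 1 * (sh (l c) g x)\<^sup>2)\<^sup>2 \<le> (\<Sum>c\<in>{1..int m}. 1\<^sup>2) * (\<Sum>c\<in>{1..int m}. ((sh (l c) g x)\<^sup>2)\<^sup>2)"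
      by (rule Cauchy_Schwarz_ineq_sum)
    then have "(\<Sum>c\<in>{1..int m}. (sh (l c) g x)\<^sup>2)\<^sup>2 \<le> real m * (\<Sum>c\<in>{1..int m}. (sh (l c) g x) ^ 4)"
      by (simp add: power_mult[symmetric])
    from mult_left_mono[OF this, of "q\<^sup>2"]
    show "(\<Sum>c\<in>{1..int m}. q * (sh (l c) g x)\<^sup>2)\<^sup>2 \<le> q\<^sup>2 * real m * (\<Sum>c\<in>{1..int m}. (sh (l c) g x) ^ 4)"
      by (simp add: sum_distrib_left[symmetric] power_mult_distrib mult.assoc)
  qed (intro bdd_integrable bdd_intros bdd_sh g)+
  also have "\<dots> = q\<^sup>2 * real m * (\<Sum>c\<in>{1..int m}. (\<integral>x. (sh (l c) g x) ^ 4 \<partial>M))"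
    using bdd_integrable[OF bdd_power[OF bdd_sh[OF g]]] by simp
  also have "(\<Sum>c\<in>{1..int m}. (\<integral>x. (sh (l c) g x) ^ 4 \<partial>M)) = real m * (\<integral>x. (g x) ^ 4 \<partial>M)"
    using integral_T[OF bdd_meas[OF bdd_power[OF g, of 4]]] by (simp add: sh_def)
  also have "q\<^sup>2 * real m * (real m * (\<integral>x. (g x) ^ 4 \<partial>M)) = (1 / w\<^sup>2) * (\<integral>x. (g x) ^ 4 \<partial>M)"
    using m w by (simp add: q_def power2_eq_square)
  finally show ?thesis .
qed

text \<open>The empirical covariance, over \<open>m\<close> steps in the direction \<open>\<iota>\<close>, of a normalised box sum and its translate.\<close>

definition cor :: "'d \<Rightarrow> 'd set \<Rightarrow> int ^ 'd \<Rightarrow> nat \<Rightarrow> int ^ 'd \<Rightarrow> 'a \<Rightarrow> real" where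
  "cor \<iota> J n m k = (\<lambda>x. (1 / (real m * vol_on J n)) *
     (\<Sum>c\<in>{1..int m}. sh (axis \<iota> c) (S J n D) x * sh (axis \<iota> c + k) (S J n D) x))"

lemma cor_bdd: "bdd (cor \<iota> J n m k)"
  unfolding cor_def by (intro bdd_intros bdd_sh bdd_S D_bdd)

text \<open>
  The vectors to which \<open>martingale_bilinear_bound\<close> is applied: \<open>Y k b\<close> has as coordinates the normalised
  slice sums along \<open>\<iota>\<close>, translated by \<open>k\<close> and by \<open>b + 1\<close> steps along \<open>i\<close>.  Their inner products are translates
  of empirical covariances, and \<open>Y k b\<close> is a martingale difference sequence in \<open>b\<close>.
\<close>

lemma off_diagonal_bound:
  assumes io: "i \<noteq> \<iota>" and i: "i \<notin> J" and \<iota>: "\<iota> \<notin> J" and n: "\<And>j. 1 \<le> n $ j" and m: "1 \<le> m"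
    and k: "k1 $ i = 0" "k2 $ i = 0"
    and L: "1 \<le> L" "L \<le> v" and \<eta>: "0 \<le> \<eta>"
    and C: "\<And>t. t \<noteq> 0 \<Longrightarrow> \<bar>t\<bar> < int L \<Longrightarrow> (\<integral>x. (cor \<iota> J n m (axis i t) x)\<^sup>2 \<partial>M) \<le> \<eta>"
    and A: "A = 16 ^ (card J + 1) * K ^ 4"
    and Y: "Y = (\<lambda>k b c. (\<lambda>x. (1 / sqrt (real m * vol_on J n)) * sh (axis \<iota> c + axis i (int b + 1) + k) (S J n D) x))"
  shows "(\<integral>x. (\<Sum>b<v. \<Sum>c\<in>{1..int m}. Y k2 b c x * (\<Sum>a<b. Y k1 a c x))\<^sup>2 \<partial>M)
    \<le> 8 * sqrt A * (real v)\<^sup>2 * sqrt (A / L + \<eta>) + 4 * A * L * v"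
proof -
  define w where "w = vol_on J n"
  define q where "q = 1 / sqrt (real m * w)"
  have w: "0 < w" unfolding w_def by (rule vol_on_pos) (rule n)
  have n0: "0 \<le> n $ j" for j using n[of j] by simp
  have A0: "0 < A" unfolding A using K_pos by simp
  have q2: "q * q = 1 / (real m * w)" using m w by (simp add: q_def power2_eq_square[symmetric] power_divide)
  let ?Sb = "S J n D"
  have Y': "Y k b c = (\<lambda>x. q * sh (axis \<iota> c + axis i (int b + 1) + k) ?Sb x)" for k b c
    by (simp add: Y q_def w_def)
  have bY: "bdd (Y k b c)" for k b c unfolding Y' by (intro bdd_intros bdd_sh bdd_S D_bdd)
  show ?thesis
  proof (rule martingale_bilinear_bound[where x="Y k1" and z="Y k2" and W="\<lambda>b x. \<Sum>c\<in>{1..int m}. Y k2 b c x * (\<Sum>a<b. Y k1 a c x)" and C="{1..int m}" and A=A and L=L and \<eta>=\<eta> and v=v])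
    show "finite {1..int m}" by simp
    show "bdd (Y k1 b c)" "bdd (Y k2 b c)" for b c by (rule bY)+
    show "(\<integral>x. (\<Sum>c\<in>{1..int m}. Y k2 b c x * (\<Sum>a<b. Y k1 a c x)) * (\<Sum>c\<in>{1..int m}. Y k2 b' c x * (\<Sum>a<b'. Y k1 a c x)) \<partial>M) = 0"
      if bb: "b < b'" for b b'
    proof -
      let ?W = "\<lambda>x. \<Sum>c\<in>{1..int m}. Y k2 b c x * (\<Sum>a<b. Y k1 a c x)"
      \<comment> \<open>everything up to step \<open>b'\<close> along \<open>i\<close> is measurable here: the other coordinates only have to be large\<close>
      define \<kappa> where "\<kappa> = idx i (int b') (\<chi> j. int m + n $ j + \<bar>k1 $ j\<bar> + \<bar>k2 $ j\<bar>)"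
      have Ym: "Y k' a c \<in> borel_measurable (F \<kappa>)" if "a < b'" "c \<in> {1..int m}" "k' = k1 \<or> k' = k2" for k' a c
        unfolding Y'
      proof (intro borel_measurable_times borel_measurable_const slice_meas)
        fix h assume "h \<in> Box J n"
        then have h: "if j \<in> J then 1 \<le> h $ j \<and> h $ j \<le> n $ j else h $ j = 0" for j by (simp add: Box_def)
        show "axis \<iota> c + axis i (int a + 1) + k' + h \<le> \<kappa>" unfolding less_eq_vec_def
        proof
          fix j
          have kj: "k' $ j \<le> \<bar>k1 $ j\<bar> + \<bar>k2 $ j\<bar>" using that(3) by auto
          have hj: "h $ j \<le> n $ j" using h[of j] n[of j] by (auto split: if_splits)
          show "(axis \<iota> c + axis i (int a + 1) + k' + h) $ j \<le> \<kappa> $ j"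
          proof (cases "j = i")
            case True
            then show ?thesis using h[of i] i io that k by (auto simp: \<kappa>_def axis_nth')
          next
            case False
            then show ?thesis using kj hj that(2) by (auto simp: \<kappa>_def axis_nth')
          qed
        qed
      qed
      have "(\<integral>x. ?W x * (\<Sum>c\<in>{1..int m}. Y k2 b' c x * (\<Sum>a<b'. Y k1 a c x)) \<partial>M)
        = (\<integral>x. (\<Sum>c\<in>{1..int m}. q * ((?W x * (\<Sum>a<b'. Y k1 a c x)) * sh (axis \<iota> c + axis i (int b' + 1) + k2) ?Sb x)) \<partial>M)"
        by (intro Bochner_Integration.integral_cong refl, subst sum_distrib_left) (simp add: Y'[of k2 b'] mult_ac)
      also have "\<dots> = (\<Sum>c\<in>{1..int m}. q * (\<integral>x. (?W x * (\<Sum>a<b'. Y k1 a c x)) * sh (axis \<iota> c + axis i (int b' + 1) + k2) ?Sb x \<partial>M))"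
        by (subst Bochner_Integration.integral_sum, intro bdd_integrable bdd_intros bY bdd_sh bdd_S D_bdd)
          (intro sum.cong refl integral_mult_right_zero)
      also have "\<dots> = 0"
      proof (intro sum.neutral ballI)
        fix c assume c: "c \<in> {1..int m}"
        have "(\<integral>x. (?W x * (\<Sum>a<b'. Y k1 a c x)) * sh (axis \<iota> c + axis i (int b' + 1) + k2) ?Sb x \<partial>M) = 0"
        proof (rule slice_orthogonal[where \<kappa>=\<kappa> and i=i])
          show "bdd (\<lambda>x. ?W x * (\<Sum>a<b'. Y k1 a c x))" by (intro bdd_intros bY)
          show "(\<lambda>x. ?W x * (\<Sum>a<b'. Y k1 a c x)) \<in> borel_measurable (F \<kappa>)"
            using bb c by (intro borel_measurable_times borel_measurable_sum Ym) auto
          fix h assume "h \<in> Box J n"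
          then have "h $ i = 0" using i by (auto simp: Box_def)
          then show "\<kappa> $ i < (axis \<iota> c + axis i (int b' + 1) + k2 + h) $ i"
            using io k by (simp add: \<kappa>_def axis_nth')
        qed
        then show "q * (\<integral>x. (?W x * (\<Sum>a<b'. Y k1 a c x)) * sh (axis \<iota> c + axis i (int b' + 1) + k2) ?Sb x \<partial>M) = 0" by simp
      qed
      finally show ?thesis .
    qed
    show "0 < A" by (rule A0)
    have w2: "(1 / w\<^sup>2) * (16 ^ p * (vol_on J n)\<^sup>2 * K ^ 4) = 16 ^ p * K ^ 4" for p :: nat
      using w by (simp add: w_def)
    show "(\<integral>x. (\<Sum>c\<in>{1..int m}. (Y k2 b c x)\<^sup>2)\<^sup>2 \<partial>M) \<le> A" for b
    proof -
      have "(\<integral>x. (\<Sum>c\<in>{1..int m}. (Y k2 b c x)\<^sup>2)\<^sup>2 \<partial>M) \<le> (1 / w\<^sup>2) * (\<integral>x. (?Sb x) ^ 4 \<partial>M)"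
        unfolding Y' q_def by (rule square_average_bound[OF bdd_S[OF D_bdd] m w])
      also have "\<dots> \<le> (1 / w\<^sup>2) * (16 ^ card J * (vol_on J n)\<^sup>2 * K ^ 4)"
        by (intro mult_left_mono fourth_moment_box n0) auto
      also have "\<dots> = 16 ^ card J * K ^ 4" by (rule w2)
      also have "\<dots> \<le> A" unfolding A using K_pos by simp
      finally show ?thesis .
    qed
    show "(\<integral>x. (\<Sum>c\<in>{1..int m}. (\<Sum>a\<in>{p..<p + r}. Y k1 a c x)\<^sup>2)\<^sup>2 \<partial>M) \<le> A * (real r)\<^sup>2" for p r
    proof -
      let ?n = "idx i (int r) n"
      have eq: "(\<Sum>a\<in>{p..<p + r}. Y k1 a c x) = q * sh (axis \<iota> c + axis i (int p) + k1) (S (insert i J) ?n D) x" for c x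
      proof -
        have "(\<Sum>a\<in>{p..<p + r}. Y k1 a c x) = q * (\<Sum>a\<in>{p..<p + r}. sh (axis \<iota> c + axis i (int a + 1) + k1) ?Sb x)"
          by (simp add: Y' sum_distrib_left)
        also have "(\<Sum>a\<in>{p..<p + r}. sh (axis \<iota> c + axis i (int a + 1) + k1) ?Sb x)
          = (\<Sum>b\<in>{1..int r}. sh (axis i b) ?Sb (T (axis \<iota> c + axis i (int p) + k1) x))"
        proof (rule sum.reindex_bij_witness[of _ "\<lambda>b. nat (b - 1) + p" "\<lambda>a. int a - int p + 1"])
          fix a :: nat
          have "axis i (int a - int p + 1) + (axis \<iota> c + axis i (int p) + k1) = axis \<iota> c + axis i (int a + 1) + k1"
            by (simp add: vec_eq_iff axis_nth')
          then show "sh (axis i (int a - int p + 1)) ?Sb (T (axis \<iota> c + axis i (int p) + k1) x) = sh (axis \<iota> c + axis i (int a + 1) + k1) ?Sb x"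
            unfolding sh_def T_T by (simp only:)
        qed auto
        also have "\<dots> = sh (axis \<iota> c + axis i (int p) + k1) (S (insert i J) ?n D) x"
          using S_cong[of J ?n n D] i by (simp add: S_insert[OF i] sh_def) (metis (no_types, lifting) idx_nth)
        finally show ?thesis .
      qed
      have "(\<integral>x. (\<Sum>c\<in>{1..int m}. (\<Sum>a\<in>{p..<p + r}. Y k1 a c x)\<^sup>2)\<^sup>2 \<partial>M) \<le> (1 / w\<^sup>2) * (\<integral>x. (S (insert i J) ?n D x) ^ 4 \<partial>M)"
        unfolding eq q_def by (rule square_average_bound[OF bdd_S[OF D_bdd] m w])
      also have "\<dots> \<le> (1 / w\<^sup>2) * (16 ^ card (insert i J) * (vol_on (insert i J) ?n)\<^sup>2 * K ^ 4)"
        using n0 by (intro mult_left_mono fourth_moment_box) auto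
      also have "vol_on (insert i J) ?n = real r * vol_on J n"
        using i vol_on_cong[of J ?n n] by (simp add: vol_on_insert) (metis idx_nth)
      also have "(1 / w\<^sup>2) * (16 ^ card (insert i J) * (real r * vol_on J n)\<^sup>2 * K ^ 4)
          = (real r)\<^sup>2 * ((1 / w\<^sup>2) * (16 ^ (card J + 1) * (vol_on J n)\<^sup>2 * K ^ 4))"
        using i by (simp add: power_mult_distrib)
      also have "\<dots> = A * (real r)\<^sup>2" unfolding w2 A by (rule mult.commute)
      finally show ?thesis .
    qed
    show "(\<integral>x. (\<Sum>c\<in>{1..int m}. Y k2 b c x * Y k2 b' c x)\<^sup>2 \<partial>M) \<le> \<eta>"
      if bb: "b \<noteq> b'" "\<bar>int b - int b'\<bar> < int L" for b b'
    proof -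
      let ?t = "int b' - int b"
      have "(\<Sum>c\<in>{1..int m}. Y k2 b c x * Y k2 b' c x) = sh (axis i (int b + 1) + k2) (cor \<iota> J n m (axis i ?t)) x" for x
      proof -
        have "(\<Sum>c\<in>{1..int m}. Y k2 b c x * Y k2 b' c x)
          = (q * q) * (\<Sum>c\<in>{1..int m}. sh (axis \<iota> c + axis i (int b + 1) + k2) ?Sb x * sh (axis \<iota> c + axis i (int b' + 1) + k2) ?Sb x)"
          by (simp add: Y' sum_distrib_left mult_ac)
        also have "\<dots> = sh (axis i (int b + 1) + k2) (cor \<iota> J n m (axis i ?t)) x"
        proof -
          have "axis \<iota> c + axis i (int b' + 1) + k2 = axis \<iota> c + axis i ?t + (axis i (int b + 1) + k2)" for c
            by (simp add: vec_eq_iff axis_nth')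
          then show ?thesis unfolding cor_def sh_def q2 w_def[symmetric] by (simp only: T_T add.assoc)
        qed
        finally show ?thesis .
      qed
      then have "(\<integral>x. (\<Sum>c\<in>{1..int m}. Y k2 b c x * Y k2 b' c x)\<^sup>2 \<partial>M) = (\<integral>x. (cor \<iota> J n m (axis i ?t) x)\<^sup>2 \<partial>M)"
        using integral_T[OF bdd_meas[OF bdd_power[OF cor_bdd, where p=2]]] by (simp add: sh_def)
      also have "\<dots> \<le> \<eta>" using bb by (intro C) auto
      finally show ?thesis .
    qed
    show "1 \<le> L" "L \<le> v" "0 \<le> \<eta>" by (rule L \<eta>)+
  qed auto
qed

text \<open>
  A nonzero \<open>k\<close> is positive or negative in some direction; accordingly one of the two factors lies in the
  past of the other in that direction.
\<close>

lemma D_covariance: "(\<integral>x. D x * sh k D x \<partial>M) = (if k = 0 then (nrm D)\<^sup>2 else 0)"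
proof (cases "k = 0")
  case True
  then show ?thesis unfolding nrm_sq by (simp add: power2_eq_square)
next
  case False
  then obtain i where "k $ i \<noteq> 0" by (auto simp: vec_eq_iff)
  then consider "0 < k $ i" | "k $ i < 0" by linarith
  moreover have md: "mds {i} D" using D_mds by (simp add: mds_def)
  ultimately show ?thesis
  proof cases
    case 1
    then show ?thesis
      using mds_orthogonal[OF D_H md H_L2[OF D_H] H_F[OF D_H], of k] False by simp
  next
    case 2
    have "sh k D \<in> borel_measurable (F k)" using sh_F[OF H_F[OF D_H], of k] by simp
    then show ?thesis
      using mds_orthogonal[OF D_H md sh_L2[OF H_L2[OF D_H]], of k k 0] False 2 by (simp add: mult.commute)
  qed
qed

text \<open>
  Law of large numbers for the products of slice sums, as the number of slices and their sides grow in
  an arbitrary manner.  For a single site this is the ergodic theorem for the shift in the direction \<open>\<iota>\<close>.  When a direction \<open>i\<close> is added,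
  the diagonal terms are averages of the previous covariances, and the off-diagonal terms form a
  martingale in the direction \<open>i\<close>; their size is governed by the covariances at finitely many
  translations along \<open>i\<close>, which are small by the induction hypothesis.
\<close>

theorem slice_covariance:
  assumes erg: "\<And>B. B \<in> sets M \<Longrightarrow> T (axis \<iota> 1) -` B = B \<Longrightarrow> prob B = 0 \<or> prob B = 1"
    and \<iota>: "\<iota> \<notin> J" and k: "\<And>j. j \<in> insert \<iota> J \<Longrightarrow> k $ j = 0" and \<epsilon>: "0 < \<epsilon>"
  shows "\<exists>L\<ge>1. \<forall>m\<ge>L. \<forall>n. (\<forall>j. 1 \<le> n $ j) \<and> (\<forall>j\<in>J. int L \<le> n $ j) \<longrightarrow>
    nrm (\<lambda>x. cor \<iota> J n m k x - (if k = 0 then (nrm D)\<^sup>2 else 0)) \<le> \<epsilon>"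
proof -
  define s where "s k = (if k = 0 then (nrm D)\<^sup>2 else 0)" for k :: "int ^ 'd"
  have "finite J" by simp
  then have "\<exists>L\<ge>1. \<forall>m\<ge>L. \<forall>n. (\<forall>j. 1 \<le> n $ j) \<and> (\<forall>j\<in>J. int L \<le> n $ j) \<longrightarrow>
    nrm (\<lambda>x. cor \<iota> J n m k x - s k) \<le> \<epsilon>" using \<iota> k \<epsilon>
  proof (induction J arbitrary: k \<epsilon> rule: finite_induct)
    case empty
    let ?e = "axis \<iota> 1 :: int ^ 'd"
    define h where "h x = D x * sh k D x" for x
    have bh: "bdd h" unfolding h_def by (intro bdd_intros bdd_sh D_bdd)
    then obtain B where B: "\<And>x. \<bar>h x\<bar> \<le> B" by (auto simp: bdd_def)
    have Eh: "expectation h = s k" unfolding h_def s_def by (rule D_covariance)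
    have pw: "T ?e ^^ c = T (axis \<iota> (int c))" for c
    proof (induction c)
      case (Suc c)
      have "(T ?e ^^ Suc c) x = T (axis \<iota> (int (Suc c))) x" for x
        by (simp add: Suc T_T axis_add)
      then show ?case by (rule ext)
    qed (simp add: fun_eq_iff)
    have lim: "(\<lambda>m. nrm (\<lambda>x. (\<Sum>c<m. h ((T ?e ^^ c) x)) / real m - expectation h)) \<longlonglongrightarrow> 0"
      by (rule mean_ergodic_bounded[OF space_UNIV T_meas T_distr erg bdd_meas[OF bh] B])
    then obtain L where L: "\<And>m. L \<le> m \<Longrightarrow> nrm (\<lambda>x. (\<Sum>c<m. h ((T ?e ^^ c) x)) / real m - expectation h) \<le> \<epsilon>"
      using order_tendstoD(2)[OF lim empty(3)] unfolding eventually_sequentially by (meson less_imp_le)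
    show ?case
    proof (rule exI[of _ "max 1 L"], intro conjI allI impI)
      fix m n assume m: "max 1 L \<le> m"
      let ?g = "\<lambda>x. (\<Sum>c<m. h ((T ?e ^^ c) x)) / real m - expectation h"
      have bg: "bdd ?g" unfolding pw using bdd_sh[OF bh] by (intro bdd_intros) (simp add: sh_def)
      have "cor \<iota> {} n m k x - s k = sh ?e ?g x" for x
      proof -
        have "(\<Sum>c\<in>{1..int m}. sh (axis \<iota> c) D x * sh (axis \<iota> c + k) D x) = (\<Sum>c<m. h (T (axis \<iota> (int c)) (T ?e x)))"
          by (rule sum.reindex_bij_witness[of _ "\<lambda>c. int c + 1" "\<lambda>c. nat (c - 1)"])
            (auto simp: h_def sh_def T_T axis_add add_ac)
        then show ?thesis unfolding pw by (simp add: cor_def vol_on_def Eh sh_def)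
      qed
      then have "nrm (\<lambda>x. cor \<iota> {} n m k x - s k) = nrm (sh ?e ?g)" by simp
      also have "\<dots> = nrm ?g" by (rule nrm_sh[OF bdd_L2[OF bg]])
      also have "\<dots> \<le> \<epsilon>" using m by (intro L) simp
      finally show "nrm (\<lambda>x. cor \<iota> {} n m k x - s k) \<le> \<epsilon>" .
    qed simp
  next
    case (insert i J)
    have io: "i \<noteq> \<iota>" "\<iota> \<notin> J" using insert.prems(1) by auto
    have k0: "k $ i = 0" "k $ \<iota> = 0" using insert.prems(2) by auto
    define A where "A = 16 ^ (card J + 1) * K ^ 4"
    have A0: "0 < A" unfolding A_def using K_pos by simp
    define \<delta> where "\<delta> = \<epsilon>\<^sup>2 / 32"
    have \<delta>0: "0 < \<delta>" using insert.prems(3) by (simp add: \<delta>_def)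
    define \<theta> where "\<theta> = (\<delta> / (8 * sqrt A))\<^sup>2"
    have \<theta>0: "0 < \<theta>" unfolding \<theta>_def using \<delta>0 A0 by simp
    define Lb where "Lb = nat \<lceil>2 * A / \<theta>\<rceil> + 1"
    have Lb: "1 \<le> Lb" "A / Lb \<le> \<theta> / 2"
    proof -
      have "2 * A / \<theta> \<le> real Lb" unfolding Lb_def by linarith
      then show "A / Lb \<le> \<theta> / 2" using \<theta>0 by (simp add: Lb_def divide_le_eq field_simps)
    qed (simp add: Lb_def)
    have key1: "8 * sqrt A * sqrt (A / Lb + \<theta> / 2) \<le> \<delta>"
    proof -
      have "sqrt (A / Lb + \<theta> / 2) \<le> sqrt \<theta>" using add_right_mono[OF Lb(2), of "\<theta> / 2"] by (intro real_sqrt_le_mono) simp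
      also have "\<dots> = \<delta> / (8 * sqrt A)" unfolding \<theta>_def using \<delta>0 A0 by simp
      finally show ?thesis using A0 by (simp add: field_simps)
    qed
    \<comment> \<open>the covariances that the induction hypothesis must make small: the given one, and all nonzero shifts by less than \<open>Lb\<close>\<close>
    have "\<exists>L\<ge>1. \<forall>m\<ge>L. \<forall>n. (\<forall>j. 1 \<le> n $ j) \<and> (\<forall>j\<in>J. int L \<le> n $ j) \<longrightarrow>
        nrm (\<lambda>x. cor \<iota> J n m k x - s k) \<le> \<epsilon> / 2"
      by (rule insert.IH[OF io(2)]) (use insert.prems in auto)
    then obtain L0 where L0: "1 \<le> L0" "\<And>m n. L0 \<le> m \<Longrightarrow> (\<forall>j. 1 \<le> n $ j) \<and> (\<forall>j\<in>J. int L0 \<le> n $ j) \<Longrightarrow>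
        nrm (\<lambda>x. cor \<iota> J n m k x - s k) \<le> \<epsilon> / 2"
      by blast
    have "\<forall>t. \<exists>L\<ge>1. t \<noteq> 0 \<longrightarrow> (\<forall>m\<ge>L. \<forall>n. (\<forall>j. 1 \<le> n $ j) \<and> (\<forall>j\<in>J. int L \<le> n $ j) \<longrightarrow>
        nrm (\<lambda>x. cor \<iota> J n m (axis i t) x - s (axis i t)) \<le> sqrt (\<theta> / 2))"
    proof
      fix t :: int
      have "\<exists>L\<ge>1. \<forall>m\<ge>L. \<forall>n. (\<forall>j. 1 \<le> n $ j) \<and> (\<forall>j\<in>J. int L \<le> n $ j) \<longrightarrow>
          nrm (\<lambda>x. cor \<iota> J n m (axis i t) x - s (axis i t)) \<le> sqrt (\<theta> / 2)"
        using insert.hyps(2) io(1) \<theta>0 by (intro insert.IH[OF io(2)]) (auto simp: axis_nth')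
      then show "\<exists>L\<ge>1. t \<noteq> 0 \<longrightarrow> (\<forall>m\<ge>L. \<forall>n. (\<forall>j. 1 \<le> n $ j) \<and> (\<forall>j\<in>J. int L \<le> n $ j) \<longrightarrow>
          nrm (\<lambda>x. cor \<iota> J n m (axis i t) x - s (axis i t)) \<le> sqrt (\<theta> / 2))" by blast
    qed
    then obtain Lt :: "int \<Rightarrow> nat" where Lt: "\<And>t m n. t \<noteq> 0 \<Longrightarrow> Lt t \<le> m \<Longrightarrow> (\<forall>j. 1 \<le> n $ j) \<and> (\<forall>j\<in>J. int (Lt t) \<le> n $ j) \<Longrightarrow>
        nrm (\<lambda>x. cor \<iota> J n m (axis i t) x - s (axis i t)) \<le> sqrt (\<theta> / 2)" by metis
    define L1 where "L1 = (\<Sum>t\<in>{- int Lb..int Lb}. Lt t)"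
    have L1: "Lt t \<le> L1" if "\<bar>t\<bar> < int Lb" for t
      unfolding L1_def by (rule member_le_sum) (use that in auto)
    define Lv where "Lv = nat \<lceil>4 * A * Lb / \<delta>\<rceil>"
    define L where "L = L0 + L1 + Lv + Lb"
    show ?case
    proof (rule exI[of _ L], intro conjI allI impI)
      show "1 \<le> L" using L0(1) by (simp add: L_def)
      fix m n assume m: "L \<le> m" and n': "(\<forall>j. 1 \<le> n $ j) \<and> (\<forall>j\<in>insert i J. int L \<le> n $ j)"
      have n: "1 \<le> n $ j" for j using n' by blast
      have m1: "1 \<le> m" using m L0(1) by (simp add: L_def)
      define v where "v = nat (n $ i)"
      have Lv: "L \<le> v" using n' by (auto simp: v_def)
      have vn: "int v = n $ i" using n[of i] by (simp add: v_def)
      have v0: "0 < real v" using Lv L0(1) by (simp add: L_def)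
      define w where "w = vol_on J n"
      have w: "0 < w" unfolding w_def by (rule vol_on_pos) (rule n)
      define q where "q = 1 / sqrt (real m * w)"
      have q2: "q * q = 1 / (real m * w)" using m1 w by (simp add: q_def power2_eq_square[symmetric] power_divide)
      define Y where "Y = (\<lambda>k b c. (\<lambda>x. (1 / sqrt (real m * vol_on J n)) * sh (axis \<iota> c + axis i (int b + 1) + k) (S J n D) x))"
      have Y': "Y k b c = (\<lambda>x. q * sh (axis \<iota> c + axis i (int b + 1) + k) (S J n D) x)" for k b c
        by (simp add: Y_def q_def w_def)
      have bY: "bdd (Y k b c)" for k b c unfolding Y' by (intro bdd_intros bdd_sh bdd_S D_bdd)
      have C: "(\<integral>x. (cor \<iota> J n m (axis i t) x)\<^sup>2 \<partial>M) \<le> \<theta> / 2" if t: "t \<noteq> 0" "\<bar>t\<bar> < int Lb" for t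
      proof -
        have "axis i t \<noteq> (0 :: int ^ 'd)" using t(1) by (simp add: vec_eq_iff axis_nth')
        then have st: "s (axis i t) = 0" by (simp add: s_def)
        have "nrm (\<lambda>x. cor \<iota> J n m (axis i t) x - s (axis i t)) \<le> sqrt (\<theta> / 2)"
        proof (rule Lt[OF t(1)])
          show "Lt t \<le> m" using L1[OF t(2)] m by (simp add: L_def)
          show "(\<forall>j. 1 \<le> n $ j) \<and> (\<forall>j\<in>J. int (Lt t) \<le> n $ j)"
          proof (intro conjI ballI)
            fix j assume "j \<in> J"
            then have "int L \<le> n $ j" using n' by blast
            then show "int (Lt t) \<le> n $ j" using L1[OF t(2)] by (simp add: L_def)
          qed (use n in blast)
        qed
        then have "(nrm (cor \<iota> J n m (axis i t)))\<^sup>2 \<le> (sqrt (\<theta> / 2))\<^sup>2" unfolding st by (intro power_mono) auto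
        then show ?thesis using \<theta>0 by (simp add: nrm_sq)
      qed
      define P where "P k1 k2 x = (\<Sum>b<v. \<Sum>c\<in>{1..int m}. Y k2 b c x * (\<Sum>a<b. Y k1 a c x))" for k1 k2 x
      have bP: "bdd (P k1 k2)" for k1 k2 unfolding P_def by (intro bdd_intros bY)
      have Pb: "nrm (P k1 k2) \<le> real v * (\<epsilon> / 4)" if kk: "k1 $ i = 0" "k2 $ i = 0" for k1 k2
      proof (rule power2_le_imp_le)
        have "(nrm (P k1 k2))\<^sup>2 \<le> 8 * sqrt A * (real v)\<^sup>2 * sqrt (A / Lb + \<theta> / 2) + 4 * A * Lb * v"
          unfolding nrm_sq P_def
          by (rule off_diagonal_bound[OF io(1) insert.hyps(2) io(2) n m1 kk Lb(1) _ _ C A_def Y_def])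
            (use Lv \<theta>0 in \<open>auto simp: L_def\<close>)
        also have "\<dots> \<le> (real v)\<^sup>2 * \<delta> + (real v)\<^sup>2 * \<delta>"
        proof (rule add_mono)
          show "8 * sqrt A * (real v)\<^sup>2 * sqrt (A / Lb + \<theta> / 2) \<le> (real v)\<^sup>2 * \<delta>"
            using mult_left_mono[OF key1, of "(real v)\<^sup>2"] by (simp add: mult_ac)
          have "4 * A * Lb / \<delta> \<le> real v" using Lv unfolding L_def Lv_def by linarith
          then have "4 * A * Lb \<le> real v * \<delta>" using \<delta>0 by (simp add: divide_le_eq)
          from mult_right_mono[OF this, of "real v"]
          show "4 * A * Lb * v \<le> (real v)\<^sup>2 * \<delta>" by (simp add: power2_eq_square mult_ac)
        qed
        also have "\<dots> = (real v * (\<epsilon> / 4))\<^sup>2" by (simp add: \<delta>_def power2_eq_square)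
        finally show "(nrm (P k1 k2))\<^sup>2 \<le> (real v * (\<epsilon> / 4))\<^sup>2" .
      qed (use insert.prems in simp)
      define Q where "Q x = (\<Sum>b<v. sh (axis i (int b + 1)) (\<lambda>x. cor \<iota> J n m k x - s k) x)" for x
      have bQ: "bdd Q" unfolding Q_def by (intro bdd_intros bdd_sh cor_bdd)
      have Qb: "nrm Q \<le> real v * (\<epsilon> / 2)"
      proof -
        have "nrm Q \<le> (\<Sum>b<v. nrm (sh (axis i (int b + 1)) (\<lambda>x. cor \<iota> J n m k x - s k)))"
          unfolding Q_def by (intro nrm_sum bdd_L2 bdd_sh bdd_intros cor_bdd)
        also have "\<dots> = real v * nrm (\<lambda>x. cor \<iota> J n m k x - s k)"
          by (simp add: nrm_sh bdd_L2[OF bdd_diff[OF cor_bdd bdd_const]])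
        also have "\<dots> \<le> real v * (\<epsilon> / 2)"
        proof (intro mult_left_mono L0(2))
          show "L0 \<le> m" using m by (simp add: L_def)
          show "(\<forall>j. 1 \<le> n $ j) \<and> (\<forall>j\<in>J. int L0 \<le> n $ j)"
          proof (intro conjI ballI)
            fix j assume "j \<in> J"
            then have "int L \<le> n $ j" using n' by blast
            then show "int L0 \<le> n $ j" by (simp add: L_def)
          qed (use n in blast)
        qed simp
        finally show ?thesis .
      qed
      have decomp: "cor \<iota> (insert i J) n m k x - s k = (1 / real v) * (Q x + (P 0 k x + P k 0 x))" for x
      proof -
        have SY: "sqrt (1 / (real m * w)) * sh (axis \<iota> c + k') (S (insert i J) n D) x = (\<Sum>b<v. Y k' b c x)" for c k'
        proof -
          have "sh (axis \<iota> c + k') (S (insert i J) n D) x = (\<Sum>b<v. sh (axis \<iota> c + axis i (int b + 1) + k') (S J n D) x)"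
            unfolding S_insert[OF insert.hyps(2)] sh_def[of "axis \<iota> c + k'"]
            by (rule sum.reindex_bij_witness[of _ "\<lambda>b. int b + 1" "\<lambda>a. nat (a - 1)"])
              (auto simp: sh_def T_T vn[symmetric] add_ac)
          then show ?thesis by (simp add: Y' q_def sum_distrib_left real_sqrt_divide)
        qed
        have "(1 / (real m * w)) * (\<Sum>c\<in>{1..int m}. sh (axis \<iota> c) (S (insert i J) n D) x * sh (axis \<iota> c + k) (S (insert i J) n D) x)
          = (\<Sum>c\<in>{1..int m}. (sqrt (1 / (real m * w)) * sh (axis \<iota> c + 0) (S (insert i J) n D) x) * (sqrt (1 / (real m * w)) * sh (axis \<iota> c + k) (S (insert i J) n D) x))"
          using w by (simp add: sum_distrib_left real_sqrt_divide)
        also have "\<dots> = (\<Sum>c\<in>{1..int m}. (\<Sum>b<v. Y 0 b c x) * (\<Sum>b<v. Y k b c x))" by (simp only: SY)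
        also have "\<dots> = (\<Sum>c\<in>{1..int m}. (\<Sum>b<v. Y 0 b c x * Y k b c x) + ((\<Sum>b<v. Y k b c x * (\<Sum>a<b. Y 0 a c x)) + (\<Sum>b<v. Y 0 b c x * (\<Sum>a<b. Y k a c x))))"
        proof (intro sum.cong refl)
          fix c
          have "(\<Sum>b<N. p b) * (\<Sum>b<N. r b) = (\<Sum>b<N. p b * r b) + ((\<Sum>b<N. r b * (\<Sum>a<b. p a)) + (\<Sum>b<N. p b * (\<Sum>a<b. r a)))"
            for p r :: "nat \<Rightarrow> real" and N
            by (induction N) (simp_all add: algebra_simps)
          then show "(\<Sum>b<v. Y 0 b c x) * (\<Sum>b<v. Y k b c x) = (\<Sum>b<v. Y 0 b c x * Y k b c x) + ((\<Sum>b<v. Y k b c x * (\<Sum>a<b. Y 0 a c x)) + (\<Sum>b<v. Y 0 b c x * (\<Sum>a<b. Y k a c x)))" .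
        qed
        also have "\<dots> = (\<Sum>b<v. \<Sum>c\<in>{1..int m}. Y 0 b c x * Y k b c x) + (P 0 k x + P k 0 x)"
          unfolding P_def by (simp only: sum.distrib sum.swap[of _ "{1..int m}" "{..<v}"])
        also have "(\<Sum>b<v. \<Sum>c\<in>{1..int m}. Y 0 b c x * Y k b c x) = (\<Sum>b<v. sh (axis i (int b + 1)) (cor \<iota> J n m k) x)"
        proof (intro sum.cong refl)
          fix b
          have "(\<Sum>c\<in>{1..int m}. Y 0 b c x * Y k b c x) = (q * q) * (\<Sum>c\<in>{1..int m}. sh (axis \<iota> c + axis i (int b + 1)) (S J n D) x * sh (axis \<iota> c + axis i (int b + 1) + k) (S J n D) x)"
            by (simp add: Y' sum_distrib_left mult_ac)
          then show "(\<Sum>c\<in>{1..int m}. Y 0 b c x * Y k b c x) = sh (axis i (int b + 1)) (cor \<iota> J n m k) x"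
            unfolding cor_def q2 w_def sh_def by (simp only: T_T add_ac)
        qed
        also have "\<dots> = Q x + real v * s k" by (simp add: Q_def sh_def sum_subtractf)
        finally have "(1 / (real m * w)) * (\<Sum>c\<in>{1..int m}. sh (axis \<iota> c) (S (insert i J) n D) x * sh (axis \<iota> c + k) (S (insert i J) n D) x)
          = Q x + real v * s k + (P 0 k x + P k 0 x)" .
        moreover have "cor \<iota> (insert i J) n m k x = (1 / real v) * ((1 / (real m * w)) * (\<Sum>c\<in>{1..int m}. sh (axis \<iota> c) (S (insert i J) n D) x * sh (axis \<iota> c + k) (S (insert i J) n D) x))"
          unfolding cor_def vol_on_insert[OF insert.hyps(2)] w_def[symmetric] vn[symmetric] by (simp add: mult_ac)
        ultimately show ?thesis using v0 by (simp add: field_simps)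
      qed
      have "nrm (\<lambda>x. cor \<iota> (insert i J) n m k x - s k) = (1 / real v) * nrm (\<lambda>x. Q x + (P 0 k x + P k 0 x))"
        unfolding decomp nrm_cmult by simp
      also have "\<dots> \<le> (1 / real v) * (real v * (\<epsilon> / 2) + (real v * (\<epsilon> / 4) + real v * (\<epsilon> / 4)))"
      proof (rule mult_left_mono)
        have "nrm (\<lambda>x. Q x + (P 0 k x + P k 0 x)) \<le> nrm Q + nrm (\<lambda>x. P 0 k x + P k 0 x)"
          by (intro nrm_add bdd_L2 bdd_intros bQ bP)
        also have "nrm (\<lambda>x. P 0 k x + P k 0 x) \<le> nrm (P 0 k) + nrm (P k 0)"
          by (intro nrm_add bdd_L2 bP)
        also have "nrm Q + (nrm (P 0 k) + nrm (P k 0)) \<le> real v * (\<epsilon> / 2) + (real v * (\<epsilon> / 4) + real v * (\<epsilon> / 4))"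
          by (intro add_mono Qb Pb) (simp_all add: k0)
        finally show "nrm (\<lambda>x. Q x + (P 0 k x + P k 0 x)) \<le> real v * (\<epsilon> / 2) + (real v * (\<epsilon> / 4) + real v * (\<epsilon> / 4))"
          by simp
      qed (use v0 in simp)
      also have "\<dots> = \<epsilon>" using v0 by (simp add: field_simps)
      finally show "nrm (\<lambda>x. cor \<iota> (insert i J) n m k x - s k) \<le> \<epsilon>" .
    qed
  qed
  then show ?thesis by (simp add: s_def)
qed

end

section \<open>A central limit bound for martingale differences\<close>

text \<open>
  Up to the third order \<open>e\<^sup>i\<^sup>y = (1 + i y) exp (- y\<^sup>2 / 2)\<close>.
\<close>

lemma iexp_quotient:
  fixes y :: real
  shows "cmod (iexp y / (1 + \<i> * complex_of_real y) - complex_of_real (exp (- y\<^sup>2 / 2))) \<le> 2 * \<bar>y\<bar> ^ 3"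
    and "cmod (iexp y / (1 + \<i> * complex_of_real y)) \<le> 1"
    and "1 \<le> cmod (1 + \<i> * complex_of_real y)"
proof -
  let ?d = "1 + \<i> * complex_of_real y"
  define e where "e = exp (- y\<^sup>2 / 2)"
  have dsq: "(cmod ?d)\<^sup>2 = 1 + y\<^sup>2" by (simp add: cmod_power2)
  show d1: "1 \<le> cmod ?d"
    by (rule power2_le_imp_le) (simp_all add: dsq)
  have d0: "?d \<noteq> 0" using d1 by (metis norm_zero not_one_le_zero)
  show q1: "cmod (iexp y / ?d) \<le> 1" using d1 by (simp add: norm_divide divide_le_eq)
  have e01: "0 \<le> e" "e \<le> 1" by (simp_all add: e_def)
  show "cmod (iexp y / ?d - complex_of_real e) \<le> 2 * \<bar>y\<bar> ^ 3"
  proof (cases "\<bar>y\<bar> \<le> 1")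
    case False
    have "cmod (iexp y / ?d - complex_of_real e) \<le> cmod (iexp y / ?d) + cmod (complex_of_real e)"
      by (rule norm_triangle_ineq4)
    also have "\<dots> \<le> 1 + 1" using q1 e01 by (intro add_mono) auto
    also have "\<dots> \<le> 2 * \<bar>y\<bar> ^ 3" using one_le_power[of "\<bar>y\<bar>" 3] False by simp
    finally show ?thesis .
  next
    case True
    define z where "z = y\<^sup>2 / 2"
    have z0: "0 \<le> z" by (simp add: z_def)
    have ez: "\<bar>(1 - z) - e\<bar> \<le> z\<^sup>2"
    proof -
      have 1: "1 - z \<le> e" using exp_ge_add_one_self[of "- z"] by (simp add: e_def z_def)
      have "e * exp z = 1" unfolding e_def z_def by (simp flip: exp_add)
      moreover have "e * (1 + z) \<le> e * exp z" using e01 exp_ge_add_one_self[of z] by (intro mult_left_mono) auto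
      ultimately have "e * (1 + z) \<le> 1" by simp
      also have "1 \<le> (1 - z + z\<^sup>2) * (1 + z)"
      proof -
        have "(1 - z + z\<^sup>2) * (1 + z) = 1 + z ^ 3" by algebra
        then show ?thesis using z0 by simp
      qed
      finally have "e \<le> 1 - z + z\<^sup>2" using z0 by simp
      with 1 show ?thesis by simp
    qed
    have s2: "(\<Sum>k\<le>2. (\<i> * complex_of_real y) ^ k / fact k) = 1 + \<i> * complex_of_real y - complex_of_real z"
    proof -
      have "(\<Sum>k\<le>2. g k) = g 0 + g 1 + g 2" for g :: "nat \<Rightarrow> complex" by (simp add: numeral_2_eq_2)
      then show ?thesis by (simp add: power_mult_distrib z_def)
    qed
    have a1: "cmod (iexp y - (1 + \<i> * complex_of_real y - complex_of_real z)) \<le> \<bar>y\<bar> ^ 3 / 6"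
      using iexp_approx1[of y 2] unfolding s2 by (simp add: fact_numeral numeral_3_eq_3)
    have a2: "cmod (?d * complex_of_real ((1 - z) - e)) \<le> 2 * z\<^sup>2"
    proof -
      have "cmod ?d \<le> 1 + \<bar>y\<bar>" using norm_triangle_ineq[of 1 "\<i> * complex_of_real y"] by (simp add: norm_mult)
      then show ?thesis unfolding norm_mult norm_of_real using True ez by (intro mult_mono) auto
    qed
    have dec: "iexp y - ?d * complex_of_real e = (iexp y - (1 + \<i> * complex_of_real y - complex_of_real z))
        + \<i> * complex_of_real (y * z) + ?d * complex_of_real ((1 - z) - e)"
      by (simp add: algebra_simps)
    have "cmod (iexp y - ?d * complex_of_real e) \<le> \<bar>y\<bar> ^ 3 / 6 + \<bar>y * z\<bar> + 2 * z\<^sup>2"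
      unfolding dec using a1 a2
      by (intro order_trans[OF norm_triangle_ineq] add_mono) (auto simp: norm_mult)
    also have "\<dots> \<le> 2 * \<bar>y\<bar> ^ 3"
    proof -
      have "\<bar>y * z\<bar> = \<bar>y\<bar> ^ 3 / 2" by (simp add: z_def abs_mult power3_eq_cube power2_eq_square)
      moreover have "2 * z\<^sup>2 \<le> \<bar>y\<bar> ^ 3 / 2"
      proof -
        have "2 * z\<^sup>2 = \<bar>y\<bar> ^ 3 / 2 * \<bar>y\<bar>" by (simp add: z_def power2_eq_square power3_eq_cube)
        also have "\<dots> \<le> \<bar>y\<bar> ^ 3 / 2 * 1" using True by (intro mult_left_mono) auto
        finally show ?thesis by simp
      qed
      moreover have "0 \<le> \<bar>y\<bar> ^ 3" by simp
      ultimately show ?thesis by linarith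
    qed
    finally have 2: "cmod (iexp y - ?d * complex_of_real e) \<le> 2 * \<bar>y\<bar> ^ 3" .
    have "iexp y / ?d - complex_of_real e = (iexp y - ?d * complex_of_real e) / ?d" using d0 by (simp add: field_simps)
    then have "cmod (iexp y / ?d - complex_of_real e) = cmod (iexp y - ?d * complex_of_real e) / cmod ?d"
      by (simp only: norm_divide)
    also have "\<dots> \<le> cmod (iexp y - ?d * complex_of_real e) / 1" using d1 by (intro divide_left_mono) auto
    finally show ?thesis using 2 by simp
  qed
qed

lemma exp_minus_lipschitz: assumes "0 \<le> a" "0 \<le> (b::real)" shows "\<bar>exp (- a) - exp (- b)\<bar> \<le> \<bar>a - b\<bar>"
proof -
  have *: "exp (- a) - exp (- b) \<le> b - a" if "0 \<le> a" "a \<le> b" for a b :: real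
  proof -
    have "exp (- a) * (1 - (b - a)) \<le> exp (- a) * exp (- (b - a))"
    proof (rule mult_left_mono)
      show "1 - (b - a) \<le> exp (- (b - a))" using exp_ge_add_one_self[of "a - b"] by (simp add: algebra_simps)
    qed simp
    also have "\<dots> = exp (- b)" by (simp flip: exp_add)
    finally have "exp (- a) - exp (- b) \<le> exp (- a) * (b - a)" by (simp add: algebra_simps)
    also have "\<dots> \<le> 1 * (b - a)" using that by (intro mult_right_mono) auto
    finally show ?thesis by simp
  qed
  show ?thesis
  proof (cases "a \<le> b")
    case True
    then show ?thesis using *[OF assms(1) True] by simp
  next
    case False
    then show ?thesis using *[OF assms(2), of a] by simp
  qed
qed

lemma iexp_lipschitz: "cmod (iexp a - iexp b) \<le> \<bar>a - b\<bar>"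
proof -
  have "iexp a - iexp b = iexp b * (iexp (a - b) - 1)"
    by (simp add: right_diff_distrib exp_diff algebra_simps)
  then have "cmod (iexp a - iexp b) = cmod (iexp (a - b) - 1)" by (simp only: norm_mult) simp
  also have "\<dots> \<le> \<bar>a - b\<bar>" using iexp_approx1[of "a - b" 0] by simp
  finally show ?thesis .
qed

context prob_space begin

lemma integrable_bdd_complex:
  fixes f :: "'a \<Rightarrow> complex"
  assumes "f \<in> borel_measurable M" "\<And>x. cmod (f x) \<le> B" shows "integrable M f"
  by (rule integrable_const_bound[of _ B]) (use assms in auto)

lemma cmod_integral_le:
  fixes f :: "'a \<Rightarrow> complex"
  assumes "integrable M f" "integrable M g" "\<And>x. cmod (f x) \<le> g x"
  shows "cmod (\<integral>x. f x \<partial>M) \<le> (\<integral>x. g x \<partial>M)"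
  using order_trans[OF integral_norm_bound[of M f] integral_mono[OF integrable_norm[OF assms(1)] assms(2)]] assms(3)
  by blast

text \<open>
  McLeish's method.  With \<open>P = \<Prod> (1 + i t x\<^sub>a)\<close>, a martingale of mean one, \<open>exp (i t \<Sum> x\<^sub>a) / P\<close> is
  close to \<open>exp (- t\<^sup>2 s / 2)\<close> when \<open>\<Sum> x\<^sub>a\<^sup>2\<close> is close to \<open>s\<close>.  The increments are stopped once the sum of
  squares exceeds \<open>s + 1\<close>, which keeps \<open>P\<close> bounded in mean square and is unlikely to change anything.
\<close>

lemma martingale_clt_bound:
  fixes x :: "nat \<Rightarrow> 'a \<Rightarrow> real" and G :: "nat \<Rightarrow> 'a measure"
  assumes x: "\<And>a. bdd (x a)"
    and xG: "\<And>a b. b < a \<Longrightarrow> x b \<in> borel_measurable (G a)"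
    and orth: "\<And>a Z. a < N \<Longrightarrow> Z \<in> borel_measurable (G a) \<Longrightarrow> bdd Z \<Longrightarrow> (\<integral>\<omega>. Z \<omega> * x a \<omega> \<partial>M) = 0"
    and s: "0 \<le> s"
    and q1: "(\<integral>\<omega>. \<bar>(\<Sum>a<N. (x a \<omega>)\<^sup>2) - s\<bar> \<partial>M) \<le> q" and q3: "(\<integral>\<omega>. (\<Sum>a<N. \<bar>x a \<omega>\<bar> ^ 3) \<partial>M) \<le> q"
  shows "cmod ((\<integral>\<omega>. iexp (t * (\<Sum>a<N. x a \<omega>)) \<partial>M) - complex_of_real (exp (- t\<^sup>2 * s / 2)))
    \<le> 2 * q + sqrt (exp (t\<^sup>2 * (s + 1)) * (1 + t\<^sup>2 * (s + q))) * sqrt (2 * (2 * \<bar>t\<bar> ^ 3 * q + t\<^sup>2 / 2 * q))"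
proof -
  define v where "v n \<omega> = (\<Sum>a<n. (x a \<omega>)\<^sup>2)" for n \<omega>
  define J where "J a \<omega> = (if v a \<omega> \<le> s + 1 then 1 else 0 :: real)" for a \<omega>
  define y where "y a \<omega> = J a \<omega> * x a \<omega>" for a \<omega>
  define u where "u n \<omega> = (\<Sum>a<n. (y a \<omega>)\<^sup>2)" for n \<omega>
  define P where "P n \<omega> = (\<Prod>a<n. 1 + \<i> * complex_of_real (t * y a \<omega>))" for n \<omega>
  define w where "w = exp (- t\<^sup>2 * s / 2)"
  define r where "r \<omega> = 2 * \<bar>t\<bar> ^ 3 * (\<Sum>a<N. \<bar>x a \<omega>\<bar> ^ 3) + t\<^sup>2 / 2 * \<bar>v N \<omega> - s\<bar>" for \<omega>
  have xm [measurable]: "x a \<in> borel_measurable M" for a using x by (rule bdd_meas)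
  have vm [measurable]: "v n \<in> borel_measurable M" for n unfolding v_def by measurable
  have Jm [measurable]: "J a \<in> borel_measurable M" for a unfolding J_def by measurable
  have ym [measurable]: "y a \<in> borel_measurable M" for a unfolding y_def by measurable
  have Pm [measurable]: "P n \<in> borel_measurable M" for n unfolding P_def by measurable
  have bv: "bdd (v n)" for n unfolding v_def by (intro bdd_intros x)
  have bJ: "bdd (J a)" for a by (rule bdd_I[where K=1]) (auto simp: J_def)
  have by': "bdd (y a)" for a unfolding y_def by (intro bdd_intros x bJ)
  have J01: "J a \<omega> = 0 \<or> J a \<omega> = 1" for a \<omega> by (simp add: J_def)
  have ysq: "(y a \<omega>)\<^sup>2 \<le> (x a \<omega>)\<^sup>2" for a \<omega> using J01[of a \<omega>] by (auto simp: y_def)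
  have vmono: "v n \<omega> \<le> v m \<omega>" if "n \<le> m" for n m \<omega>
    unfolding v_def using that by (intro sum_mono2) auto
  have uv: "u n \<omega> \<le> v n \<omega>" for n \<omega> unfolding u_def v_def by (intro sum_mono ysq)
  have udich: "u n \<omega> = v n \<omega> \<or> s + 1 < u n \<omega>" for n \<omega>
  proof (induction n)
    case (Suc n)
    have uS: "u (Suc n) \<omega> = u n \<omega> + (y n \<omega>)\<^sup>2" and vS: "v (Suc n) \<omega> = v n \<omega> + (x n \<omega>)\<^sup>2" by (simp_all add: u_def v_def)
    show ?case
    proof (cases "s + 1 < u n \<omega>")
      case True
      then have "s + 1 < u n \<omega> + (y n \<omega>)\<^sup>2" using zero_le_power2[of "y n \<omega>"] by linarith
      then show ?thesis unfolding uS ..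
    next
      case False
      then have eq: "u n \<omega> = v n \<omega>" using Suc by simp
      with False have "J n \<omega> = 1" by (simp add: J_def)
      then show ?thesis unfolding uS vS eq by (simp add: y_def)
    qed
  qed (simp add: u_def v_def)
  have us: "\<bar>u N \<omega> - s\<bar> \<le> \<bar>v N \<omega> - s\<bar>" for \<omega> using udich[of N \<omega>] uv[of N \<omega>] by auto
  have same: "y a \<omega> = x a \<omega>" if "v N \<omega> \<le> s + 1" "a < N" for a \<omega>
    using that vmono[of a N \<omega>] by (simp add: y_def J_def)
  have Psq: "(cmod (P n \<omega>))\<^sup>2 = (\<Prod>a<n. 1 + t\<^sup>2 * (y a \<omega>)\<^sup>2)" for n \<omega>
    unfolding P_def prod_norm[symmetric] prod_power_distrib
    by (intro prod.cong refl) (simp add: cmod_power2 power_mult_distrib)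
  have Pexp: "(cmod (P n \<omega>))\<^sup>2 \<le> exp (t\<^sup>2 * v n \<omega>)" for n \<omega>
  proof -
    have "(\<Prod>a<n. 1 + t\<^sup>2 * (y a \<omega>)\<^sup>2) \<le> (\<Prod>a<n. exp (t\<^sup>2 * (x a \<omega>)\<^sup>2))"
    proof (rule prod_mono, intro conjI)
      fix a
      have "1 + t\<^sup>2 * (y a \<omega>)\<^sup>2 \<le> 1 + t\<^sup>2 * (x a \<omega>)\<^sup>2" using ysq[of a \<omega>] by (intro add_left_mono mult_left_mono) auto
      also have "\<dots> \<le> exp (t\<^sup>2 * (x a \<omega>)\<^sup>2)" by (rule exp_ge_add_one_self)
      finally show "1 + t\<^sup>2 * (y a \<omega>)\<^sup>2 \<le> exp (t\<^sup>2 * (x a \<omega>)\<^sup>2)" .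
    qed simp
    also have "\<dots> = exp (t\<^sup>2 * v n \<omega>)" by (simp add: v_def sum_distrib_left exp_sum)
    finally show ?thesis unfolding Psq .
  qed
  have Pbd: "(cmod (P n \<omega>))\<^sup>2 \<le> exp (t\<^sup>2 * (s + 1)) * (1 + t\<^sup>2 * v n \<omega>)" for n \<omega>
  proof (induction n)
    case 0
    have "1 \<le> exp (t\<^sup>2 * (s + 1))" using s by simp
    then show ?case by (simp add: P_def v_def)
  next
    case (Suc n)
    have PS: "(cmod (P (Suc n) \<omega>))\<^sup>2 = (cmod (P n \<omega>))\<^sup>2 * (1 + t\<^sup>2 * (y n \<omega>)\<^sup>2)" by (simp add: Psq)
    have vS: "v (Suc n) \<omega> = v n \<omega> + (x n \<omega>)\<^sup>2" by (simp add: v_def)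
    have v0: "0 \<le> v n \<omega>" unfolding v_def by (intro sum_nonneg) auto
    show ?case
    proof (cases "v n \<omega> \<le> s + 1")
      case True
      have "(cmod (P n \<omega>))\<^sup>2 * (1 + t\<^sup>2 * (y n \<omega>)\<^sup>2) \<le> exp (t\<^sup>2 * (s + 1)) * (1 + t\<^sup>2 * v (Suc n) \<omega>)"
      proof (rule mult_mono)
        have "exp (t\<^sup>2 * v n \<omega>) \<le> exp (t\<^sup>2 * (s + 1))" using True by (simp add: mult_left_mono)
        then show "(cmod (P n \<omega>))\<^sup>2 \<le> exp (t\<^sup>2 * (s + 1))" using Pexp[of n \<omega>] by linarith
        show "1 + t\<^sup>2 * (y n \<omega>)\<^sup>2 \<le> 1 + t\<^sup>2 * v (Suc n) \<omega>"
          using ysq[of n \<omega>] v0 unfolding vS by (intro add_left_mono mult_left_mono) auto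
      qed auto
      then show ?thesis unfolding PS .
    next
      case False
      then have "y n \<omega> = 0" by (simp add: y_def J_def)
      then have "(cmod (P (Suc n) \<omega>))\<^sup>2 \<le> exp (t\<^sup>2 * (s + 1)) * (1 + t\<^sup>2 * v n \<omega>)" using Suc unfolding PS by simp
      also have "\<dots> \<le> exp (t\<^sup>2 * (s + 1)) * (1 + t\<^sup>2 * v (Suc n) \<omega>)"
        unfolding vS by (intro mult_left_mono add_left_mono) auto
      finally show ?thesis .
    qed
  qed
  have Pbound: "\<exists>B. \<forall>\<omega>. cmod (P n \<omega>) \<le> B" for n
  proof -
    obtain B where B: "\<And>\<omega>. \<bar>v n \<omega>\<bar> \<le> B" using bv[of n] by (auto simp: bdd_def)
    have "(cmod (P n \<omega>))\<^sup>2 \<le> exp (t\<^sup>2 * B)" for \<omega>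
    proof -
      have "v n \<omega> \<le> B" using B[of \<omega>] by simp
      then have "exp (t\<^sup>2 * v n \<omega>) \<le> exp (t\<^sup>2 * B)" by (simp add: mult_left_mono)
      then show ?thesis using Pexp[of n \<omega>] by linarith
    qed
    then have "cmod (P n \<omega>) \<le> sqrt (exp (t\<^sup>2 * B))" for \<omega> by (intro real_le_rsqrt)
    then show ?thesis by blast
  qed
  have Pint: "integrable M (P n)" for n using Pbound[of n] integrable_bdd_complex[OF Pm] by blast
  have EP: "(\<integral>\<omega>. P n \<omega> \<partial>M) = 1" if "n \<le> N" for n
    using that
  proof (induction n)
    case (Suc n)
    have xGn: "x b \<in> borel_measurable (G n)" if "b < n" for b using xG[OF that] .
    have vG: "v a \<in> borel_measurable (G n)" if "a \<le> n" for a
      unfolding v_def using that xGn by (intro borel_measurable_sum borel_measurable_power) auto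
    have JG: "J a \<in> borel_measurable (G n)" if "a \<le> n" for a
    proof -
      note [measurable] = vG[OF that]
      show ?thesis unfolding J_def by measurable
    qed
    have yG: "y b \<in> borel_measurable (G n)" if "b < n" for b
      unfolding y_def using that xGn JG by (intro borel_measurable_times) auto
    have PG: "P n \<in> borel_measurable (G n)"
      unfolding P_def
    proof (intro borel_measurable_prod)
      fix a assume "a \<in> {..<n}"
      then have [measurable]: "y a \<in> borel_measurable (G n)" using yG by simp
      show "(\<lambda>\<omega>. 1 + \<i> * complex_of_real (t * y a \<omega>)) \<in> borel_measurable (G n)" by measurable
    qed
    define Z where "Z \<omega> = complex_of_real (J n \<omega>) * P n \<omega>" for \<omega>
    have [measurable]: "Z \<in> borel_measurable M" unfolding Z_def by measurable
    have ZG: "Z \<in> borel_measurable (G n)" unfolding Z_def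
      using JG[of n] PG by (intro borel_measurable_times borel_measurable_of_real) auto
    obtain B where B: "\<And>\<omega>. cmod (P n \<omega>) \<le> B" using Pbound[of n] by blast
    have ZB: "cmod (Z \<omega>) \<le> B" for \<omega>
      using B[of \<omega>] J01[of n \<omega>] order_trans[OF norm_ge_zero B[of \<omega>]] by (auto simp: Z_def norm_mult)
    obtain C where C: "\<And>\<omega>. \<bar>x n \<omega>\<bar> \<le> C" using x[of n] by (auto simp: bdd_def)
    have Zi: "integrable M (\<lambda>\<omega>. Z \<omega> * complex_of_real (x n \<omega>))"
    proof (rule integrable_bdd_complex[where B="B * C"])
      fix \<omega>
      show "cmod (Z \<omega> * complex_of_real (x n \<omega>)) \<le> B * C"
        unfolding norm_mult norm_of_real using ZB[of \<omega>] C[of \<omega>] norm_ge_zero[of "Z \<omega>"]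
        by (intro mult_mono) linarith+
    qed measurable
    have "(\<integral>\<omega>. Z \<omega> * complex_of_real (x n \<omega>) \<partial>M) = 0"
    proof (rule complex_eqI)
      have bz: "bdd (\<lambda>\<omega>. Re (Z \<omega>))" "bdd (\<lambda>\<omega>. Im (Z \<omega>))"
        using ZB by (auto intro!: bdd_I[where K=B] intro: order_trans[OF abs_Re_le_cmod] order_trans[OF abs_Im_le_cmod])
      have "Re (\<integral>\<omega>. Z \<omega> * complex_of_real (x n \<omega>) \<partial>M) = (\<integral>\<omega>. Re (Z \<omega>) * x n \<omega> \<partial>M)"
        using integral_Re[OF Zi] by simp
      also have "\<dots> = 0" using Suc.prems ZG by (intro orth bz) auto
      finally show "Re (\<integral>\<omega>. Z \<omega> * complex_of_real (x n \<omega>) \<partial>M) = Re 0" by simp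
      have "Im (\<integral>\<omega>. Z \<omega> * complex_of_real (x n \<omega>) \<partial>M) = (\<integral>\<omega>. Im (Z \<omega>) * x n \<omega> \<partial>M)"
        using integral_Im[OF Zi] by simp
      also have "\<dots> = 0" using Suc.prems ZG by (intro orth bz) auto
      finally show "Im (\<integral>\<omega>. Z \<omega> * complex_of_real (x n \<omega>) \<partial>M) = Im 0" by simp
    qed
    moreover have "P (Suc n) \<omega> = P n \<omega> + (\<i> * complex_of_real t) * (Z \<omega> * complex_of_real (x n \<omega>))" for \<omega>
      by (simp add: P_def Z_def y_def algebra_simps)
    ultimately show ?case using Suc Pint[of n] Zi by simp
  next
    case 0
    have "P 0 = (\<lambda>\<omega>. 1)" by (simp add: P_def fun_eq_iff)
    then show ?case by (simp add: prob_space)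
  qed
  define R where "R \<omega> = (\<Prod>a<N. iexp (t * y a \<omega>) / (1 + \<i> * complex_of_real (t * y a \<omega>)))" for \<omega>
  have [measurable]: "R \<in> borel_measurable M" unfolding R_def by measurable
  have RP: "P N \<omega> * R \<omega> = iexp (t * (\<Sum>a<N. y a \<omega>))" for \<omega>
  proof -
    have nz: "1 + \<i> * complex_of_real z \<noteq> 0" for z using iexp_quotient(3)[of z] by auto
    have canc: "p \<noteq> 0 \<Longrightarrow> p * (p' / p) = p'" for p p' :: complex by simp
    have "P N \<omega> * R \<omega> = (\<Prod>a<N. iexp (t * y a \<omega>))"
      unfolding P_def R_def prod.distrib[symmetric] by (intro prod.cong refl canc nz)
    also have "\<dots> = iexp (t * (\<Sum>a<N. y a \<omega>))" by (simp add: exp_sum[symmetric] sum_distrib_left)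
    finally show ?thesis .
  qed
  have R1: "cmod (R \<omega>) \<le> 1" for \<omega>
  proof -
    have "cmod (R \<omega>) = (\<Prod>a<N. cmod (iexp (t * y a \<omega>) / (1 + \<i> * complex_of_real (t * y a \<omega>))))"
      unfolding R_def by (simp only: prod_norm)
    also have "\<dots> \<le> 1" by (intro prod_le_1 conjI norm_ge_zero iexp_quotient(2))
    finally show ?thesis .
  qed
  have w01: "0 \<le> w" "w \<le> 1" using s by (simp_all add: w_def)
  have Rw: "cmod (R \<omega> - complex_of_real w) \<le> r \<omega>" for \<omega>
  proof -
    let ?e = "\<lambda>a. complex_of_real (exp (- (t * y a \<omega>)\<^sup>2 / 2))"
    have "cmod (R \<omega> - (\<Prod>a<N. ?e a)) \<le> (\<Sum>a<N. cmod (iexp (t * y a \<omega>) / (1 + \<i> * complex_of_real (t * y a \<omega>)) - ?e a))"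
      unfolding R_def
    proof (rule norm_prod_diff)
      fix a
      show "cmod (iexp (t * y a \<omega>) / (1 + \<i> * complex_of_real (t * y a \<omega>))) \<le> 1" by (rule iexp_quotient(2))
      show "cmod (?e a) \<le> 1" by (simp only: norm_of_real) simp
    qed
    also have "\<dots> \<le> (\<Sum>a<N. 2 * \<bar>t * y a \<omega>\<bar> ^ 3)" by (intro sum_mono iexp_quotient(1))
    also have "\<dots> \<le> (\<Sum>a<N. 2 * \<bar>t\<bar> ^ 3 * \<bar>x a \<omega>\<bar> ^ 3)"
    proof (rule sum_mono)
      fix a
      have "\<bar>y a \<omega>\<bar> \<le> \<bar>x a \<omega>\<bar>" using J01[of a \<omega>] by (auto simp: y_def)
      then have "\<bar>t * y a \<omega>\<bar> ^ 3 \<le> (\<bar>t\<bar> * \<bar>x a \<omega>\<bar>) ^ 3" unfolding abs_mult by (intro power_mono mult_left_mono) auto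
      then show "2 * \<bar>t * y a \<omega>\<bar> ^ 3 \<le> 2 * \<bar>t\<bar> ^ 3 * \<bar>x a \<omega>\<bar> ^ 3" by (simp add: power_mult_distrib)
    qed
    also have "\<dots> = 2 * \<bar>t\<bar> ^ 3 * (\<Sum>a<N. \<bar>x a \<omega>\<bar> ^ 3)" by (simp add: sum_distrib_left)
    finally have 1: "cmod (R \<omega> - (\<Prod>a<N. ?e a)) \<le> 2 * \<bar>t\<bar> ^ 3 * (\<Sum>a<N. \<bar>x a \<omega>\<bar> ^ 3)" .
    have pe: "(\<Prod>a<N. ?e a) = complex_of_real (exp (- (t\<^sup>2 * u N \<omega> / 2)))"
    proof -
      have "(\<Prod>a<N. exp (- (t * y a \<omega>)\<^sup>2 / 2)) = exp (\<Sum>a<N. - (t * y a \<omega>)\<^sup>2 / 2)" by (rule exp_sum[symmetric]) simp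
      also have "(\<Sum>a<N. - (t * y a \<omega>)\<^sup>2 / 2) = - (t\<^sup>2 * u N \<omega> / 2)"
        by (simp add: u_def sum_distrib_left sum_negf sum_divide_distrib power_mult_distrib)
      finally show ?thesis by (simp only: of_real_prod[symmetric])
    qed
    have u0: "0 \<le> u N \<omega>" unfolding u_def by (intro sum_nonneg) auto
    have "cmod ((\<Prod>a<N. ?e a) - complex_of_real w) = \<bar>exp (- (t\<^sup>2 * u N \<omega> / 2)) - exp (- (t\<^sup>2 * s / 2))\<bar>"
      unfolding pe w_def by (simp only: of_real_diff[symmetric] norm_of_real) simp
    also have "\<dots> \<le> \<bar>t\<^sup>2 * u N \<omega> / 2 - t\<^sup>2 * s / 2\<bar>" using u0 s by (intro exp_minus_lipschitz) auto
    also have "\<dots> = t\<^sup>2 / 2 * \<bar>u N \<omega> - s\<bar>"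
    proof -
      have "t\<^sup>2 * u N \<omega> / 2 - t\<^sup>2 * s / 2 = t\<^sup>2 / 2 * (u N \<omega> - s)" by (simp add: algebra_simps)
      then show ?thesis by (simp only: abs_mult) simp
    qed
    also have "\<dots> \<le> t\<^sup>2 / 2 * \<bar>v N \<omega> - s\<bar>" by (intro mult_left_mono us) simp
    finally have 2: "cmod ((\<Prod>a<N. ?e a) - complex_of_real w) \<le> t\<^sup>2 / 2 * \<bar>v N \<omega> - s\<bar>" .
    have "R \<omega> - complex_of_real w = (R \<omega> - (\<Prod>a<N. ?e a)) + ((\<Prod>a<N. ?e a) - complex_of_real w)" by simp
    then have "cmod (R \<omega> - complex_of_real w) \<le> cmod (R \<omega> - (\<Prod>a<N. ?e a)) + cmod ((\<Prod>a<N. ?e a) - complex_of_real w)"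
      by (metis norm_triangle_ineq)
    then show ?thesis using 1 2 unfolding r_def by linarith
  qed
  have r2: "(cmod (R \<omega> - complex_of_real w))\<^sup>2 \<le> 2 * r \<omega>" for \<omega>
  proof -
    have c2: "cmod (R \<omega> - complex_of_real w) \<le> 2"
      using norm_triangle_ineq4[of "R \<omega>" "complex_of_real w"] R1[of \<omega>] w01 by simp
    have "cmod (R \<omega> - complex_of_real w) * cmod (R \<omega> - complex_of_real w) \<le> 2 * r \<omega>"
      by (intro mult_mono c2 Rw) auto
    then show ?thesis by (simp add: power2_eq_square)
  qed
  have q1': "(\<integral>\<omega>. \<bar>v N \<omega> - s\<bar> \<partial>M) \<le> q" using q1 by (simp add: v_def)
  have babs: "bdd f \<Longrightarrow> bdd (\<lambda>\<omega>. \<bar>f \<omega>\<bar>)" for f by (auto simp: bdd_def)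
  have bd: "bdd (\<lambda>\<omega>. \<bar>v N \<omega> - s\<bar>)" by (intro babs bdd_intros bv)
  have b3: "bdd (\<lambda>\<omega>. \<Sum>a<N. \<bar>x a \<omega>\<bar> ^ 3)" by (intro bdd_intros babs x)
  have br: "bdd r" unfolding r_def by (intro bdd_intros bd b3)
  have Er: "(\<integral>\<omega>. r \<omega> \<partial>M) \<le> 2 * \<bar>t\<bar> ^ 3 * q + t\<^sup>2 / 2 * q"
  proof -
    have "(\<integral>\<omega>. r \<omega> \<partial>M) = 2 * \<bar>t\<bar> ^ 3 * (\<integral>\<omega>. (\<Sum>a<N. \<bar>x a \<omega>\<bar> ^ 3) \<partial>M) + t\<^sup>2 / 2 * (\<integral>\<omega>. \<bar>v N \<omega> - s\<bar> \<partial>M)"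
      unfolding r_def
      by (subst Bochner_Integration.integral_add[OF bdd_integrable[OF bdd_cmult[OF b3]] bdd_integrable[OF bdd_cmult[OF bd]]])
        (simp only: integral_mult_right_zero)
    also have "\<dots> \<le> 2 * \<bar>t\<bar> ^ 3 * q + t\<^sup>2 / 2 * q" by (intro add_mono mult_left_mono q1' q3) auto
    finally show ?thesis .
  qed
  have Ev: "(\<integral>\<omega>. v N \<omega> \<partial>M) \<le> s + q"
  proof -
    have "(\<integral>\<omega>. v N \<omega> \<partial>M) \<le> (\<integral>\<omega>. s + \<bar>v N \<omega> - s\<bar> \<partial>M)"
      by (rule integral_mono) (auto intro!: bdd_integrable bdd_intros bv bd)
    also have "\<dots> = s + (\<integral>\<omega>. \<bar>v N \<omega> - s\<bar> \<partial>M)" using bdd_integrable[OF bd] by (simp add: prob_space)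
    finally show ?thesis using q1' by linarith
  qed
  let ?p = "\<lambda>\<omega>. cmod (P N \<omega>)" and ?q = "\<lambda>\<omega>. cmod (R \<omega> - complex_of_real w)"
  have bp: "bdd ?p" using Pbound[of N] by (auto simp: bdd_def)
  have bq: "bdd ?q"
  proof (rule bdd_I[where K=2])
    fix \<omega>
    show "\<bar>?q \<omega>\<bar> \<le> 2" using norm_triangle_ineq4[of "R \<omega>" "complex_of_real w"] R1[of \<omega>] w01 by simp
  qed measurable
  have np: "nrm ?p \<le> sqrt (exp (t\<^sup>2 * (s + 1)) * (1 + t\<^sup>2 * (s + q)))"
  proof (rule real_le_rsqrt)
    have "(nrm ?p)\<^sup>2 \<le> (\<integral>\<omega>. exp (t\<^sup>2 * (s + 1)) * (1 + t\<^sup>2 * v N \<omega>) \<partial>M)"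
      unfolding nrm_sq by (rule integral_mono[OF _ _ Pbd]) (intro bdd_integrable bdd_intros bp bv)+
    also have "\<dots> = exp (t\<^sup>2 * (s + 1)) * (1 + t\<^sup>2 * (\<integral>\<omega>. v N \<omega> \<partial>M))"
      using bdd_integrable[OF bv[of N]] by (simp add: prob_space)
    also have "\<dots> \<le> exp (t\<^sup>2 * (s + 1)) * (1 + t\<^sup>2 * (s + q))"
      using Ev by (intro mult_left_mono add_left_mono) auto
    finally show "(nrm ?p)\<^sup>2 \<le> exp (t\<^sup>2 * (s + 1)) * (1 + t\<^sup>2 * (s + q))" .
  qed
  have nq: "nrm ?q \<le> sqrt (2 * (2 * \<bar>t\<bar> ^ 3 * q + t\<^sup>2 / 2 * q))"
  proof (rule real_le_rsqrt)
    have "(nrm ?q)\<^sup>2 \<le> (\<integral>\<omega>. 2 * r \<omega> \<partial>M)"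
      unfolding nrm_sq by (rule integral_mono[OF _ _ r2]) (intro bdd_integrable bdd_intros bq br)+
    also have "\<dots> \<le> 2 * (2 * \<bar>t\<bar> ^ 3 * q + t\<^sup>2 / 2 * q)" using Er by simp
    finally show "(nrm ?q)\<^sup>2 \<le> 2 * (2 * \<bar>t\<bar> ^ 3 * q + t\<^sup>2 / 2 * q)" .
  qed
  have iX: "integrable M (\<lambda>\<omega>. iexp (t * (\<Sum>a<N. x a \<omega>)))" by (rule integrable_bdd_complex[where B=1]) auto
  have iY: "integrable M (\<lambda>\<omega>. iexp (t * (\<Sum>a<N. y a \<omega>)))" by (rule integrable_bdd_complex[where B=1]) auto
  have 1: "cmod ((\<integral>\<omega>. iexp (t * (\<Sum>a<N. x a \<omega>)) \<partial>M) - (\<integral>\<omega>. iexp (t * (\<Sum>a<N. y a \<omega>)) \<partial>M)) \<le> 2 * q"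
  proof -
    have "cmod ((\<integral>\<omega>. iexp (t * (\<Sum>a<N. x a \<omega>)) \<partial>M) - (\<integral>\<omega>. iexp (t * (\<Sum>a<N. y a \<omega>)) \<partial>M))
      = cmod (\<integral>\<omega>. iexp (t * (\<Sum>a<N. x a \<omega>)) - iexp (t * (\<Sum>a<N. y a \<omega>)) \<partial>M)"
      by (simp only: Bochner_Integration.integral_diff[OF iX iY])
    also have "\<dots> \<le> (\<integral>\<omega>. 2 * \<bar>v N \<omega> - s\<bar> \<partial>M)"
    proof (rule cmod_integral_le)
      show "integrable M (\<lambda>\<omega>. iexp (t * (\<Sum>a<N. x a \<omega>)) - iexp (t * (\<Sum>a<N. y a \<omega>)))" using iX iY by simp
      show "integrable M (\<lambda>\<omega>. 2 * \<bar>v N \<omega> - s\<bar>)" by (intro bdd_integrable bdd_intros bd)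
      fix \<omega>
      show "cmod (iexp (t * (\<Sum>a<N. x a \<omega>)) - iexp (t * (\<Sum>a<N. y a \<omega>))) \<le> 2 * \<bar>v N \<omega> - s\<bar>"
      proof (cases "v N \<omega> \<le> s + 1")
        case True
        then have "(\<Sum>a<N. x a \<omega>) = (\<Sum>a<N. y a \<omega>)" using same by (intro sum.cong) auto
        then show ?thesis by simp
      next
        case False
        have "cmod (iexp (t * (\<Sum>a<N. x a \<omega>)) - iexp (t * (\<Sum>a<N. y a \<omega>))) \<le> 2"
          using norm_triangle_ineq4[of "iexp (t * (\<Sum>a<N. x a \<omega>))" "iexp (t * (\<Sum>a<N. y a \<omega>))"] by simp
        also have "2 \<le> 2 * \<bar>v N \<omega> - s\<bar>" using False by (simp add: abs_if)
        finally show ?thesis .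
      qed
    qed
    also have "\<dots> \<le> 2 * q" using q1' by simp
    finally show ?thesis .
  qed
  have 2: "cmod ((\<integral>\<omega>. iexp (t * (\<Sum>a<N. y a \<omega>)) \<partial>M) - complex_of_real w) \<le> nrm ?p * nrm ?q"
  proof -
    have "(\<integral>\<omega>. iexp (t * (\<Sum>a<N. y a \<omega>)) \<partial>M) - complex_of_real w
      = (\<integral>\<omega>. iexp (t * (\<Sum>a<N. y a \<omega>)) - complex_of_real w * P N \<omega> \<partial>M)"
      using iY Pint[of N] EP[of N] by simp
    also have "\<dots> = (\<integral>\<omega>. P N \<omega> * (R \<omega> - complex_of_real w) \<partial>M)"
      by (intro Bochner_Integration.integral_cong refl) (simp only: RP[symmetric] right_diff_distrib mult.commute[of "complex_of_real w"])
    also have "cmod \<dots> \<le> (\<integral>\<omega>. ?p \<omega> * ?q \<omega> \<partial>M)"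
      by (rule order_trans[OF integral_norm_bound]) (simp add: norm_mult)
    also have "\<dots> \<le> nrm ?p * nrm ?q" by (intro L2_CS bdd_L2 bp bq)
    finally show ?thesis .
  qed
  have "nrm ?p * nrm ?q \<le> sqrt (exp (t\<^sup>2 * (s + 1)) * (1 + t\<^sup>2 * (s + q))) * sqrt (2 * (2 * \<bar>t\<bar> ^ 3 * q + t\<^sup>2 / 2 * q))"
    by (intro mult_mono np nq order_trans[OF nrm_nonneg np]) simp
  moreover have "cmod (a - c) \<le> cmod (a - b) + cmod (b - c)" for a b c :: complex
    using norm_triangle_ineq[of "a - b" "b - c"] by simp
  ultimately show ?thesis
    using 1 2 unfolding w_def by (meson add_mono order_trans)
qed

end

section \<open>The central limit theorem along a commuting filtration\<close>

lemma eventually_min_at_top: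
  "eventually P (min_at_top :: (int ^ 'd::finite) filter) \<longleftrightarrow> (\<exists>L. \<forall>n. (\<forall>j. L \<le> n $ j) \<longrightarrow> P n)"
  unfolding min_at_top_def eventually_filtercomap_at_top_linorder by (simp add: Min_ge_iff)

context bounded_orthomartingale begin

text \<open>
  The slices orthogonal to \<open>\<iota>\<close> are martingale differences along \<open>\<iota>\<close>.  Their squares are controlled by
  \<open>slice_covariance\<close> for all directions but \<open>\<iota>\<close>, and the sum of their third absolute moments is of order
  \<open>1 / sqrt N\<close>, by the fourth moment bound.
\<close>

theorem orthomartingale_clt:
  assumes erg: "\<And>B. B \<in> sets M \<Longrightarrow> T (axis \<iota> 1) -` B = B \<Longrightarrow> prob B = 0 \<or> prob B = 1"
    and \<epsilon>: "0 < \<epsilon>"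
  shows "\<forall>\<^sub>F n in min_at_top. cmod ((\<integral>x. iexp (t * (S UNIV n D x / sqrt (vol n))) \<partial>M)
    - complex_of_real (exp (- t\<^sup>2 * (nrm D)\<^sup>2 / 2))) \<le> \<epsilon>"
proof -
  define s where "s = (nrm D)\<^sup>2"
  have s0: "0 \<le> s" by (simp add: s_def)
  define B where "B q = 2 * q + sqrt (exp (t\<^sup>2 * (s + 1)) * (1 + t\<^sup>2 * (s + q))) * sqrt (2 * (2 * \<bar>t\<bar> ^ 3 * q + t\<^sup>2 / 2 * q))" for q
  have "(B \<longlongrightarrow> 2 * 0 + sqrt (exp (t\<^sup>2 * (s + 1)) * (1 + t\<^sup>2 * (s + 0))) * sqrt (2 * (2 * \<bar>t\<bar> ^ 3 * 0 + t\<^sup>2 / 2 * 0))) (at_right 0)"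
    unfolding B_def by (intro tendsto_intros)
  then have "(B \<longlongrightarrow> 0) (at_right 0)" by simp
  then have "\<forall>\<^sub>F q in at_right 0. B q < \<epsilon>" using \<epsilon> by (rule order_tendstoD(2))
  then obtain b where b: "0 < b" "\<And>q. 0 < q \<Longrightarrow> q < b \<Longrightarrow> B q < \<epsilon>"
    unfolding eventually_at_right_field by auto
  define q where "q = b / 2"
  have q: "0 < q" "B q < \<epsilon>" using b by (auto simp: q_def)
  define J where "J = (UNIV - {\<iota>} :: 'd set)"
  have iJ: "\<iota> \<notin> J" "insert \<iota> J = UNIV" by (auto simp: J_def)
  have "\<exists>L\<ge>1. \<forall>m\<ge>L. \<forall>n. (\<forall>j. 1 \<le> n $ j) \<and> (\<forall>j\<in>J. int L \<le> n $ j) \<longrightarrow>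
      nrm (\<lambda>x. cor \<iota> J n m 0 x - (if (0 :: int ^ 'd) = 0 then (nrm D)\<^sup>2 else 0)) \<le> q"
    by (rule slice_covariance[OF erg iJ(1) _ q(1)]) auto
  then obtain L1 where L1: "1 \<le> L1" "\<And>m n. L1 \<le> m \<Longrightarrow> (\<forall>j. 1 \<le> n $ j) \<and> (\<forall>j\<in>J. int L1 \<le> n $ j) \<Longrightarrow>
      nrm (\<lambda>x. cor \<iota> J n m 0 x - s) \<le> q"
    by (auto simp: s_def)
  define C where "C = 4 ^ card J * K\<^sup>2"
  have C0: "0 \<le> C" by (simp add: C_def)
  define L2 where "L2 = nat \<lceil>(sqrt C * C / q)\<^sup>2\<rceil>"
  show ?thesis unfolding eventually_min_at_top
  proof (rule exI[of _ "int (L1 + L2)"], intro allI impI)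
    fix n :: "int ^ 'd" assume n: "\<forall>j. int (L1 + L2) \<le> n $ j"
    have n1: "1 \<le> n $ j" for j using n[rule_format, of j] L1(1) by simp
    have n0: "0 \<le> n $ j" for j using n1[of j] by simp
    define N where "N = nat (n $ \<iota>)"
    have Nn: "int N = n $ \<iota>" using n1[of \<iota>] by (simp add: N_def)
    have NL: "L1 \<le> N" "L2 \<le> N" using n[rule_format, of \<iota>] unfolding Nn[symmetric] by simp_all
    have N0: "0 < real N" using NL L1(1) by simp
    define w where "w = vol_on J n"
    have w: "0 < w" unfolding w_def by (rule vol_on_pos) (rule n1)
    have vol: "vol n = real N * w"
      using vol_on_insert[OF iJ(1), of n] by (simp add: iJ(2) vol_UNIV w_def Nn[symmetric])
    define Y where "Y = S J n D"
    have bY: "bdd Y" unfolding Y_def by (rule bdd_S[OF D_bdd])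
    define x where "x c = (\<lambda>\<omega>. (1 / sqrt (vol n)) * sh (axis \<iota> (int c + 1)) Y \<omega>)" for c
    have bx: "bdd (x c)" for c unfolding x_def by (intro bdd_intros bdd_sh bY)
    have v0: "0 < vol n" unfolding vol using N0 w by simp
    have r2: "(1 / sqrt (vol n))\<^sup>2 = 1 / (real N * w)" using v0 by (simp add: power_divide vol)
    have sumx: "(\<Sum>c<N. x c \<omega>) = S UNIV n D \<omega> / sqrt (vol n)" for \<omega>
    proof -
      have "S UNIV n D \<omega> = (\<Sum>c<N. sh (axis \<iota> (int c + 1)) Y \<omega>)"
        unfolding iJ(2)[symmetric] S_insert[OF iJ(1)] Y_def
        by (rule sum.reindex_bij_witness[of _ "\<lambda>c. int c + 1" "\<lambda>c. nat (c - 1)"])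
          (auto simp: Nn[symmetric])
      then show ?thesis by (simp add: x_def sum_divide_distrib)
    qed
    have sumx2: "(\<Sum>c<N. (x c \<omega>)\<^sup>2) = cor \<iota> J n N 0 \<omega>" for \<omega>
    proof -
      have "(\<Sum>c<N. (x c \<omega>)\<^sup>2) = (1 / (real N * w)) * (\<Sum>c<N. (sh (axis \<iota> (int c + 1)) Y \<omega>)\<^sup>2)"
        unfolding x_def power_mult_distrib r2 by (simp only: sum_distrib_left)
      also have "(\<Sum>c<N. (sh (axis \<iota> (int c + 1)) Y \<omega>)\<^sup>2) = (\<Sum>c\<in>{1..int N}. sh (axis \<iota> c) Y \<omega> * sh (axis \<iota> c + 0) Y \<omega>)"
        by (rule sum.reindex_bij_witness[of _ "\<lambda>c. nat (c - 1)" "\<lambda>c. int c + 1"]) (auto simp: power2_eq_square)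
      finally show ?thesis by (simp add: cor_def w_def Y_def)
    qed
    have "cmod ((\<integral>\<omega>. iexp (t * (\<Sum>a<N. x a \<omega>)) \<partial>M) - complex_of_real (exp (- t\<^sup>2 * s / 2))) \<le> B q"
      unfolding B_def
    proof (rule martingale_clt_bound[OF bx, where G="\<lambda>a. F (idx \<iota> (int a) n)"])
      show "x b \<in> borel_measurable (F (idx \<iota> (int a) n))" if "b < a" for a b
        unfolding x_def Y_def
      proof (intro borel_measurable_times borel_measurable_const slice_meas)
        fix h assume "h \<in> Box J n"
        then have h: "if j \<in> J then 1 \<le> h $ j \<and> h $ j \<le> n $ j else h $ j = 0" for j by (simp add: Box_def)
        show "axis \<iota> (int b + 1) + h \<le> idx \<iota> (int a) n" unfolding less_eq_vec_def
        proof
          fix j show "(axis \<iota> (int b + 1) + h) $ j \<le> idx \<iota> (int a) n $ j"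
            using h[of j] n0[of j] iJ(1) that by (auto simp: axis_nth' split: if_splits)
        qed
      qed
      show "(\<integral>\<omega>. Z \<omega> * x a \<omega> \<partial>M) = 0" if "a < N" and Z: "Z \<in> borel_measurable (F (idx \<iota> (int a) n))" "bdd Z" for a Z
      proof -
        have "(\<integral>\<omega>. Z \<omega> * sh (axis \<iota> (int a + 1)) (S J n D) \<omega> \<partial>M) = 0"
        proof (rule slice_orthogonal[OF Z(2,1), where i=\<iota>])
          fix h assume "h \<in> Box J n"
          then have "h $ \<iota> = 0" using iJ(1) by (auto simp: Box_def)
          then show "idx \<iota> (int a) n $ \<iota> < (axis \<iota> (int a + 1) + h) $ \<iota>" by (simp add: axis_nth')
        qed
        then have "(\<integral>\<omega>. (1 / sqrt (vol n)) * (Z \<omega> * sh (axis \<iota> (int a + 1)) (S J n D) \<omega>) \<partial>M) = 0"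
          by (simp only: integral_mult_right_zero)
        then show ?thesis by (simp add: x_def Y_def mult_ac)
      qed
      show "0 \<le> s" by (rule s0)
      show "(\<integral>\<omega>. \<bar>(\<Sum>a<N. (x a \<omega>)\<^sup>2) - s\<bar> \<partial>M) \<le> q"
      proof -
        have "(\<integral>\<omega>. \<bar>cor \<iota> J n N 0 \<omega> - s\<bar> \<partial>M) \<le> nrm (\<lambda>\<omega>. cor \<iota> J n N 0 \<omega> - s)"
          by (intro integral_abs_le_nrm bdd_L2 bdd_intros cor_bdd)
        also have "\<dots> \<le> q"
          using n1 n NL by (intro L1(2)) (auto intro: order_trans[of _ "int (L1 + L2)"])
        finally show ?thesis unfolding sumx2 .
      qed
      show "(\<integral>\<omega>. (\<Sum>a<N. \<bar>x a \<omega>\<bar> ^ 3) \<partial>M) \<le> q"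
      proof -
        have x2: "nrm (\<lambda>\<omega>. (x a \<omega>)\<^sup>2) \<le> C / real N" for a
        proof (rule power2_le_imp_le)
          have "(nrm (\<lambda>\<omega>. (x a \<omega>)\<^sup>2))\<^sup>2 = (\<integral>\<omega>. ((1 / sqrt (vol n))\<^sup>2)\<^sup>2 * (sh (axis \<iota> (int a + 1)) Y \<omega>) ^ 4 \<partial>M)"
            unfolding nrm_sq x_def power_mult_distrib by (simp add: power_mult[symmetric])
          also have "\<dots> = (1 / (real N * w))\<^sup>2 * (\<integral>\<omega>. (Y \<omega>) ^ 4 \<partial>M)"
            using integral_T[OF bdd_meas[OF bdd_power[OF bY, where p=4]]] by (simp add: r2 sh_def)
          also have "\<dots> \<le> (1 / (real N * w))\<^sup>2 * (16 ^ card J * w\<^sup>2 * K ^ 4)"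
            unfolding Y_def w_def by (intro mult_left_mono fourth_moment_box n0) auto
          also have "\<dots> = (C / real N)\<^sup>2"
          proof -
            have "(16::real) ^ card J = (4 ^ card J)\<^sup>2" by (simp add: power2_eq_square flip: power_mult_distrib)
            moreover have "K ^ 4 = (K\<^sup>2)\<^sup>2" by simp
            ultimately show ?thesis using w by (simp add: C_def power_divide power_mult_distrib)
          qed
          finally show "(nrm (\<lambda>\<omega>. (x a \<omega>)\<^sup>2))\<^sup>2 \<le> (C / real N)\<^sup>2" .
        qed (use C0 in simp)
        have x1: "nrm (x a) \<le> sqrt (C / real N)" for a
        proof (rule real_le_rsqrt)
          have "(nrm (x a))\<^sup>2 = (\<integral>\<omega>. \<bar>(x a \<omega>)\<^sup>2\<bar> \<partial>M)" by (simp add: nrm_sq)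
          also have "\<dots> \<le> nrm (\<lambda>\<omega>. (x a \<omega>)\<^sup>2)" by (intro integral_abs_le_nrm bdd_L2 bdd_intros bx)
          finally show "(nrm (x a))\<^sup>2 \<le> C / real N" using x2[of a] by linarith
        qed
        have babs: "bdd (\<lambda>\<omega>. \<bar>x a \<omega>\<bar>)" for a using bx[of a] by (auto simp: bdd_def)
        have "(\<integral>\<omega>. (\<Sum>a<N. \<bar>x a \<omega>\<bar> ^ 3) \<partial>M) = (\<Sum>a<N. (\<integral>\<omega>. \<bar>x a \<omega>\<bar> ^ 3 \<partial>M))"
          by (intro Bochner_Integration.integral_sum bdd_integrable bdd_intros babs)
        also have "\<dots> \<le> (\<Sum>a<N. sqrt (C / real N) * (C / real N))"
        proof (rule sum_mono)
          fix a
          have "(\<integral>\<omega>. \<bar>x a \<omega>\<bar> ^ 3 \<partial>M) = (\<integral>\<omega>. \<bar>x a \<omega>\<bar> * (x a \<omega>)\<^sup>2 \<partial>M)"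
            by (simp add: power3_eq_cube power2_eq_square mult_ac)
          also have "\<dots> \<le> nrm (\<lambda>\<omega>. \<bar>x a \<omega>\<bar>) * nrm (\<lambda>\<omega>. (x a \<omega>)\<^sup>2)" by (intro L2_CS bdd_L2 babs bdd_intros bx)
          also have "nrm (\<lambda>\<omega>. \<bar>x a \<omega>\<bar>) = nrm (x a)" by (simp add: nrm_def)
          also have "nrm (x a) * nrm (\<lambda>\<omega>. (x a \<omega>)\<^sup>2) \<le> sqrt (C / real N) * (C / real N)"
            using C0 by (intro mult_mono x1 x2) auto
          finally show "(\<integral>\<omega>. \<bar>x a \<omega>\<bar> ^ 3 \<partial>M) \<le> sqrt (C / real N) * (C / real N)" .
        qed
        also have "\<dots> = sqrt C * C / sqrt (real N)" using N0 by (simp add: real_sqrt_divide)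
        also have "\<dots> \<le> q"
        proof -
          have "(sqrt C * C / q)\<^sup>2 \<le> real N" using NL(2) unfolding L2_def by linarith
          then have "sqrt C * C / q \<le> sqrt (real N)" by (rule real_le_rsqrt)
          then show ?thesis using q(1) N0 by (simp add: divide_le_eq mult.commute)
        qed
        finally show ?thesis .
      qed
    qed
    then show "cmod ((\<integral>x. iexp (t * (S UNIV n D x / sqrt (vol n))) \<partial>M) - complex_of_real (exp (- t\<^sup>2 * (nrm D)\<^sup>2 / 2))) \<le> \<epsilon>"
      using q(2) unfolding sumx s_def by linarith
  qed
qed

end

context commuting_system begin

text \<open>
  The approximations \<open>D k\<close> determine \<open>nrm (S n X) / sqrt (vol n)\<close> up to \<open>1 / (k + 1)\<close> for large \<open>n\<close>, which makes
  their norms Cauchy.  Characteristic functions are Lipschitz in mean, so those of \<open>X\<close> inherit the limit.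
\<close>

theorem projective_clt:
  assumes erg: "\<And>B. B \<in> sets M \<Longrightarrow> T (axis \<iota> 1) -` B = B \<Longrightarrow> prob B = 0 \<or> prob B = 1"
    and X: "X \<in> H" "summ X"
  shows "\<exists>c\<ge>0. ((\<lambda>n. nrm (S UNIV n X) / sqrt (vol n)) \<longlongrightarrow> c) min_at_top \<and>
    (\<forall>t. ((\<lambda>n. \<integral>x. iexp (t * (S UNIV n X x / sqrt (vol n))) \<partial>M) \<longlongrightarrow> complex_of_real (exp (- t\<^sup>2 * c\<^sup>2 / 2))) min_at_top)"
proof -
  have XL: "X \<in> L2" using X(1) by (rule H_L2)
  have "\<forall>k::nat. \<exists>D. D \<in> H \<and> (\<exists>K. \<forall>x. \<bar>D x\<bar> \<le> K) \<and> mds UNIV D \<and> asymp_le (\<lambda>x. X x - D x) (1 / real (Suc k))"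
  proof
    fix k :: nat
    have "0 < 1 / real (Suc k)" by simp
    from bounded_orthomartingale_approximation[OF X this]
    show "\<exists>D. D \<in> H \<and> (\<exists>K. \<forall>x. \<bar>D x\<bar> \<le> K) \<and> mds UNIV D \<and> asymp_le (\<lambda>x. X x - D x) (1 / real (Suc k))" by blast
  qed
  then obtain D where D: "\<And>k::nat. D k \<in> H" "\<And>k. \<exists>K. \<forall>x. \<bar>D k x\<bar> \<le> K" "\<And>k. mds UNIV (D k)"
      "\<And>k. asymp_le (\<lambda>x. X x - D k x) (1 / real (Suc k))" by metis
  have DL: "D k \<in> L2" for k using D(1) by (rule H_L2)
  define \<sigma> where "\<sigma> k = nrm (D k)" for k
  define g where "g n = nrm (S UNIV n X) / sqrt (vol n)" for n
  define \<phi> where "\<phi> t f n = (\<integral>x. iexp (t * (S UNIV n f x / sqrt (vol n))) \<partial>M)" for t f and n :: "int ^ 'd"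
  have ev: "\<forall>\<^sub>F n in min_at_top. 0 < vol n \<and> (\<forall>j. 0 \<le> n $ j) \<and> nrm (S UNIV n (\<lambda>x. X x - D k x)) \<le> 1 / real (Suc k) * sqrt (vol n)" for k
  proof -
    obtain L where L: "L \<ge> 1" "\<And>n. (\<forall>j. L \<le> n $ j) \<Longrightarrow> nrm (S UNIV n (\<lambda>x. X x - D k x)) \<le> 1 / real (Suc k) * sqrt (vol n)"
      using D(4)[of k] unfolding asymp_le_def by blast
    show ?thesis unfolding eventually_min_at_top
    proof (rule exI[of _ L], intro allI impI)
      fix n :: "int ^ 'd" assume n: "\<forall>j. L \<le> n $ j"
      then have n1: "1 \<le> n $ j" for j using L(1) by (meson order_trans)
      have "0 < vol n" unfolding vol_UNIV by (rule vol_on_pos[OF n1])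
      moreover have "0 \<le> n $ j" for j using n1[of j] by simp
      ultimately show "0 < vol n \<and> (\<forall>j. 0 \<le> n $ j) \<and> nrm (S UNIV n (\<lambda>x. X x - D k x)) \<le> 1 / real (Suc k) * sqrt (vol n)"
        using L(2)[OF n] by blast
    qed
  qed
  have g\<sigma>: "\<forall>\<^sub>F n in min_at_top. \<bar>g n - \<sigma> k\<bar> \<le> 1 / real (Suc k)" for k
    using ev[of k]
  proof eventually_elim
    fix n :: "int ^ 'd"
    assume n: "0 < vol n \<and> (\<forall>j. 0 \<le> n $ j) \<and> nrm (S UNIV n (\<lambda>x. X x - D k x)) \<le> 1 / real (Suc k) * sqrt (vol n)"
    then have v: "0 < sqrt (vol n)" by simp
    have "nrm (S UNIV n (D k)) = sqrt (vol n) * \<sigma> k"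
      unfolding \<sigma>_def by (rule mds_nrm_S[OF D(1,3)]) (use n in blast)
    then have "g n - \<sigma> k = (nrm (S UNIV n X) - nrm (S UNIV n (D k))) / sqrt (vol n)"
      using v by (simp add: g_def diff_divide_distrib)
    then have "\<bar>g n - \<sigma> k\<bar> = \<bar>nrm (S UNIV n X) - nrm (S UNIV n (D k))\<bar> / sqrt (vol n)"
      using v by (simp add: abs_divide)
    also have "\<dots> \<le> nrm (S UNIV n (\<lambda>x. X x - D k x)) / sqrt (vol n)"
      unfolding S_diff using v by (intro divide_right_mono nrm_triangle_diff S_L2 XL DL) simp
    also have "\<dots> \<le> 1 / real (Suc k)" using n v by (simp add: divide_le_eq)
    finally show "\<bar>g n - \<sigma> k\<bar> \<le> 1 / real (Suc k)" .
  qed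
  have nonbot: "(min_at_top :: (int ^ 'd) filter) \<noteq> bot"
  proof
    assume "(min_at_top :: (int ^ 'd) filter) = bot"
    then have "eventually (\<lambda>_. False) (min_at_top :: (int ^ 'd) filter)" by simp
    then obtain L where L: "\<And>n :: int ^ 'd. (\<forall>j. L \<le> n $ j) \<Longrightarrow> False" unfolding eventually_min_at_top by blast
    show False by (rule L[of "\<chi> j. L"]) simp
  qed
  have \<sigma>\<sigma>: "\<bar>\<sigma> k - \<sigma> l\<bar> \<le> 1 / real (Suc k) + 1 / real (Suc l)" for k l
  proof -
    have "\<forall>\<^sub>F n in min_at_top. \<bar>g n - \<sigma> k\<bar> \<le> 1 / real (Suc k) \<and> \<bar>g n - \<sigma> l\<bar> \<le> 1 / real (Suc l)"
      by (intro eventually_conj g\<sigma>)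
    from eventually_happens'[OF nonbot this]
    obtain n where "\<bar>g n - \<sigma> k\<bar> \<le> 1 / real (Suc k)" "\<bar>g n - \<sigma> l\<bar> \<le> 1 / real (Suc l)" by blast
    then show ?thesis by linarith
  qed
  have small: "\<exists>k0. \<forall>k\<ge>k0. 1 / real (Suc k) < e" if e: "0 < e" for e :: real
  proof -
    obtain k0 where k0: "1 / real (Suc k0) < e" using reals_Archimedean[OF e] by (auto simp: inverse_eq_divide)
    have "1 / real (Suc k) \<le> 1 / real (Suc k0)" if "k0 \<le> k" for k using that by (intro divide_left_mono) auto
    then show ?thesis using k0 by (meson le_less_trans)
  qed
  have "Cauchy \<sigma>"
  proof (rule CauchyI)
    fix e :: real assume "0 < e"
    then obtain k0 where k0: "\<And>k. k0 \<le> k \<Longrightarrow> 1 / real (Suc k) < e / 2" using small[of "e / 2"] by auto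
    show "\<exists>M. \<forall>m\<ge>M. \<forall>n\<ge>M. norm (\<sigma> m - \<sigma> n) < e"
    proof (rule exI[of _ k0], intro allI impI)
      fix m n assume "k0 \<le> m" "k0 \<le> n"
      then show "norm (\<sigma> m - \<sigma> n) < e" using \<sigma>\<sigma>[of m n] k0[of m] k0[of n] by simp
    qed
  qed
  then obtain c where c: "\<sigma> \<longlonglongrightarrow> c" by (auto simp: Cauchy_convergent_iff convergent_def)
  have c0: "0 \<le> c" by (rule LIMSEQ_le_const[OF c]) (simp add: \<sigma>_def)
  have glim: "(g \<longlongrightarrow> c) min_at_top"
  proof (rule tendstoI)
    fix e :: real assume e: "0 < e"
    obtain k0 where k0: "\<And>k. k0 \<le> k \<Longrightarrow> 1 / real (Suc k) < e / 2" using small[of "e / 2"] e by auto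
    obtain k1 where k1: "\<And>k. k1 \<le> k \<Longrightarrow> \<bar>\<sigma> k - c\<bar> < e / 2" using LIMSEQ_D[OF c, of "e / 2"] e by auto
    show "\<forall>\<^sub>F n in min_at_top. dist (g n) c < e"
      using g\<sigma>[of "max k0 k1"]
    proof eventually_elim
      fix n assume "\<bar>g n - \<sigma> (max k0 k1)\<bar> \<le> 1 / real (Suc (max k0 k1))"
      then show "dist (g n) c < e" using k0[of "max k0 k1"] k1[of "max k0 k1"] unfolding dist_real_def by linarith
    qed
  qed
  have \<phi>lim: "(\<phi> t X \<longlongrightarrow> complex_of_real (exp (- t\<^sup>2 * c\<^sup>2 / 2))) min_at_top" for t
  proof (rule tendstoI)
    fix e :: real assume e: "0 < e"
    define \<gamma> where "\<gamma> z = complex_of_real (exp (- t\<^sup>2 * z\<^sup>2 / 2))" for z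
    have "(\<lambda>k. \<gamma> (\<sigma> k)) \<longlonglongrightarrow> \<gamma> c" unfolding \<gamma>_def by (intro tendsto_intros c) auto
    moreover have "0 < e / 4" using e by simp
    ultimately have "\<exists>k1. \<forall>k\<ge>k1. cmod (\<gamma> (\<sigma> k) - \<gamma> c) < e / 4" by (rule LIMSEQ_D)
    then obtain k1 where k1: "\<And>k. k1 \<le> k \<Longrightarrow> cmod (\<gamma> (\<sigma> k) - \<gamma> c) < e / 4" by blast
    have "0 < e / (4 * (\<bar>t\<bar> + 1))" using e by (intro divide_pos_pos) auto
    then obtain k0 where k0: "\<And>k. k0 \<le> k \<Longrightarrow> 1 / real (Suc k) < e / (4 * (\<bar>t\<bar> + 1))" using small by blast
    define k where "k = max k0 k1"
    have k: "1 / real (Suc k) < e / (4 * (\<bar>t\<bar> + 1))" "cmod (\<gamma> (\<sigma> k) - \<gamma> c) < e / 4"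
      using k0[of k] k1[of k] by (auto simp: k_def)
    have t1: "\<bar>t\<bar> * (1 / real (Suc k)) \<le> e / 4"
    proof -
      have "\<bar>t\<bar> * (1 / real (Suc k)) \<le> (\<bar>t\<bar> + 1) * (e / (4 * (\<bar>t\<bar> + 1)))" using k(1) by (intro mult_mono) auto
      also have "\<dots> = e / 4"
      proof -
        have "z \<noteq> 0 \<Longrightarrow> z * (e / (4 * z)) = e / 4" for z :: real by simp
        moreover have "\<bar>t\<bar> + 1 \<noteq> 0" by linarith
        ultimately show ?thesis .
      qed
      finally show ?thesis .
    qed
    obtain K where K: "\<And>x. \<bar>D k x\<bar> \<le> K" using D(2)[of k] by blast
    have "bounded_orthomartingale M T F (D k) (\<bar>K\<bar> + 1)"
      by unfold_locales (use D(1,3)[of k] K in \<open>auto intro: order_trans[OF K] \<close>)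
    then interpret D: bounded_orthomartingale M T F "D k" "\<bar>K\<bar> + 1" .
    have "\<forall>\<^sub>F n in min_at_top. cmod (\<phi> t (D k) n - \<gamma> (\<sigma> k)) \<le> e / 4"
      unfolding \<phi>_def \<gamma>_def \<sigma>_def by (rule D.orthomartingale_clt[OF erg]) (use e in auto)
    then show "\<forall>\<^sub>F n in min_at_top. dist (\<phi> t X n) (complex_of_real (exp (- t\<^sup>2 * c\<^sup>2 / 2))) < e"
      using ev[of k]
    proof eventually_elim
      fix n :: "int ^ 'd"
      assume 1: "cmod (\<phi> t (D k) n - \<gamma> (\<sigma> k)) \<le> e / 4"
        and n: "0 < vol n \<and> (\<forall>j. 0 \<le> n $ j) \<and> nrm (S UNIV n (\<lambda>x. X x - D k x)) \<le> 1 / real (Suc k) * sqrt (vol n)"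
      have v: "0 < sqrt (vol n)" using n by simp
      have SXm [measurable]: "S UNIV n X \<in> borel_measurable M" "S UNIV n (D k) \<in> borel_measurable M"
        by (intro S_meas L2_meas XL DL)+
      let ?a = "\<lambda>x. t * (S UNIV n X x / sqrt (vol n))" and ?b = "\<lambda>x. t * (S UNIV n (D k) x / sqrt (vol n))"
      have i1: "integrable M (\<lambda>x. iexp (?a x))"
      proof (rule integrable_bdd_complex[where B=1])
        show "(\<lambda>x. iexp (?a x)) \<in> borel_measurable M" by measurable
        show "cmod (iexp (?a x)) \<le> 1" for x by (simp only: norm_exp_i_times order_refl)
      qed
      have i2: "integrable M (\<lambda>x. iexp (?b x))"
      proof (rule integrable_bdd_complex[where B=1])
        show "(\<lambda>x. iexp (?b x)) \<in> borel_measurable M" by measurable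
        show "cmod (iexp (?b x)) \<le> 1" for x by (simp only: norm_exp_i_times order_refl)
      qed
      have dL: "S UNIV n (\<lambda>x. X x - D k x) \<in> L2" by (intro S_L2 L2_diff XL DL)
      have di: "integrable M (\<lambda>x. \<bar>S UNIV n (\<lambda>x. X x - D k x) x\<bar>)" using L2_integrable[OF dL] by simp
      have "cmod (\<phi> t X n - \<phi> t (D k) n) = cmod (\<integral>x. iexp (?a x) - iexp (?b x) \<partial>M)"
        unfolding \<phi>_def by (simp only: Bochner_Integration.integral_diff[OF i1 i2])
      also have "\<dots> \<le> (\<integral>x. \<bar>t\<bar> / sqrt (vol n) * \<bar>S UNIV n (\<lambda>x. X x - D k x) x\<bar> \<partial>M)"
      proof (rule cmod_integral_le)
        show "integrable M (\<lambda>x. iexp (?a x) - iexp (?b x))" using i1 i2 by simp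
        show "integrable M (\<lambda>x. \<bar>t\<bar> / sqrt (vol n) * \<bar>S UNIV n (\<lambda>x. X x - D k x) x\<bar>)" using di by simp
        fix x
        have "cmod (iexp (?a x) - iexp (?b x)) \<le> \<bar>?a x - ?b x\<bar>" by (rule iexp_lipschitz)
        also have "?a x - ?b x = t / sqrt (vol n) * (S UNIV n X x - S UNIV n (D k) x)"
          by (simp add: right_diff_distrib diff_divide_distrib)
        also have "\<bar>t / sqrt (vol n) * (S UNIV n X x - S UNIV n (D k) x)\<bar> = \<bar>t\<bar> / sqrt (vol n) * \<bar>S UNIV n (\<lambda>x. X x - D k x) x\<bar>"
          using v by (simp add: abs_mult S_diff)
        finally show "cmod (iexp (?a x) - iexp (?b x)) \<le> \<bar>t\<bar> / sqrt (vol n) * \<bar>S UNIV n (\<lambda>x. X x - D k x) x\<bar>" .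
      qed
      also have "\<dots> = \<bar>t\<bar> / sqrt (vol n) * (\<integral>x. \<bar>S UNIV n (\<lambda>x. X x - D k x) x\<bar> \<partial>M)" by (rule integral_mult_right_zero)
      also have "\<dots> \<le> \<bar>t\<bar> / sqrt (vol n) * (1 / real (Suc k) * sqrt (vol n))"
        using v n integral_abs_le_nrm[OF dL] by (intro mult_left_mono) auto
      also have "\<dots> = \<bar>t\<bar> * (1 / real (Suc k))" using v by simp
      finally have 2: "cmod (\<phi> t X n - \<phi> t (D k) n) \<le> e / 4" using t1 by linarith
      have "cmod (\<phi> t X n - \<gamma> c) \<le> cmod (\<phi> t X n - \<phi> t (D k) n) + (cmod (\<phi> t (D k) n - \<gamma> (\<sigma> k)) + cmod (\<gamma> (\<sigma> k) - \<gamma> c))"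
        using norm_triangle_ineq[of "\<phi> t X n - \<phi> t (D k) n" "(\<phi> t (D k) n - \<gamma> (\<sigma> k)) + (\<gamma> (\<sigma> k) - \<gamma> c)"]
          norm_triangle_ineq[of "\<phi> t (D k) n - \<gamma> (\<sigma> k)" "\<gamma> (\<sigma> k) - \<gamma> c"] by simp
      then show "dist (\<phi> t X n) (complex_of_real (exp (- t\<^sup>2 * c\<^sup>2 / 2))) < e"
        using 1 2 k(2) e unfolding dist_norm \<gamma>_def by linarith
    qed
  qed
  show ?thesis using c0 glim \<phi>lim unfolding g_def[abs_def] \<phi>_def[abs_def] by blast
qed

end

section \<open>Weak convergence along the box filter\<close>

text \<open>
  The filter has a countable basis, so sequences suffice.
\<close>

lemma tendsto_min_at_top_sequentially:
  fixes f :: "int ^ 'd::finite \<Rightarrow> 'b::metric_space"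
  assumes "\<And>u. filterlim u min_at_top sequentially \<Longrightarrow> (\<lambda>k::nat. f (u k)) \<longlonglongrightarrow> l"
  shows "(f \<longlongrightarrow> l) min_at_top"
proof (rule tendstoI, rule ccontr)
  fix e :: real assume e: "0 < e" and "\<not> (\<forall>\<^sub>F n in min_at_top. dist (f n) l < e)"
  then have "\<forall>k::nat. \<exists>n. (\<forall>j. int k \<le> n $ j) \<and> \<not> dist (f n) l < e"
    unfolding eventually_min_at_top by blast
  then obtain u where u: "\<And>k j. int k \<le> u k $ j" "\<And>k. \<not> dist (f (u k)) l < e" by metis
  have "filterlim u min_at_top sequentially"
    unfolding filterlim_iff
  proof (intro allI impI)
    fix P :: "int ^ 'd \<Rightarrow> bool" assume "eventually P min_at_top"
    then obtain L where L: "\<And>n. (\<forall>j. L \<le> n $ j) \<Longrightarrow> P n" unfolding eventually_min_at_top by blast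
    show "\<forall>\<^sub>F k in sequentially. P (u k)"
      using eventually_ge_at_top[of "nat L"]
    proof eventually_elim
      fix k assume "nat L \<le> k"
      then have "L \<le> int k" by linarith
      then show "P (u k)" using u(1)[of k] by (intro L) (meson order_trans)
    qed
  qed
  then have "(\<lambda>k. f (u k)) \<longlonglongrightarrow> l" by (rule assms)
  then have "\<forall>\<^sub>F k in sequentially. dist (f (u k)) l < e" using e by (rule tendstoD)
  then show False using u(2) by (auto simp: eventually_sequentially)
qed

lemma real_distribution_centered_normal: "real_distribution (centered_normal (c\<^sup>2))"
proof (rule real_distribution.intro)
  show "prob_space (centered_normal (c\<^sup>2))"
    using prob_space_normal_density[of "sqrt (c\<^sup>2)" 0] prob_space_return[of 0 borel]
    by (cases "c = 0") (auto simp: centered_normal_def)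
  show "real_distribution_axioms (centered_normal (c\<^sup>2))"
    by (rule real_distribution_axioms.intro) (auto simp: centered_normal_def)
qed

lemma char_centered_normal:
  assumes c: "0 \<le> c"
  shows "char (centered_normal (c\<^sup>2)) t = complex_of_real (exp (- t\<^sup>2 * c\<^sup>2 / 2))"
proof (cases "c = 0")
  case True
  have "char (return borel 0) t = iexp (t * 0)"
    unfolding char_def by (rule integral_return) auto
  then show ?thesis using True by (simp add: centered_normal_def)
next
  case False
  then have c0: "0 < c" using c by simp
  define N where "N = density lborel (\<lambda>x. ennreal (normal_density 0 c x))"
  have N: "centered_normal (c\<^sup>2) = N" using c0 by (simp add: centered_normal_def N_def)
  interpret N: prob_space N unfolding N_def by (rule prob_space_normal_density[OF c0])
  have sN: "sets N = sets borel" by (simp add: N_def)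
  have "distributed N lborel (\<lambda>x. x) (normal_density 0 c)"
    unfolding distributed_def
  proof (intro conjI)
    have "distr N lborel (\<lambda>x. x) = N" by (rule distr_id2) (simp add: sN)
    then show "distr N lborel (\<lambda>x. x) = density lborel (\<lambda>x. ennreal (normal_density 0 c x))" by (simp add: N_def)
    show "(\<lambda>x. x) \<in> measurable N lborel" by (rule measurable_ident_sets) (simp add: sN)
  qed auto
  then have "distributed N lborel (\<lambda>x. (x - 0) / c) std_normal_density"
    by (subst (asm) N.normal_standard_normal_convert[OF c0])
  then have d: "distr N lborel (\<lambda>x. x / c) = std_normal_distribution" and m: "(\<lambda>x. x / c) \<in> measurable N lborel"
    by (simp_all add: distributed_def)
  have "char N t = (\<integral>x. iexp ((t * c) * (x / c)) \<partial>N)"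
    unfolding char_def using c0 by simp
  also have "\<dots> = (\<integral>y. iexp ((t * c) * y) \<partial>distr N lborel (\<lambda>x. x / c))"
    by (rule integral_distr[OF m, symmetric]) measurable
  also have "\<dots> = char std_normal_distribution (t * c)" unfolding d char_def ..
  also have "\<dots> = complex_of_real (exp (- t\<^sup>2 * c\<^sup>2 / 2))"
    by (simp add: char_std_normal_distribution power_mult_distrib)
  finally show ?thesis by (simp add: N)
qed

text \<open>Levy's continuity theorem, applied along every sequence of boxes growing in all directions.\<close>

lemma weak_conv_filter_of_char:
  fixes \<mu> :: "int ^ 'd::finite \<Rightarrow> real measure"
  assumes \<mu>: "\<And>n. real_distribution (\<mu> n)" and c: "0 \<le> c"
    and lim: "\<And>t. ((\<lambda>n. char (\<mu> n) t) \<longlongrightarrow> complex_of_real (exp (- t\<^sup>2 * c\<^sup>2 / 2))) min_at_top"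
  shows "weak_conv_filter \<mu> (centered_normal (c\<^sup>2)) min_at_top"
  unfolding weak_conv_filter_def
proof (intro allI impI tendsto_min_at_top_sequentially)
  fix x and u :: "nat \<Rightarrow> int ^ 'd"
  assume x: "isCont (cdf (centered_normal (c\<^sup>2))) x" and u: "filterlim u min_at_top sequentially"
  have "weak_conv_m (\<lambda>k. \<mu> (u k)) (centered_normal (c\<^sup>2))"
  proof (rule levy_continuity[OF \<mu> real_distribution_centered_normal])
    show "(\<lambda>k. char (\<mu> (u k)) t) \<longlonglongrightarrow> char (centered_normal (c\<^sup>2)) t" for t
      unfolding char_centered_normal[OF c] by (rule filterlim_compose[OF lim u])
  qed
  then show "(\<lambda>k. cdf (\<mu> (u k)) x) \<longlonglongrightarrow> cdf (centered_normal (c\<^sup>2)) x"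
    using x by (simp add: weak_conv_m_def weak_conv_def)
qed

section \<open>Passage to the canonical space\<close>

context prob_space begin

lemma cond_exp_self_adjoint:
  assumes G: "subalgebra M G" and f: "f \<in> L2" and g: "g \<in> L2"
  shows "(\<integral>x. f x * real_cond_exp M G g x \<partial>M) = (\<integral>x. real_cond_exp M G f x * g x \<partial>M)"
proof -
  interpret G: finite_measure_subalgebra M G by unfold_locales (rule G)
  note E = L2_cond_exp(1)[OF G]
  have "(\<integral>x. real_cond_exp M G g x * real_cond_exp M G f x \<partial>M) = (\<integral>x. real_cond_exp M G g x * f x \<partial>M)"
    by (rule G.real_cond_exp_intg(2)) (auto intro: L2_mult E f g L2_meas)
  moreover have "(\<integral>x. real_cond_exp M G f x * real_cond_exp M G g x \<partial>M) = (\<integral>x. real_cond_exp M G f x * g x \<partial>M)"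
    by (rule G.real_cond_exp_intg(2)) (auto intro: L2_mult E f g L2_meas)
  ultimately show ?thesis by (simp add: mult.commute)
qed

text \<open>The order of the two conditional expectations can be exchanged by passing to adjoints.\<close>

lemma cond_exp_commute_adjoint:
  assumes sub: "subalgebra M A" "subalgebra M B" "subalgebra M C"
    and com: "\<And>z. z \<in> L2 \<Longrightarrow> AE x in M. real_cond_exp M A (real_cond_exp M B z) x = real_cond_exp M C z x"
    and g: "g \<in> L2"
  shows "AE x in M. real_cond_exp M B (real_cond_exp M A g) x = real_cond_exp M C g x"
proof -
  let ?p = "real_cond_exp M B (real_cond_exp M A g)" and ?q = "real_cond_exp M C g"
  let ?d = "\<lambda>x. ?p x - ?q x"
  have L: "?p \<in> L2" "?q \<in> L2" by (intro L2_cond_exp(1) sub g)+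
  then have d: "?d \<in> L2" by (intro L2_diff)
  have "(\<integral>x. ?d x * ?p x \<partial>M) = (\<integral>x. real_cond_exp M B ?d x * real_cond_exp M A g x \<partial>M)"
    by (intro cond_exp_self_adjoint sub d L2_cond_exp(1) g)
  also have "\<dots> = (\<integral>x. real_cond_exp M A (real_cond_exp M B ?d) x * g x \<partial>M)"
    by (intro cond_exp_self_adjoint sub d L2_cond_exp(1) g)
  also have "\<dots> = (\<integral>x. real_cond_exp M C ?d x * g x \<partial>M)"
    using com[OF d] L2_meas[OF g] by (intro integral_cong_AE) auto
  also have "\<dots> = (\<integral>x. ?d x * ?q x \<partial>M)" by (intro cond_exp_self_adjoint[symmetric] sub d g)
  finally have eq: "(\<integral>x. ?d x * ?p x \<partial>M) = (\<integral>x. ?d x * ?q x \<partial>M)" .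
  have "(\<integral>x. (?d x)\<^sup>2 \<partial>M) = (\<integral>x. ?d x * ?p x - ?d x * ?q x \<partial>M)"
    by (simp add: power2_eq_square right_diff_distrib)
  also have "\<dots> = 0" using eq L2_mult[OF d L(1)] L2_mult[OF d L(2)] by simp
  finally have "AE x in M. (?d x)\<^sup>2 = 0"
    using L2_sq[OF d] integral_nonneg_eq_0_iff_AE[of M "\<lambda>x. (?d x)\<^sup>2"] by simp
  then show ?thesis by eventually_elim simp
qed

end

lemma real_cond_exp_distr:
  assumes M: "prob_space M" and \<Phi>: "\<Phi> \<in> measurable M N"
    and G: "subalgebra M G" and G': "subalgebra (distr M N \<Phi>) G'"
    and \<Phi>G: "\<Phi> \<in> measurable G G'"
    and vim: "\<And>A. A \<in> sets G \<Longrightarrow> \<exists>B\<in>sets G'. A = \<Phi> -` B \<inter> space M"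
    and g: "integrable (distr M N \<Phi>) g"
  shows "AE \<omega> in M. real_cond_exp M G (\<lambda>\<omega>. g (\<Phi> \<omega>)) \<omega> = real_cond_exp (distr M N \<Phi>) G' g (\<Phi> \<omega>)"
proof -
  interpret M: prob_space M by (rule M)
  interpret D: prob_space "distr M N \<Phi>" by (rule M.prob_space_distr[OF \<Phi>])
  interpret G: finite_measure_subalgebra M G by unfold_locales (rule G)
  interpret G': finite_measure_subalgebra "distr M N \<Phi>" G' by unfold_locales (rule G')
  let ?D = "distr M N \<Phi>" and ?h = "real_cond_exp (distr M N \<Phi>) G' g"
  have hi: "integrable ?D ?h" using G'.real_cond_exp_int(1)[OF g] .
  show ?thesis
  proof (rule G.real_cond_exp_charact)
    show "integrable M (\<lambda>\<omega>. g (\<Phi> \<omega>))" using integrable_distr[OF \<Phi> g] .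
    show "integrable M (\<lambda>\<omega>. ?h (\<Phi> \<omega>))" using integrable_distr[OF \<Phi> hi] .
    show "(\<lambda>\<omega>. ?h (\<Phi> \<omega>)) \<in> borel_measurable G" by (rule measurable_compose[OF \<Phi>G]) simp
    fix A assume "A \<in> sets G"
    then obtain B where B: "B \<in> sets G'" "A = \<Phi> -` B \<inter> space M" using vim by blast
    have BN: "B \<in> sets N" using B(1) G' by (auto simp: subalgebra_def)
    have tr: "(LINT \<omega>:A|M. f (\<Phi> \<omega>)) = (LINT x:B|?D. f x)" if f: "f \<in> borel_measurable N" for f :: "_ \<Rightarrow> real"
    proof -
      have "(LINT \<omega>:A|M. f (\<Phi> \<omega>)) = (\<integral>\<omega>. indicator B (\<Phi> \<omega>) *\<^sub>R f (\<Phi> \<omega>) \<partial>M)"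
        unfolding set_lebesgue_integral_def
        by (intro Bochner_Integration.integral_cong refl) (auto simp: B(2) indicator_def)
      also have "\<dots> = (\<integral>x. indicator B x *\<^sub>R f x \<partial>?D)"
        using BN f by (intro integral_distr[OF \<Phi>, symmetric]) auto
      finally show ?thesis by (simp add: set_lebesgue_integral_def)
    qed
    have "(LINT \<omega>:A|M. g (\<Phi> \<omega>)) = (LINT x:B|?D. g x)" using g by (intro tr) auto
    also have "\<dots> = (LINT x:B|?D. ?h x)" by (rule G'.real_cond_exp_intA[OF g B(1)])
    also have "\<dots> = (LINT \<omega>:A|M. ?h (\<Phi> \<omega>))" using hi by (intro tr[symmetric]) auto
    finally show "(LINT \<omega>:A|M. g (\<Phi> \<omega>)) = (LINT \<omega>:A|M. ?h (\<Phi> \<omega>))" .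
  qed
qed

lemma space_past [simp]: "space (past M \<xi> k) = space M"
  unfolding past_def by (rule space_measure_of) auto

lemma sets_past: "sets (past M \<xi> k) = sigma_sets (space M) {\<xi> u -` B \<inter> space M | u B. u \<le> k \<and> B \<in> sets borel}"
  unfolding past_def by (rule sets_measure_of) auto

lemma past_measurable: assumes "u \<le> k" shows "\<xi> u \<in> borel_measurable (past M \<xi> k)"
proof (rule measurableI)
  fix B :: "real set" assume "B \<in> sets borel"
  then have "\<xi> u -` B \<inter> space M \<in> {\<xi> u -` B \<inter> space M | u B. u \<le> k \<and> B \<in> sets borel}" using assms by blast
  then show "\<xi> u -` B \<inter> space (past M \<xi> k) \<in> sets (past M \<xi> k)"
    unfolding sets_past space_past by (rule sigma_sets.Basic)
qed simp

text \<open>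
  The past is generated by the coordinates before \<open>k\<close>.
\<close>

lemma measurable_past:
  assumes "\<Psi> \<in> space A \<rightarrow> space M" "\<And>u. u \<le> k \<Longrightarrow> (\<lambda>\<omega>. \<xi> u (\<Psi> \<omega>)) \<in> borel_measurable A"
  shows "\<Psi> \<in> measurable A (past M \<xi> k)"
  unfolding past_def
proof (rule measurable_measure_of)
  fix Y assume "Y \<in> {\<xi> u -` B \<inter> space M | u B. u \<le> k \<and> B \<in> sets borel}"
  then obtain u B where Y: "Y = \<xi> u -` B \<inter> space M" "u \<le> k" "B \<in> sets borel" by blast
  have "\<Psi> -` Y \<inter> space A = (\<lambda>\<omega>. \<xi> u (\<Psi> \<omega>)) -` B \<inter> space A" using assms(1) by (auto simp: Y(1))
  then show "\<Psi> -` Y \<inter> space A \<in> sets A" using measurable_sets[OF assms(2)[OF Y(2)] Y(3)] by simp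
qed (use assms in auto)

lemma subalgebra_past: assumes "\<And>u. \<xi> u \<in> borel_measurable M" shows "subalgebra M (past M \<xi> k)"
  unfolding subalgebra_def sets_past space_past
proof (intro conjI refl sets.sigma_sets_subset subsetI)
  fix Y assume "Y \<in> {\<xi> u -` B \<inter> space M | u B. u \<le> k \<and> B \<in> sets borel}"
  then obtain u B where "Y = \<xi> u -` B \<inter> space M" "B \<in> sets borel" by blast
  then show "Y \<in> sets M" using measurable_sets[OF assms] by simp
qed

text \<open>
  The field moved to its canonical space, where translation is a genuine group action.  The
  commutation is transported from one order of the two conditionings to the other by adjunction.
\<close>

lemma canonical_commuting_system:
  fixes M :: "'a measure" and \<xi> :: "int ^ 'd::finite \<Rightarrow> 'a \<Rightarrow> real"
  assumes M: "prob_space M" and st: "stationary_field M \<xi>" and com: "commuting M (past M \<xi>) i\<^sub>0"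
  defines "N \<equiv> field_law M \<xi>"
  shows "commuting_system N (\<lambda>h x n. x (n + h)) (past N (\<lambda>u x. x u))"
    and "integrable N g \<Longrightarrow>
      AE \<omega> in M. real_cond_exp M (past M \<xi> k) (\<lambda>\<omega>. g (\<lambda>n. \<xi> n \<omega>)) \<omega> = real_cond_exp N (past N (\<lambda>u x. x u) k) g (\<lambda>n. \<xi> n \<omega>)"
proof -
  interpret M: prob_space M by (rule M)
  define \<Omega> :: "(int ^ 'd \<Rightarrow> real) measure" where "\<Omega> = (\<Pi>\<^sub>M n\<in>UNIV. borel)"
  define \<Phi> where "\<Phi> = (\<lambda>\<omega> n. \<xi> n \<omega>)"
  define Fc where "Fc = past N (\<lambda>u x. x u)"
  have \<xi>m [measurable]: "\<xi> n \<in> borel_measurable M" for n using st by (simp add: stationary_field_def)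
  have \<Phi>m: "\<Phi> \<in> measurable M \<Omega>" unfolding \<Phi>_def \<Omega>_def by (rule measurable_PiM_single') auto
  have N: "N = distr M \<Omega> \<Phi>" by (simp add: N_def field_law_def \<Omega>_def \<Phi>_def)
  have spN: "space N = UNIV" by (simp add: N \<Omega>_def space_PiM)
  have stN: "sets N = sets \<Omega>" by (simp add: N)
  interpret N: prob_space N unfolding N by (rule M.prob_space_distr[OF \<Phi>m])
  have coord: "(\<lambda>x. x u) \<in> borel_measurable N" for u
    unfolding measurable_cong_sets[OF stN refl] \<Omega>_def by (rule measurable_component_singleton) simp
  have Fc_sub: "subalgebra N (Fc k)" for k unfolding Fc_def by (rule subalgebra_past[OF coord])
  have F_sub: "subalgebra M (past M \<xi> k)" for k by (rule subalgebra_past[OF \<xi>m])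
  have \<Phi>F: "\<Phi> \<in> measurable (past M \<xi> k) (Fc k)" for k
    unfolding Fc_def by (rule measurable_past) (auto simp: spN \<Phi>_def past_measurable)
  have vim: "\<exists>B\<in>sets (Fc k). A = \<Phi> -` B \<inter> space M" if A: "A \<in> sets (past M \<xi> k)" for A k
  proof -
    let ?E = "{(\<lambda>x. x u) -` B \<inter> space N | u B. u \<le> k \<and> B \<in> sets (borel :: real measure)}"
    have "{\<Phi> -` A \<inter> space M | A. A \<in> ?E} = {\<xi> u -` B \<inter> space M | u B. u \<le> k \<and> B \<in> sets borel}" (is "?l = ?r")
    proof (intro equalityI subsetI)
      have eq: "\<Phi> -` ((\<lambda>x. x u) -` B \<inter> space N) \<inter> space M = \<xi> u -` B \<inter> space M" for u B
        by (auto simp: \<Phi>_def spN)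
      {
        fix Y assume "Y \<in> ?l"
        then obtain A where A: "A \<in> ?E" "Y = \<Phi> -` A \<inter> space M" by blast
        then obtain u B where "u \<le> k" "B \<in> sets borel" "A = (\<lambda>x. x u) -` B \<inter> space N" by blast
        then have "Y = \<xi> u -` B \<inter> space M \<and> u \<le> k \<and> B \<in> sets borel" using A(2) eq by simp
        then show "Y \<in> ?r" by blast
      next
        fix Y assume "Y \<in> ?r"
        then obtain u B where uB: "u \<le> k" "B \<in> sets borel" "Y = \<xi> u -` B \<inter> space M" by blast
        then have E: "(\<lambda>x. x u) -` B \<inter> space N \<in> ?E" by blast
        have Y: "Y = \<Phi> -` ((\<lambda>x. x u) -` B \<inter> space N) \<inter> space M" unfolding eq by (rule uB(3))
        show "Y \<in> ?l" by (rule CollectI, rule exI, rule conjI, rule Y, rule E)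
      }
    qed
    then have "sets (past M \<xi> k) = {\<Phi> -` A \<inter> space M | A. A \<in> sigma_sets (space N) ?E}"
      unfolding sets_past by (subst sigma_sets_vimage_commute) (simp_all add: spN)
    with A obtain B where "B \<in> sigma_sets (space N) ?E" "A = \<Phi> -` B \<inter> space M" by auto
    then show ?thesis unfolding Fc_def sets_past by (intro bexI)
  qed
  have tr: "AE \<omega> in M. real_cond_exp M (past M \<xi> k) (\<lambda>\<omega>. g (\<Phi> \<omega>)) \<omega> = real_cond_exp N (Fc k) g (\<Phi> \<omega>)"
    if g: "integrable N g" for g k
    unfolding N
    by (rule real_cond_exp_distr[OF M \<Phi>m F_sub _ \<Phi>F vim]) (use Fc_sub g in \<open>auto simp: N\<close>)
  show "integrable N g \<Longrightarrow>
      AE \<omega> in M. real_cond_exp M (past M \<xi> k) (\<lambda>\<omega>. g (\<lambda>n. \<xi> n \<omega>)) \<omega> = real_cond_exp N (past N (\<lambda>u x. x u) k) g (\<lambda>n. \<xi> n \<omega>)"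
    using tr[of g k] unfolding \<Phi>_def Fc_def .
  \<comment> \<open>the hypothesis gives the case in which the outer index is the earlier one along \<open>i\<^sub>0\<close>\<close>
  have com1: "AE x in N. real_cond_exp N (Fc l) (real_cond_exp N (Fc k) g) x = real_cond_exp N (Fc (vmin k l)) g x"
    if g: "g \<in> N.L2" and lk: "l $ i\<^sub>0 \<le> k $ i\<^sub>0" for g k l
  proof -
    interpret Fl: finite_measure_subalgebra M "past M \<xi> l" by unfold_locales (rule F_sub)
    have gi: "integrable N g" by (rule N.L2_integrable[OF g])
    have g\<Phi>: "integrable M (\<lambda>\<omega>. g (\<Phi> \<omega>))" using integrable_distr[OF \<Phi>m] gi unfolding N by blast
    have Ei: "integrable N (real_cond_exp N (Fc k) g)" by (intro N.L2_integrable N.L2_cond_exp(1) Fc_sub g)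
    have E\<Phi>: "integrable M (\<lambda>\<omega>. real_cond_exp N (Fc k) g (\<Phi> \<omega>))" using integrable_distr[OF \<Phi>m] Ei unfolding N by blast
    have ix: "idx i\<^sub>0 (k $ i\<^sub>0) k = k" "idx i\<^sub>0 (l $ i\<^sub>0) l = l" "idx i\<^sub>0 (l $ i\<^sub>0) (vmin k l) = vmin k l"
      using lk by (auto simp: vec_eq_iff)
    have "AE \<omega> in M. real_cond_exp M (past M \<xi> l) (real_cond_exp M (past M \<xi> k) (\<lambda>\<omega>. g (\<Phi> \<omega>))) \<omega>
        = real_cond_exp M (past M \<xi> (vmin k l)) (\<lambda>\<omega>. g (\<Phi> \<omega>)) \<omega>"
      using com[unfolded commuting_def, rule_format, OF lk g\<Phi>, of l k] unfolding ix .
    moreover have "AE \<omega> in M. real_cond_exp M (past M \<xi> l) (real_cond_exp M (past M \<xi> k) (\<lambda>\<omega>. g (\<Phi> \<omega>))) \<omega>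
        = real_cond_exp M (past M \<xi> l) (\<lambda>\<omega>. real_cond_exp N (Fc k) g (\<Phi> \<omega>)) \<omega>"
      by (rule Fl.real_cond_exp_cong[OF tr[OF gi]]) (use E\<Phi> in auto)
    moreover note tr[OF Ei, of l] tr[OF gi, of "vmin k l"]
    ultimately have "AE \<omega> in M. real_cond_exp N (Fc l) (real_cond_exp N (Fc k) g) (\<Phi> \<omega>) = real_cond_exp N (Fc (vmin k l)) g (\<Phi> \<omega>)"
      by eventually_elim simp
    moreover have "{x \<in> space N. real_cond_exp N (Fc l) (real_cond_exp N (Fc k) g) x = real_cond_exp N (Fc (vmin k l)) g x} \<in> sets N"
      by measurable
    ultimately show ?thesis
      unfolding N by (subst AE_distr_iff[OF \<Phi>m]) (simp_all add: N[symmetric] stN[symmetric] sets_eq_imp_space_eq[OF stN, symmetric])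
  qed
  show "commuting_system N (\<lambda>h x n. x (n + h)) (past N (\<lambda>u x. x u))"
    unfolding Fc_def[symmetric]
  proof (unfold_locales)
    show "space N = UNIV" by (rule spN)
    have Tm: "(\<lambda>x n. x (n + h)) \<in> measurable N \<Omega>" for h :: "int ^ 'd"
      unfolding \<Omega>_def by (rule measurable_PiM_single') (auto simp: coord)
    show T: "(\<lambda>x n. x (n + h)) \<in> measurable N N" for h :: "int ^ 'd"
      using Tm[of h] unfolding measurable_cong_sets[OF refl stN] .
    show "distr N N (\<lambda>x n. x (n + h)) = N" for h :: "int ^ 'd"
    proof -
      have "distr N N (\<lambda>x n. x (n + h)) = distr N \<Omega> (\<lambda>x n. x (n + h))" by (rule distr_cong) (auto simp: stN)
      also have "\<dots> = distr M \<Omega> ((\<lambda>x n. x (n + h)) \<circ> \<Phi>)"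
        unfolding N by (rule distr_distr[OF _ \<Phi>m]) (use Tm[of h] in \<open>simp add: N\<close>)
      also have "\<dots> = field_law M (\<lambda>n. \<xi> (n + h))" by (simp add: field_law_def \<Omega>_def \<Phi>_def comp_def)
      also have "\<dots> = N" using st by (simp add: stationary_field_def N_def)
      finally show ?thesis .
    qed
    show "(\<lambda>n. x (n + 0)) = x" for x :: "int ^ 'd \<Rightarrow> real" by simp
    show "(\<lambda>n. (\<lambda>n. x (n + k)) (n + h)) = (\<lambda>n. x (n + (h + k)))" for x :: "int ^ 'd \<Rightarrow> real" and h k
      by (simp add: add.assoc)
    show "subalgebra N (Fc k)" for k by (rule Fc_sub)
    show "sets (Fc k) \<subseteq> sets (Fc l)" if "k \<le> l" for k l
      unfolding Fc_def sets_past by (rule sigma_sets_mono') (use that in \<open>blast intro: order_trans\<close>)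
    show "(\<lambda>x n. x (n + h)) \<in> measurable (Fc (k + h)) (Fc k)" for h k
      unfolding Fc_def
    proof (rule measurable_past)
      fix u assume "u \<le> k"
      then have "u + h \<le> k + h" by (simp add: less_eq_vec_def)
      then show "(\<lambda>x. x (u + h)) \<in> borel_measurable (past N (\<lambda>u x. x u) (k + h))"
        by (rule past_measurable[where \<xi>="\<lambda>u x. x u"])
    qed (simp add: spN)
    show "AE x in N. real_cond_exp N (Fc l) (real_cond_exp N (Fc k) g) x = real_cond_exp N (Fc (vmin k l)) g x"
      if g: "g \<in> N.L2" for g k l
    proof (cases "l $ i\<^sub>0 \<le> k $ i\<^sub>0")
      case True
      then show ?thesis by (rule com1[OF g])
    next
      case False
      then have kl: "k $ i\<^sub>0 \<le> l $ i\<^sub>0" by simp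
      show ?thesis
        by (rule N.cond_exp_commute_adjoint[OF Fc_sub Fc_sub Fc_sub _ g])
          (use com1[OF _ kl] in \<open>simp add: vmin_commute\<close>)
    qed
  qed
qed

section \<open>Central limit theorem for fields with a projective condition\<close>

theorem theorem3:
  fixes M :: "'a measure"
    and \<xi> :: "int ^ 'd::finite \<Rightarrow> 'a \<Rightarrow> real"
    and f :: "(int ^ 'd \<Rightarrow> real) \<Rightarrow> real"
    and X S :: "int ^ 'd \<Rightarrow> 'a \<Rightarrow> real"
    and F :: "int ^ 'd \<Rightarrow> 'a measure"
    and i\<^sub>0 :: 'd
  assumes "prob_space M"
    and "stationary_field M \<xi>"
    and "f \<in> borel_measurable (\<Pi>\<^sub>M j\<in>{0..}. borel)"
    and X_def: "X = causal_field f \<xi>"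
    and "integrable M (X 0)"
    and F_def: "F = past M \<xi>"
    and S_def: "S = part_sum X"
    and "commuting M F i\<^sub>0"
    and "(\<Sum>\<^sub>\<infinity>u\<in>{1..}. ennreal (1 / vol u powr (3/2)) * L2_norm M (real_cond_exp M (F 1) (S u))) < \<infinity>"
    and "ergodic_shift M \<xi> i\<^sub>0"
  shows "\<exists>c::real.
      ((\<lambda>n. 1 / vol n * (\<integral>\<omega>. (S n \<omega>)\<^sup>2 \<partial>M)) \<longlongrightarrow> c\<^sup>2) min_at_top \<and>
      weak_conv_filter (\<lambda>n. distr M borel (\<lambda>\<omega>. 1 / sqrt (vol n) * S n \<omega>))
        (centered_normal (c\<^sup>2)) min_at_top"
proof -
  interpret M: prob_space M by (rule assms(1))
  define N where "N = field_law M \<xi>"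
  define \<Omega> :: "(int ^ 'd \<Rightarrow> real) measure" where "\<Omega> = (\<Pi>\<^sub>M n\<in>UNIV. borel)"
  define \<Phi> where "\<Phi> = (\<lambda>\<omega> n. \<xi> n \<omega>)"
  define Tc :: "int ^ 'd \<Rightarrow> (int ^ 'd \<Rightarrow> real) \<Rightarrow> int ^ 'd \<Rightarrow> real" where "Tc = (\<lambda>h x n. x (n + h))"
  define Fc where "Fc = past N (\<lambda>u x. x u)"
  have \<xi>m [measurable]: "\<xi> n \<in> borel_measurable M" for n using assms(2) by (simp add: stationary_field_def)
  have \<Phi>m: "\<Phi> \<in> measurable M \<Omega>" unfolding \<Phi>_def \<Omega>_def by (rule measurable_PiM_single') auto
  have N: "N = distr M \<Omega> \<Phi>" by (simp add: N_def field_law_def \<Omega>_def \<Phi>_def)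
  have stN: "sets N = sets \<Omega>" by (simp add: N)
  interpret C: commuting_system N Tc Fc
    unfolding N_def Tc_def Fc_def
    by (rule canonical_commuting_system(1)[OF assms(1,2) assms(8)[unfolded F_def]])
  have tr: "AE \<omega> in M. real_cond_exp M (F k) (\<lambda>\<omega>. g (\<Phi> \<omega>)) \<omega> = C.E k g (\<Phi> \<omega>)" if "integrable N g" for g k
    using canonical_commuting_system(2)[OF assms(1,2) assms(8)[unfolded F_def], of g k] that
    unfolding N_def Fc_def \<Phi>_def F_def by blast
  have \<Phi>F: "\<Phi> \<in> measurable (F k) (Fc k)" for k
    unfolding Fc_def F_def by (rule measurable_past) (auto simp: C.space_UNIV \<Phi>_def past_measurable)
  have mN: "g \<in> borel_measurable \<Omega>" if "g \<in> borel_measurable N" for g :: "(int ^ 'd \<Rightarrow> real) \<Rightarrow> real"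
    using that unfolding measurable_cong_sets[OF stN refl] .
  have int_eq: "(\<integral>\<omega>. g (\<Phi> \<omega>) \<partial>M) = (\<integral>x. g x \<partial>N)" if "g \<in> borel_measurable N" for g :: "(int ^ 'd \<Rightarrow> real) \<Rightarrow> real"
    unfolding N by (rule integral_distr[OF \<Phi>m mN[OF that], symmetric])
  have intb_eq: "integrable M (\<lambda>\<omega>. g (\<Phi> \<omega>)) \<longleftrightarrow> integrable N g" if "g \<in> borel_measurable N" for g :: "(int ^ 'd \<Rightarrow> real) \<Rightarrow> real"
    unfolding N by (rule integrable_distr_eq[OF \<Phi>m mN[OF that], symmetric])
  \<comment> \<open>the field \<open>X\<close> as the orbit of one function on the canonical space\<close>
  define \<phi> where "\<phi> x = f (\<lambda>j\<in>{0..}. x (- j))" for x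
  have \<phi>F: "\<phi> \<in> borel_measurable (Fc 0)"
    unfolding \<phi>_def
  proof (rule measurable_compose[OF _ assms(3)], rule measurable_restrict)
    fix j :: "int ^ 'd" assume "j \<in> {0..}"
    then have "- j \<le> 0" by (simp add: less_eq_vec_def)
    then show "(\<lambda>x. x (- j)) \<in> borel_measurable (Fc 0)"
      unfolding Fc_def by (rule past_measurable[where \<xi>="\<lambda>u x. x u"])
  qed
  have \<phi>m: "\<phi> \<in> borel_measurable N" by (rule C.F_meas[OF \<phi>F])
  have X: "X k = (\<lambda>\<omega>. C.sh k \<phi> (\<Phi> \<omega>))" for k
    unfolding X_def causal_field_def C.sh_def by (simp add: fun_eq_iff \<phi>_def Tc_def \<Phi>_def)
  have S: "S n = (\<lambda>\<omega>. C.S UNIV n \<phi> (\<Phi> \<omega>))" for n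
    by (simp add: fun_eq_iff S_def part_sum_def C.S_def Box_UNIV X)
  have \<phi>i: "integrable N \<phi>" using assms(5) intb_eq[OF \<phi>m] by (simp add: X)
  define a where "a u = ennreal (1 / vol u powr (3/2)) * L2_norm M (real_cond_exp M (F 1) (S u))" for u
  have a_sum: "sum a B \<le> infsum a {1..}" if "finite B" "B \<subseteq> {1..}" for B
    using that by (subst nonneg_infsum_complete) (auto intro!: SUP_upper)
  have tot: "infsum a {1..} < \<infinity>" using assms(9) by (simp add: a_def[abs_def])
  have \<phi>L: "\<phi> \<in> C.L2"
  proof -
    have i1: "integrable N (C.sh 1 \<phi>)" unfolding C.sh_def by (rule C.integrable_T[OF \<phi>i])
    have "sum a {1} < \<infinity>" using a_sum[of "{1}"] tot by (simp add: le_less_trans)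
    moreover have "vol (1 :: int ^ 'd) = 1" by (simp add: vol_def)
    ultimately have "integrable M (\<lambda>\<omega>. (real_cond_exp M (F 1) (S 1) \<omega>)\<^sup>2)"
      by (auto simp: a_def L2_norm_def split: if_splits)
    moreover have S1: "S 1 = (\<lambda>\<omega>. C.sh 1 \<phi> (\<Phi> \<omega>))" by (simp add: fun_eq_iff S_def part_sum_def X)
    have "AE \<omega> in M. real_cond_exp M (F 1) (S 1) \<omega> = C.sh 1 \<phi> (\<Phi> \<omega>)"
    proof -
      have "C.sh 1 \<phi> \<in> borel_measurable (Fc 1)" using C.sh_F[OF \<phi>F, of 1] by simp
      then have "AE x in N. C.E 1 (C.sh 1 \<phi>) x = C.sh 1 \<phi> x" by (rule C.F.real_cond_exp_F_meas[OF i1])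
      then have "AE \<omega> in M. C.E 1 (C.sh 1 \<phi>) (\<Phi> \<omega>) = C.sh 1 \<phi> (\<Phi> \<omega>)"
        unfolding N by (rule AE_distrD[OF \<Phi>m])
      with tr[OF i1, of 1] show ?thesis unfolding S1 by eventually_elim simp
    qed
    then have "AE \<omega> in M. (real_cond_exp M (F 1) (S 1) \<omega>)\<^sup>2 = (C.sh 1 \<phi> (\<Phi> \<omega>))\<^sup>2" by eventually_elim simp
    ultimately have "integrable M (\<lambda>\<omega>. (C.sh 1 \<phi> (\<Phi> \<omega>))\<^sup>2)"
      using measurable_compose[OF \<Phi>m mN[OF C.sh_meas[OF \<phi>m]]]
      by (subst (asm) integrable_cong_AE) auto
    then have "integrable N (\<lambda>x. (C.sh 1 \<phi> x)\<^sup>2)"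
      using C.sh_meas[OF \<phi>m, of 1] by (subst intb_eq[symmetric]) auto
    then have "C.sh 1 \<phi> \<in> C.L2" using C.sh_meas[OF \<phi>m, of 1] by (simp add: C.L2_def)
    then have "C.sh (- 1) (C.sh 1 \<phi>) \<in> C.L2" by (rule C.sh_L2)
    then show ?thesis by (simp add: C.sh_sh)
  qed
  have \<phi>H: "\<phi> \<in> C.H" using \<phi>L \<phi>F by (simp add: C.H_def)
  have a_eq: "a u = ennreal (vol u powr (- 3 / 2) * C.nrm (C.E 1 (C.S UNIV u \<phi>)))" for u
  proof -
    let ?h = "C.E 1 (C.S UNIV u \<phi>)"
    have hL: "?h \<in> C.L2" by (intro C.E_L2 C.S_L2 \<phi>L)
    have hm: "(\<lambda>x. (?h x)\<^sup>2) \<in> borel_measurable N" using C.L2_meas[OF hL] by measurable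
    have "AE \<omega> in M. real_cond_exp M (F 1) (S u) \<omega> = ?h (\<Phi> \<omega>)"
      unfolding S by (rule tr[OF C.L2_integrable[OF C.S_L2[OF \<phi>L]]])
    then have ae: "AE \<omega> in M. (real_cond_exp M (F 1) (S u) \<omega>)\<^sup>2 = (?h (\<Phi> \<omega>))\<^sup>2" by eventually_elim simp
    have m1: "(\<lambda>\<omega>. (?h (\<Phi> \<omega>))\<^sup>2) \<in> borel_measurable M" using measurable_compose[OF \<Phi>m mN[OF hm]] .
    have "integrable M (\<lambda>\<omega>. (?h (\<Phi> \<omega>))\<^sup>2)" using C.L2_sq[OF hL] by (simp add: intb_eq[OF hm])
    then have i: "integrable M (\<lambda>\<omega>. (real_cond_exp M (F 1) (S u) \<omega>)\<^sup>2)"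
      using ae m1 by (subst integrable_cong_AE[OF _ m1]) auto
    have "(\<integral>\<omega>. (real_cond_exp M (F 1) (S u) \<omega>)\<^sup>2 \<partial>M) = (\<integral>\<omega>. (?h (\<Phi> \<omega>))\<^sup>2 \<partial>M)"
      using ae m1 by (intro integral_cong_AE) auto
    also have "\<dots> = (\<integral>x. (?h x)\<^sup>2 \<partial>N)" by (rule int_eq[OF hm])
    finally have "L2_norm M (real_cond_exp M (F 1) (S u)) = ennreal (C.nrm ?h)"
      using i by (simp add: L2_norm_def C.nrm_def)
    moreover have "1 / vol u powr (3 / 2) = vol u powr (- 3 / 2)"
    proof -
      have "vol u powr (- 3 / 2) = vol u powr (- (3 / 2))" by (rule arg_cong[where f="(powr) (vol u)"]) simp
      also have "\<dots> = 1 / vol u powr (3 / 2)" by (rule powr_minus_divide)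
      finally show ?thesis by (rule sym)
    qed
    ultimately show ?thesis unfolding a_def by (simp only: ennreal_mult[OF powr_ge_zero C.nrm_nonneg])
  qed
  have \<phi>S: "C.summ \<phi>"
  proof (rule C.summ_I[OF \<phi>L, where B="enn2real (infsum a {1..})"])
    fix n :: "int ^ 'd"
    let ?b = "\<lambda>u. vol u powr (- 3 / 2) * C.nrm (C.E 1 (C.S UNIV u \<phi>))"
    have "ennreal (\<Sum>u\<in>Box UNIV n. ?b u) = sum a (Box UNIV n)"
      unfolding a_eq by (rule sum_ennreal[symmetric]) simp
    also have "\<dots> \<le> infsum a {1..}" by (rule a_sum) (auto simp: Box_UNIV finite_Box[of UNIV n, unfolded Box_UNIV])
    finally have "enn2real (ennreal (\<Sum>u\<in>Box UNIV n. ?b u)) \<le> enn2real (infsum a {1..})"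
      using tot by (intro enn2real_mono) auto
    then show "(\<Sum>u\<in>Box UNIV n. ?b u) \<le> enn2real (infsum a {1..})" by (simp add: sum_nonneg)
  qed
  have erg: "C.prob B = 0 \<or> C.prob B = 1" if "B \<in> sets N" "Tc (axis i\<^sub>0 1) -` B = B" for B
  proof -
    have "coord_shift i\<^sub>0 = Tc (axis i\<^sub>0 1)" by (simp add: fun_eq_iff coord_shift_def Tc_def)
    then show ?thesis using assms(10) that unfolding ergodic_shift_def N_def[symmetric] by simp
  qed
  obtain c where c: "0 \<le> c"
      "((\<lambda>n. C.nrm (C.S UNIV n \<phi>) / sqrt (vol n)) \<longlongrightarrow> c) min_at_top"
      "\<And>t. ((\<lambda>n. \<integral>x. iexp (t * (C.S UNIV n \<phi> x / sqrt (vol n))) \<partial>N) \<longlongrightarrow> complex_of_real (exp (- t\<^sup>2 * c\<^sup>2 / 2))) min_at_top"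
    using C.projective_clt[OF erg \<phi>H \<phi>S] by blast
  have Sm: "C.S UNIV n \<phi> \<in> borel_measurable N" for n by (rule C.S_meas[OF \<phi>m])
  have SmM: "S n \<in> borel_measurable M" for n unfolding S using measurable_compose[OF \<Phi>m mN[OF Sm]] .
  have var: "((\<lambda>n. 1 / vol n * (\<integral>\<omega>. (S n \<omega>)\<^sup>2 \<partial>M)) \<longlongrightarrow> c\<^sup>2) min_at_top"
  proof (rule Lim_transform_eventually[OF tendsto_power[OF c(2), of 2]])
    have "\<forall>\<^sub>F n :: int ^ 'd in min_at_top. \<forall>j. 1 \<le> n $ j" unfolding eventually_min_at_top by blast
    then show "\<forall>\<^sub>F n in min_at_top. (C.nrm (C.S UNIV n \<phi>) / sqrt (vol n))\<^sup>2 = 1 / vol n * (\<integral>\<omega>. (S n \<omega>)\<^sup>2 \<partial>M)"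
    proof eventually_elim
      fix n :: "int ^ 'd" assume "\<forall>j. 1 \<le> n $ j"
      then have "0 < vol n" unfolding vol_UNIV by (intro vol_on_pos) auto
      moreover have "(\<integral>\<omega>. (S n \<omega>)\<^sup>2 \<partial>M) = (C.nrm (C.S UNIV n \<phi>))\<^sup>2"
        unfolding S C.nrm_sq by (rule int_eq[OF borel_measurable_power[OF Sm]])
      ultimately show "(C.nrm (C.S UNIV n \<phi>) / sqrt (vol n))\<^sup>2 = 1 / vol n * (\<integral>\<omega>. (S n \<omega>)\<^sup>2 \<partial>M)"
        by (simp add: power_divide)
    qed
  qed
  have "weak_conv_filter (\<lambda>n. distr M borel (\<lambda>\<omega>. 1 / sqrt (vol n) * S n \<omega>)) (centered_normal (c\<^sup>2)) min_at_top"
  proof (rule weak_conv_filter_of_char[OF _ c(1)])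
    have m: "(\<lambda>\<omega>. 1 / sqrt (vol n) * S n \<omega>) \<in> borel_measurable M" for n using SmM[of n] by measurable
    show "real_distribution (distr M borel (\<lambda>\<omega>. 1 / sqrt (vol n) * S n \<omega>))" for n
      by (rule M.real_distribution_distr[OF m])
    have "char (distr M borel (\<lambda>\<omega>. 1 / sqrt (vol n) * S n \<omega>)) t = (\<integral>x. iexp (t * (C.S UNIV n \<phi> x / sqrt (vol n))) \<partial>N)" for n t
    proof -
      have mI: "(\<lambda>x. iexp (t * (C.S UNIV n \<phi> x / sqrt (vol n)))) \<in> borel_measurable \<Omega>"
      proof -
        note [measurable] = mN[OF Sm[of n]]
        show ?thesis by measurable
      qed
      have "char (distr M borel (\<lambda>\<omega>. 1 / sqrt (vol n) * S n \<omega>)) t = (\<integral>\<omega>. iexp (t * (1 / sqrt (vol n) * S n \<omega>)) \<partial>M)"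
        unfolding char_def by (rule integral_distr[OF m]) measurable
      also have "\<dots> = (\<integral>\<omega>. iexp (t * (C.S UNIV n \<phi> (\<Phi> \<omega>) / sqrt (vol n))) \<partial>M)" by (simp add: S)
      also have "\<dots> = (\<integral>x. iexp (t * (C.S UNIV n \<phi> x / sqrt (vol n))) \<partial>N)"
        unfolding N by (rule integral_distr[OF \<Phi>m mI, symmetric])
      finally show ?thesis .
    qed
    then show "((\<lambda>n. char (distr M borel (\<lambda>\<omega>. 1 / sqrt (vol n) * S n \<omega>)) t) \<longlongrightarrow> complex_of_real (exp (- t\<^sup>2 * c\<^sup>2 / 2))) min_at_top" for t
      using c(3)[of t] by simp
  qed
  with var show ?thesis by blast
qed

end
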